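(* Assume that $p>1$. Let $\Omega\subset X$ be a nonempty bounded open set, and let $A_0,A_1\subset\Omega$ be disjoint sets such that $\mathrm{cap}_p(A_0,A_1,\Omega)<\infty$ (which in particular happens if $\mathrm{dist}(A_0,A_1)>0$). Then there is a minimizer for the condenser $(A_0,A_1,\Omega)$, i.e. a function $u\in N^{1,p}(\Omega)$ such that $0\le u\le1$ in $\Omega$, $u=0$ in $A_0$, $u=1$ in $A_1$ and $$\mathrm{cap}_p(A_0,A_1,\Omega)=\int_\Omega g_u^p\,d\mu.$$ If $X$ has the zero $p$-weak upper gradient property, $\Omega$ is connected, and $C_p(A_0\cup A_1)>0$, then the minimizer is unique (up to sets of capacity zero).
   Context: $1\le p<\infty$ and $X=(X,d,\mu)$ is a metric space with a Borel regular measure $\mu$ (defined on the completion of the Borel $\sigma$-algebra) such that $0<\mu(B)<\infty$ for all balls $B$ (balls are nonempty and open). Curves are nonconstant, compact and rectifiable, parameterized by arc length as $\gamma:[0,l_\gamma]\to X$. A property holds for $p$-almost every curve if the family $\Gamma$ of curves for which it fails has zero $p$-modulus, i.e. there is a nonnegative Borel $\rho\in L^p(X)$ with $\int_\gamma\rho\,ds=\infty$ for every $\gamma\in\Gamma$. A nonnegative Borel function $g$ is an upper gradient of $u:X\to[-\infty,\infty]$ if $|u(\gamma(0))-u(\gamma(l_\gamma))|\le\int_\gamma g\,ds$ for all curves $\gamma$ (the left-hand side is $\infty$ whenever both terms are infinite); a nonnegative measurable $g$ is a $p$-weak upper gradient if this holds for $p$-almost every curve. If $u$ has an upper gradient in $L^p_{\rm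 loc}(X)$ (local: each point has a ball on which the property holds), its minimal $p$-weak upper gradient $g_u\in L^p_{\rm loc}(X)$ is the (a.e. unique) $p$-weak upper gradient satisfying $g_u\le g$ a.e. for every $p$-weak upper gradient $g\in L^p_{\rm loc}(X)$ of $u$. $N^{1,p}(X)$ is the set of everywhere defined measurable $u:X\to[-\infty,\infty]$ having an upper gradient in $L^p_{\rm loc}(X)$ with $\|u\|_{N^{1,p}(X)}=(\int_X|u|^p\,d\mu+\int_X g_u^p\,d\mu)^{1/p}<\infty$. For open $\Omega\subset X$, $N^{1,p}(\Omega)$ and minimal $p$-weak upper gradients of functions on $\Omega$ (also denoted $g_u$) are defined by regarding $\Omega$ as a metric space on its own. The capacity of $A\subset X$ is $C_p(A)=\inf\|u\|_{N^{1,p}(X)}^p$ over all $u\in N^{1,p}(X)$ with $u=1$ on $A$. For a nonempty bounded open $\Omega\subset X$ and disjoint $A_0,A_1\subset\Omega$, the capacity of the condenser $(A_0,A_1,\Omega)$ is $\mathrm{cap}_p(A_0,A_1,\Omega)=\inf_u\int_\Omega g_u^p\,d\mu$, where the infimum is over all $u\in N^{1,p}(\Omega)$ satisfying $0\le u\le1$ in $\Omega$, $u=0$ in $A_0$ and $u=1$ in $A_1$ (the infimum of the empty set is $\infty$). $X$ has the zero $p$-weak upper gradient property if every measurable function $f$ which has $0$ as a $p$-weak upper gradient in some ball $B(x,r)$ is essentially constant (a.e. equal to a constant) in some (possibly smaller) ball $B(x,\delta)$, where $\delta$ may depend both on $f$ and on $B(x,r)$. *)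

theory Defs
  imports "HOL-Analysis.Analysis"
begin

text \<open>
  All notions below take a measure \<open>M\<close> on a metric space type and refer to its carrier
  \<open>space M\<close> with the inherited metric as the metric measure space. The whole space \<open>X\<close> corresponds
  to \<open>space M = UNIV\<close>, and an open set \<open>\<Omega>\<close> regarded as a metric space on its own
  corresponds to \<open>restrict_space M \<Omega>\<close>. Values of functions off \<open>space M\<close> are irrelevant.
\<close>

text \<open>
  Borel regularity is implied by \<open>M\<close> being the completion of a Borel measure; it is
  listed only to match the usual wording.
\<close>

definition metric_measure_space :: "'a::metric_space measure \<Rightarrow> bool" where
  "metric_measure_space M \<longleftrightarrow>
     (\<exists>N. sets N = sets borel \<and> M = completion N) \<and>
     (\<forall>E\<in>sets M. \<exists>B\<in>sets borel. E \<subseteq> B \<and> emeasure M B = emeasure M E) \<and>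
     (\<forall>x r. 0 < r \<longrightarrow> 0 < emeasure M (ball x r) \<and> emeasure M (ball x r) < \<infinity>)"

text \<open>Powers with a positive real exponent on \<open>[0,\<infinity>]\<close>.\<close>

definition ennpowr :: "ennreal \<Rightarrow> real \<Rightarrow> ennreal" where
  "ennpowr x p = (if x = \<infinity> then \<infinity> else ennreal (enn2real x powr p))"

definition curve_length :: "(real \<Rightarrow> 'a::metric_space) \<Rightarrow> real \<Rightarrow> real \<Rightarrow> ennreal" where
  "curve_length \<gamma> a b =
     (SUP ts\<in>{ts. sorted ts \<and> set ts \<subseteq> {a..b}}.
        \<Sum>i<length ts - 1. ennreal (dist (\<gamma> (ts ! i)) (\<gamma> (ts ! Suc i))))"

text \<open>
  A curve is a pair \<open>(l, \<gamma>)\<close>, where \<open>\<gamma>\<close> is an arc length parametrization on \<open>[0,l]\<close>;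
  it is nonconstant because \<open>l > 0\<close>.
\<close>

type_synonym 'a curve = "real \<times> (real \<Rightarrow> 'a)"

definition curves :: "'a::metric_space set \<Rightarrow> 'a curve set" where
  "curves S = {(l, \<gamma>). 0 < l \<and> continuous_on {0..l} \<gamma> \<and> \<gamma> ` {0..l} \<subseteq> S \<and>
     (\<forall>t\<in>{0..l}. curve_length \<gamma> 0 t = ennreal t)}"

definition line_integral :: "('a \<Rightarrow> ennreal) \<Rightarrow> 'a curve \<Rightarrow> ennreal" where
  "line_integral g c = (\<integral>\<^sup>+t. g (snd c t) \<partial>lebesgue_on {0..fst c})"

text \<open>
  For a function \<open>g\<close> that is merely measurable with respect to \<open>M\<close>, the line integral need
  not be defined along every curve.
\<close>

definition line_integral_defined :: "('a \<Rightarrow> ennreal) \<Rightarrow> 'a curve \<Rightarrow> bool" where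
  "line_integral_defined g c \<longleftrightarrow>
     (\<lambda>t. g (snd c t)) \<in> borel_measurable (lebesgue_on {0..fst c})"

definition endpoint_diff :: "('a \<Rightarrow> ereal) \<Rightarrow> 'a curve \<Rightarrow> ennreal" where
  "endpoint_diff u c =
     (let a = u (snd c 0); b = u (snd c (fst c))
      in if \<bar>a\<bar> = \<infinity> \<and> \<bar>b\<bar> = \<infinity> then \<infinity> else e2ennreal \<bar>a - b\<bar>)"

definition zero_modulus :: "real \<Rightarrow> 'a::metric_space measure \<Rightarrow> 'a curve set \<Rightarrow> bool" where
  "zero_modulus p M \<Gamma> \<longleftrightarrow>
     (\<exists>\<rho>\<in>borel_measurable (restrict_space borel (space M)).
        (\<integral>\<^sup>+x. ennpowr (\<rho> x) p \<partial>M) < \<infinity> \<and> (\<forall>c\<in>\<Gamma>. line_integral \<rho> c = \<infinity>))"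

definition upper_gradient ::
  "'a::metric_space measure \<Rightarrow> ('a \<Rightarrow> ereal) \<Rightarrow> ('a \<Rightarrow> ennreal) \<Rightarrow> bool" where
  "upper_gradient M u g \<longleftrightarrow>
     g \<in> borel_measurable (restrict_space borel (space M)) \<and>
     (\<forall>c\<in>curves (space M). endpoint_diff u c \<le> line_integral g c)"

definition weak_upper_gradient ::
  "real \<Rightarrow> 'a::metric_space measure \<Rightarrow> ('a \<Rightarrow> ereal) \<Rightarrow> ('a \<Rightarrow> ennreal) \<Rightarrow> bool" where
  "weak_upper_gradient p M u g \<longleftrightarrow>
     g \<in> borel_measurable M \<and>
     zero_modulus p M {c \<in> curves (space M).
       \<not> (line_integral_defined g c \<and> endpoint_diff u c \<le> line_integral g c)}"

definition Lp_loc :: "real \<Rightarrow> 'a::metric_space measure \<Rightarrow> ('a \<Rightarrow> ennreal) set" where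
  "Lp_loc p M = {g \<in> borel_measurable M.
     \<forall>x\<in>space M. \<exists>r>0. (\<integral>\<^sup>+y\<in>ball x r. ennpowr (g y) p \<partial>M) < \<infinity>}"

definition is_minimal_weak_upper_gradient ::
  "real \<Rightarrow> 'a::metric_space measure \<Rightarrow> ('a \<Rightarrow> ereal) \<Rightarrow> ('a \<Rightarrow> ennreal) \<Rightarrow> bool" where
  "is_minimal_weak_upper_gradient p M u g \<longleftrightarrow>
     g \<in> Lp_loc p M \<and> weak_upper_gradient p M u g \<and>
     (\<forall>h\<in>Lp_loc p M. weak_upper_gradient p M u h \<longrightarrow> (AE x in M. g x \<le> h x))"

text \<open>
  The minimal weak upper gradient is determined only almost everywhere, hence the choice. It is
  used only for functions that have an upper gradient in \<open>Lp_loc p M\<close>.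
\<close>

definition min_weak_upper_gradient ::
  "real \<Rightarrow> 'a::metric_space measure \<Rightarrow> ('a \<Rightarrow> ereal) \<Rightarrow> 'a \<Rightarrow> ennreal" where
  "min_weak_upper_gradient p M u = (SOME g. is_minimal_weak_upper_gradient p M u g)"

definition energy :: "real \<Rightarrow> 'a::metric_space measure \<Rightarrow> ('a \<Rightarrow> ereal) \<Rightarrow> ennreal" where
  "energy p M u = (\<integral>\<^sup>+x. ennpowr (min_weak_upper_gradient p M u x) p \<partial>M)"

definition newtonian_norm :: "real \<Rightarrow> 'a::metric_space measure \<Rightarrow> ('a \<Rightarrow> ereal) \<Rightarrow> ennreal" where
  "newtonian_norm p M u =
     ennpowr ((\<integral>\<^sup>+x. ennpowr (e2ennreal \<bar>u x\<bar>) p \<partial>M) + energy p M u) (1 / p)"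

definition newtonian_space :: "real \<Rightarrow> 'a::metric_space measure \<Rightarrow> ('a \<Rightarrow> ereal) set" where
  "newtonian_space p M = {u \<in> borel_measurable M.
     (\<exists>g\<in>Lp_loc p M. upper_gradient M u g) \<and> newtonian_norm p M u < \<infinity>}"

definition sobolev_capacity :: "real \<Rightarrow> 'a::metric_space measure \<Rightarrow> 'a set \<Rightarrow> ennreal" where
  "sobolev_capacity p M A =
     (INF u\<in>{u \<in> newtonian_space p M. \<forall>x\<in>A. u x = 1}. ennpowr (newtonian_norm p M u) p)"

definition condenser_admissible ::
  "real \<Rightarrow> 'a::metric_space measure \<Rightarrow> 'a set \<Rightarrow> 'a set \<Rightarrow> 'a set \<Rightarrow> ('a \<Rightarrow> ereal) set" where
  "condenser_admissible p M A\<^sub>0 A\<^sub>1 \<Omega> =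
     {u \<in> newtonian_space p (restrict_space M \<Omega>).
        (\<forall>x\<in>\<Omega>. 0 \<le> u x \<and> u x \<le> 1) \<and> (\<forall>x\<in>A\<^sub>0. u x = 0) \<and> (\<forall>x\<in>A\<^sub>1. u x = 1)}"

definition condenser_capacity ::
  "real \<Rightarrow> 'a::metric_space measure \<Rightarrow> 'a set \<Rightarrow> 'a set \<Rightarrow> 'a set \<Rightarrow> ennreal" where
  "condenser_capacity p M A\<^sub>0 A\<^sub>1 \<Omega> =
     (INF u\<in>condenser_admissible p M A\<^sub>0 A\<^sub>1 \<Omega>. energy p (restrict_space M \<Omega>) u)"

definition condenser_minimizer ::
  "real \<Rightarrow> 'a::metric_space measure \<Rightarrow> 'a set \<Rightarrow> 'a set \<Rightarrow> 'a set \<Rightarrow> ('a \<Rightarrow> ereal) \<Rightarrow> bool" where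
  "condenser_minimizer p M A\<^sub>0 A\<^sub>1 \<Omega> u \<longleftrightarrow>
     u \<in> condenser_admissible p M A\<^sub>0 A\<^sub>1 \<Omega> \<and>
     condenser_capacity p M A\<^sub>0 A\<^sub>1 \<Omega> = energy p (restrict_space M \<Omega>) u"

definition zero_weak_upper_gradient_property ::
  "real \<Rightarrow> 'a::metric_space measure \<Rightarrow> bool" where
  "zero_weak_upper_gradient_property p M \<longleftrightarrow>
     (\<forall>f :: 'a \<Rightarrow> ereal. f \<in> borel_measurable M \<longrightarrow>
       (\<forall>x r. 0 < r \<longrightarrow> weak_upper_gradient p (restrict_space M (ball x r)) f (\<lambda>_. 0) \<longrightarrow>
         (\<exists>\<delta> c. 0 < \<delta> \<and> \<delta> \<le> r \<and> (AE y in M. y \<in> ball x \<delta> \<longrightarrow> f y = c))))"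

text \<open>
  Unlike \<open>setdist\<close>, this distance is \<open>\<infinity>\<close> when one of the sets is empty.
\<close>

definition set_distance :: "'a::metric_space set \<Rightarrow> 'a set \<Rightarrow> ennreal" where
  "set_distance A B = (INF x\<in>A. INF y\<in>B. ennreal (dist x y))"

end

theory Submission
  imports Defs
begin

text \<open>
  On an open set \<open>\<Omega>\<close> of finite measure, take admissible functions \<open>v\<^sub>n\<close> whose energies tend to the
  capacity and which, among such functions, almost minimize the \<open>L\<^sup>p\<close>-norm. Midpoints are admissible,
  so uniform convexity of \<open>L\<^sup>p\<close> makes both the \<open>v\<^sub>n\<close> and their minimal weak upper gradients Cauchy
  sequences. Along a rapidly converging subsequence the gradients are dominated by one function in
  \<open>L\<^sup>p\<close>; hence on almost every curve the \<open>v\<^sub>n\<close> are equicontinuous, converge everywhere, and the limit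
  is a minimizer with the prescribed boundary values.

  If \<open>u\<close> and \<open>v\<close> are minimizers, uniform convexity gives a common minimal gradient \<open>g\<close>. The competitor
  \<open>max u (min v a)\<close> equals \<open>a\<close> where \<open>u \<le> a \<le> v\<close> and so has no gradient there, which forces \<open>g = 0\<close>
  where \<open>u \<noteq> v\<close>. Hence \<open>u - v\<close> has zero weak upper gradient, is constant almost everywhere by
  connectedness, and is then equal to that constant outside a set of capacity zero. The constant is
  \<open>0\<close> since \<open>u - v\<close> vanishes on \<open>A\<^sub>0 \<union> A\<^sub>1\<close>, which has positive capacity.
\<close>

section \<open>Subcurves\<close>

text \<open>The analysis takes place on intervals. An upper gradient inequality valid on almost
  every curve is valid on all subcurves of almost every curve. Along the arc length parametrization,
  \<open>F\<close> and \<open>g\<close> then satisfy \<open>|F s - F t| <= \<integral> g\<close>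
  over every interval from \<open>s\<close> to \<open>t\<close>, and minima, limits and level sets
  are treated in this one-dimensional form.

  Two obstacles shape the argument. Near-minimal energy controls the gradients but, without a
  Poincare inequality, not the functions; hence the second minimization, of the norm. And null sets
  matter, since boundary values are prescribed pointwise and uniqueness is claimed up to capacity
  zero. Limits are therefore taken pointwise, and exceptional sets are shown to be met by almost no
  curve.

  Uniform convexity gives strong convergence of the chosen sequence itself, where weak compactness
  would give it only for convex combinations. Separability is not assumed: countable covers come
  from finite total measure and positive measure of balls.\<close>

definition polygon_length :: "(real \<Rightarrow> 'a::metric_space) \<Rightarrow> real list \<Rightarrow> ennreal" where
  "polygon_length \<gamma> ts = (\<Sum>i<length ts - 1. ennreal (dist (\<gamma> (ts ! i)) (\<gamma> (ts ! Suc i))))"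

lemma polygon_length_simps [simp]:
  "polygon_length \<gamma> [] = 0" "polygon_length \<gamma> [x] = 0"
  "polygon_length \<gamma> (x # y # ts) = ennreal (dist (\<gamma> x) (\<gamma> y)) + polygon_length \<gamma> (y # ts)"
  by (simp_all add: polygon_length_def sum.lessThan_Suc_shift del: sum.lessThan_Suc)

lemma polygon_length_append_Cons:
  "polygon_length \<gamma> (xs @ m # ys) = polygon_length \<gamma> (xs @ [m]) + polygon_length \<gamma> (m # ys)"
proof (induction xs)
  case (Cons x xs)
  then show ?case by (cases xs) (auto simp: add.assoc)
qed simp

text \<open>The segment joining the two polygons is dropped, hence only an inequality.\<close>

lemma polygon_length_append:
  "polygon_length \<gamma> xs + polygon_length \<gamma> ys \<le> polygon_length \<gamma> (xs @ ys)"
proof (induction xs)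
  case (Cons x xs)
  show ?case
  proof (cases xs)
    case Nil
    then show ?thesis by (cases ys) auto
  next
    case (Cons z zs)
    then show ?thesis using Cons.IH by (auto simp: add.assoc intro!: add_left_mono)
  qed
qed simp

lemma polygon_length_insert:
  "polygon_length \<gamma> (xs @ ys) \<le> polygon_length \<gamma> (xs @ m # ys)"
proof (induction xs)
  case Nil
  then show ?case by (cases ys) auto
next
  case (Cons x xs)
  show ?case
  proof (cases xs)
    case Nil
    show ?thesis
    proof (cases ys)
      case (Cons y zs)
      have "ennreal (dist (\<gamma> x) (\<gamma> y)) \<le> ennreal (dist (\<gamma> x) (\<gamma> m)) + ennreal (dist (\<gamma> m) (\<gamma> y))"
        by (simp add: ennreal_plus[symmetric] dist_triangle del: ennreal_plus)
      then show ?thesis using Nil Cons by (auto simp: add.assoc[symmetric] intro!: add_right_mono)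
    qed (use Nil in auto)
  next
    case (Cons z zs)
    then show ?thesis using Cons.IH by (auto intro!: add_left_mono)
  qed
qed

lemma curve_length_eq_polygon:
  "curve_length \<gamma> a b = (SUP ts\<in>{ts. sorted ts \<and> set ts \<subseteq> {a..b}}. polygon_length \<gamma> ts)"
  by (simp add: curve_length_def polygon_length_def)

text \<open>Inserting \<open>m\<close> as a vertex never shortens a polygon, and a polygon with
  vertex \<open>m\<close> splits exactly there; this gives one inequality. Concatenating polygons of
  the two pieces gives the other.\<close>

lemma curve_length_add:
  assumes "a \<le> m" "m \<le> b"
  shows "curve_length \<gamma> a b = curve_length \<gamma> a m + curve_length \<gamma> m b"
proof (rule antisym)
  let ?S = "\<lambda>a b. {ts. sorted ts \<and> set ts \<subseteq> {a..b::real}}"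
  show "curve_length \<gamma> a b \<le> curve_length \<gamma> a m + curve_length \<gamma> m b"
    unfolding curve_length_eq_polygon[of \<gamma> a b]
  proof (rule SUP_least)
    fix ts assume ts: "ts \<in> ?S a b"
    let ?x = "takeWhile (\<lambda>t. t \<le> m) ts" and ?y = "dropWhile (\<lambda>t. t \<le> m) ts"
    have "polygon_length \<gamma> ts \<le> polygon_length \<gamma> (?x @ m # ?y)"
      using polygon_length_insert[of \<gamma> ?x ?y] by simp
    also have "\<dots> = polygon_length \<gamma> (?x @ [m]) + polygon_length \<gamma> (m # ?y)"
      by (rule polygon_length_append_Cons)
    also have "\<dots> \<le> curve_length \<gamma> a m + curve_length \<gamma> m b"
      unfolding curve_length_eq_polygon
    proof (intro add_mono SUP_upper)
      show "?x @ [m] \<in> ?S a m"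
        using ts assms by (force simp: sorted_append sorted_takeWhile dest: set_takeWhileD)
      have "t \<ge> m" if "t \<in> set ?y" for t
      proof (cases ?y)
        case Nil
        with that have "t \<in> set []" by (simp only:)
        then show ?thesis by simp
      next
        case (Cons z zs)
        have "sorted ?y" using ts by (simp add: sorted_dropWhile)
        moreover have "\<not> z \<le> m" using Cons by (auto simp: dropWhile_eq_Cons_conv)
        ultimately show ?thesis using that Cons by auto
      qed
      then show "m # ?y \<in> ?S m b"
        using ts assms by (auto simp: sorted_dropWhile dest: set_dropWhileD)
    qed
    finally show "polygon_length \<gamma> ts \<le> curve_length \<gamma> a m + curve_length \<gamma> m b" .
  qed
  have ne: "?S a b \<noteq> {}" for a b by (auto intro!: exI[of _ "[]"])
  have "polygon_length \<gamma> ts + polygon_length \<gamma> us \<le> curve_length \<gamma> a b"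
    if "ts \<in> ?S a m" "us \<in> ?S m b" for ts us
  proof -
    have "ts @ us \<in> ?S a b"
      using that assms by (simp add: sorted_append subset_iff) (meson order_trans)
    then have "polygon_length \<gamma> (ts @ us) \<le> curve_length \<gamma> a b"
      unfolding curve_length_eq_polygon by (rule SUP_upper)
    with polygon_length_append show ?thesis by (rule order_trans)
  qed
  then have "(SUP us\<in>?S m b. SUP ts\<in>?S a m. polygon_length \<gamma> ts + polygon_length \<gamma> us) \<le> curve_length \<gamma> a b"
    by (intro SUP_least)
  then show "curve_length \<gamma> a m + curve_length \<gamma> m b \<le> curve_length \<gamma> a b"
    unfolding curve_length_eq_polygon[of \<gamma> a m] curve_length_eq_polygon[of \<gamma> m b]
      ennreal_SUP_add_right[OF ne] ennreal_SUP_add_left[OF ne, symmetric] by simp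
qed

lemma curve_length_shift:
  "curve_length (\<lambda>r. \<gamma> (s + r)) a b = curve_length \<gamma> (s + a) (s + b)"
proof -
  have P: "polygon_length (\<lambda>r. \<gamma> (s + r)) ts = polygon_length \<gamma> (map ((+) s) ts)" for ts
    by (simp add: polygon_length_def)
  have "{ts. sorted ts \<and> set ts \<subseteq> {s + a..s + b}} = map ((+) s) ` {ts. sorted ts \<and> set ts \<subseteq> {a..b}}"
  proof (intro equalityI subsetI)
    fix ts assume "ts \<in> {ts. sorted ts \<and> set ts \<subseteq> {s + a..s + b}}"
    then show "ts \<in> map ((+) s) ` {ts. sorted ts \<and> set ts \<subseteq> {a..b}}"
      by (intro image_eqI[of _ _ "map (\<lambda>t. t - s) ts"])
         (force simp: comp_def sorted_map sorted_wrt_iff_nth_less)+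
  qed (auto simp: sorted_map sorted_wrt_iff_nth_less subset_iff)
  then show ?thesis
    by (simp add: curve_length_eq_polygon P image_image)
qed

lemma dist_le_curve_length:
  assumes "s \<le> t" shows "ennreal (dist (\<gamma> s) (\<gamma> t)) \<le> curve_length \<gamma> s t"
  unfolding curve_length_eq_polygon
  by (rule SUP_upper2[of "[s, t]"]) (use assms in auto)

text \<open>\<open>curves\<close> prescribes lengths from the initial point only. Additivity gives
  the other pieces, because the finite length \<open>s\<close> can be cancelled.\<close>

lemma curves_curve_length:
  assumes "(l, \<gamma>) \<in> curves S" "0 \<le> s" "s \<le> t" "t \<le> l"
  shows "curve_length \<gamma> s t = ennreal (t - s)"
proof -
  have "ennreal s + curve_length \<gamma> s t = ennreal t"
    using curve_length_add[of 0 s t \<gamma>] assms by (auto simp: curves_def)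
  then have "ennreal s + curve_length \<gamma> s t = ennreal s + ennreal (t - s)"
    using assms by (simp add: ennreal_plus[symmetric] del: ennreal_plus)
  then show ?thesis by (simp add: ennreal_add_left_cancel)
qed

section \<open>Line integrals along subcurves\<close>

definition subcurve :: "real \<Rightarrow> real \<Rightarrow> 'a curve \<Rightarrow> 'a curve" where
  "subcurve s t c = (t - s, \<lambda>r. snd c (s + r))"

lemma subcurve_curves:
  assumes "c \<in> curves S" "0 \<le> s" "s < t" "t \<le> fst c" "snd c ` {s..t} \<subseteq> T"
  shows "subcurve s t c \<in> curves T"
proof -
  obtain l \<gamma> where c: "c = (l, \<gamma>)" by force
  have "continuous_on {0..t - s} (\<lambda>r. \<gamma> (s + r))"
    by (rule continuous_on_compose2[of "{0..l}" \<gamma>])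
       (use assms c in \<open>auto simp: curves_def intro!: continuous_intros\<close>)
  moreover have "curve_length (\<lambda>r. \<gamma> (s + r)) 0 r = ennreal r" if "r \<in> {0..t - s}" for r
    using curves_curve_length[of l \<gamma> S s "s + r"] that assms c by (simp add: curve_length_shift)
  ultimately show ?thesis
    using assms c by (auto simp: subcurve_def curves_def)
qed

lemma endpoint_diff_subcurve:
  assumes "0 \<le> s" "s < t"
  shows "endpoint_diff (\<lambda>x. ereal (f x)) (subcurve s t c) = ennreal \<bar>f (snd c s) - f (snd c t)\<bar>"
  by (simp add: endpoint_diff_def subcurve_def e2ennreal_ereal)

lemma endpoint_diff_real:
  "endpoint_diff (\<lambda>x. ereal (f x)) c = ennreal \<bar>f (snd c 0) - f (snd c (fst c))\<bar>"
  by (simp add: endpoint_diff_def e2ennreal_ereal)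

text \<open>The integrand is cut off outside the parameter interval, so that it can be treated as a
  function on the whole line.\<close>

definition along :: "('a \<Rightarrow> ennreal) \<Rightarrow> 'a curve \<Rightarrow> real \<Rightarrow> ennreal" where
  "along g c t = g (snd c t) * indicator {0..fst c} t"

lemma line_integral_defined_iff:
  "line_integral_defined g c \<longleftrightarrow> along g c \<in> borel_measurable lebesgue"
  unfolding line_integral_defined_def along_def
  by (rule borel_measurable_restrict_space_iff_ennreal) simp

lemma line_integral_eq: "line_integral g c = (\<integral>\<^sup>+t. along g c t \<partial>lebesgue)"
  unfolding line_integral_def along_def by (rule nn_integral_restrict_space) simp

text \<open>Translation invariance moves the parameter interval of the subcurve back into that of
  \<open>c\<close>; the omitted endpoint \<open>s\<close> is a null set.\<close>

lemma line_integral_subcurve: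
  assumes "along g c \<in> borel_measurable lebesgue" "0 \<le> s" "s < t" "t \<le> fst c"
  shows "line_integral g (subcurve s t c) = (\<integral>\<^sup>+r\<in>{s<..t}. along g c r \<partial>lebesgue)"
proof -
  have "(\<integral>\<^sup>+r\<in>{s<..t}. along g c r \<partial>lebesgue) = (\<integral>\<^sup>+r\<in>{s..t}. along g c r \<partial>lebesgue)"
    by (rule nn_integral_cong_AE)
       (use AE_lborel_singleton[of s, THEN AE_completion] in eventually_elim, auto split: split_indicator)
  also have "\<dots> = (\<integral>\<^sup>+r. along g c (s + 1 * r) * indicator {s..t} (s + 1 * r) \<partial>lebesgue)"
    by (subst nn_integral_real_affine_lebesgue[where t=s and c=1])
       (use assms in \<open>auto intro!: borel_measurable_times_ennreal borel_measurable_indicator\<close>)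
  also have "\<dots> = line_integral g (subcurve s t c)"
    unfolding line_integral_eq
    by (rule nn_integral_cong) (use assms in \<open>auto simp: along_def subcurve_def split: split_indicator\<close>)
  finally show ?thesis ..
qed

abbreviation borel_on :: "'a::topological_space set \<Rightarrow> ('a \<Rightarrow> 'b::topological_space) set" where
  "borel_on S \<equiv> borel_measurable (restrict_space borel S)"

text \<open>Curves are continuous, so composition preserves Borel functions. For functions
  measurable only with respect to the completion, the same can be obtained merely on almost every
  curve.\<close>

lemma along_borel:
  assumes "g \<in> borel_on S" "c \<in> curves S"
  shows "along g c \<in> borel_measurable lebesgue"
proof -
  obtain l \<gamma> where c: "c = (l, \<gamma>)" by force
  have "\<gamma> \<in> restrict_space borel {0..l} \<rightarrow>\<^sub>M restrict_space borel S"
    using assms(2) c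
    by (intro measurable_restrict_space2 borel_measurable_continuous_on_restrict)
       (auto simp: curves_def space_restrict_space)
  then have "(\<lambda>t. g (\<gamma> t)) \<in> borel_measurable (restrict_space borel {0..l})"
    using assms(1) by (rule measurable_compose)
  then have "along g c \<in> borel_measurable borel"
    unfolding along_def c by (subst (asm) borel_measurable_restrict_space_iff_ennreal) auto
  then show ?thesis by (auto intro: measurable_completion)
qed

lemma subcurve_integral_le:
  assumes "g \<in> borel_on S" "c \<in> curves S" "0 \<le> s" "s < t" "t \<le> fst c"
  shows "line_integral g (subcurve s t c) \<le> line_integral g c"
  unfolding line_integral_subcurve[OF along_borel[OF assms(1,2)] assms(3-5)] line_integral_eq[of g c]
  by (rule nn_integral_mono) (auto split: split_indicator)

section \<open>Gradient bounds on an interval\<close>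

text \<open>For integrable \<open>g\<close> this says that \<open>F\<close> is absolutely continuous
  on \<open>[0,l]\<close> with derivative bounded in modulus by \<open>g\<close> almost everywhere.
  The integral form needs no differentiation, and half-open intervals let adjacent pieces add up
  exactly.\<close>

definition interval_gradient :: "real \<Rightarrow> (real \<Rightarrow> real) \<Rightarrow> (real \<Rightarrow> ennreal) \<Rightarrow> bool" where
  "interval_gradient l F g \<longleftrightarrow> (\<forall>s t. 0 \<le> s \<longrightarrow> s \<le> t \<longrightarrow> t \<le> l \<longrightarrow>
     ennreal \<bar>F s - F t\<bar> \<le> (\<integral>\<^sup>+r\<in>{s<..t}. g r \<partial>lebesgue))"

lemma interval_gradientD:
  "interval_gradient l F g \<Longrightarrow> 0 \<le> s \<Longrightarrow> s \<le> t \<Longrightarrow> t \<le> l \<Longrightarrow>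
     ennreal \<bar>F s - F t\<bar> \<le> (\<integral>\<^sup>+r\<in>{s<..t}. g r \<partial>lebesgue)"
  by (simp add: interval_gradient_def)

lemma interval_gradient_mono_AE:
  assumes "interval_gradient l F g" "AE r in lebesgue. r \<in> {0..l} \<longrightarrow> g r \<le> h r"
  shows "interval_gradient l F h"
  unfolding interval_gradient_def
proof (intro allI impI)
  fix s t :: real assume st: "0 \<le> s" "s \<le> t" "t \<le> l"
  have "(\<integral>\<^sup>+r\<in>{s<..t}. g r \<partial>lebesgue) \<le> (\<integral>\<^sup>+r\<in>{s<..t}. h r \<partial>lebesgue)"
    by (rule nn_integral_mono_AE)
       (use assms(2) in eventually_elim, use st in \<open>auto split: split_indicator\<close>)
  with interval_gradientD[OF assms(1) st] show "ennreal \<bar>F s - F t\<bar> \<le> (\<integral>\<^sup>+r\<in>{s<..t}. h r \<partial>lebesgue)"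
    by (rule order_trans)
qed

lemma interval_gradient_cong_AE:
  assumes "AE r in lebesgue. g r = h r"
  shows "interval_gradient l F g \<longleftrightarrow> interval_gradient l F h"
proof
  show "interval_gradient l F h" if "interval_gradient l F g"
    by (rule interval_gradient_mono_AE[OF that]) (use assms in eventually_elim, simp)
  show "interval_gradient l F g" if "interval_gradient l F h"
    by (rule interval_gradient_mono_AE[OF that]) (use assms in eventually_elim, simp)
qed

lemma set_nn_integral_split:
  fixes g :: "real \<Rightarrow> ennreal"
  assumes "g \<in> borel_measurable lebesgue" "s \<le> m" "m \<le> t"
  shows "(\<integral>\<^sup>+r\<in>{s<..t}. g r \<partial>lebesgue) =
    (\<integral>\<^sup>+r\<in>{s<..m}. g r \<partial>lebesgue) + (\<integral>\<^sup>+r\<in>{m<..t}. g r \<partial>lebesgue)"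
proof -
  have "(\<integral>\<^sup>+r\<in>{s<..m}. g r \<partial>lebesgue) + (\<integral>\<^sup>+r\<in>{m<..t}. g r \<partial>lebesgue) =
      (\<integral>\<^sup>+r. (g r * indicator {s<..m} r + g r * indicator {m<..t} r) \<partial>lebesgue)"
    using assms
    by (intro nn_integral_add[symmetric] borel_measurable_times_ennreal borel_measurable_indicator) auto
  also have "\<dots> = (\<integral>\<^sup>+r\<in>{s<..t}. g r \<partial>lebesgue)"
    by (rule nn_integral_cong) (use assms in \<open>auto split: split_indicator\<close>)
  finally show ?thesis ..
qed

lemma set_nn_integral_finite:
  assumes "(\<integral>\<^sup>+r. g r \<partial>M) < \<infinity>"
  shows "(\<integral>\<^sup>+r\<in>A. g r \<partial>M) < \<infinity>"
proof -
  have "(\<integral>\<^sup>+r\<in>A. g r \<partial>M) \<le> (\<integral>\<^sup>+r. g r \<partial>M)"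
    by (rule nn_integral_mono) (auto split: split_indicator)
  with assms show ?thesis by (rule le_less_trans[rotated])
qed

text \<open>Monotone convergence from above, for which \<open>g 0\<close> must have finite
  integral.\<close>

lemma interval_gradient_INF:
  assumes "\<And>n::nat. interval_gradient l F (g n)" "\<And>n. g n \<in> borel_measurable lebesgue"
    and "decseq g" "(\<integral>\<^sup>+r. g 0 r \<partial>lebesgue) < \<infinity>"
  shows "interval_gradient l F (\<lambda>r. INF n. g n r)"
  unfolding interval_gradient_def
proof (intro allI impI)
  fix s t :: real assume st: "0 \<le> s" "s \<le> t" "t \<le> l"
  have "(INF n. g n r) * indicator A r = (INF n. g n r * indicator A r)" for r and A :: "real set"
    by (auto split: split_indicator)
  then have "(\<integral>\<^sup>+r\<in>{s<..t}. (INF n. g n r) \<partial>lebesgue) = (\<integral>\<^sup>+r. (INF n. g n r * indicator {s<..t} r) \<partial>lebesgue)"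
    by simp
  also have "\<dots> = (INF n. \<integral>\<^sup>+r\<in>{s<..t}. g n r \<partial>lebesgue)"
  proof (rule nn_integral_monotone_convergence_INF_decseq[where i=0])
    show "decseq (\<lambda>n r. g n r * indicator {s<..t} r)"
      using assms(3) by (intro decseq_SucI le_funI mult_right_mono) (auto dest: decseq_SucD le_funD)
  qed (use assms(2) set_nn_integral_finite[OF assms(4), of "{s<..t}"] in
         \<open>auto intro!: borel_measurable_times_ennreal borel_measurable_indicator\<close>)
  also have "\<dots> \<ge> ennreal \<bar>F s - F t\<bar>"
    by (intro INF_greatest interval_gradientD[OF assms(1) st])
  finally show "ennreal \<bar>F s - F t\<bar> \<le> (\<integral>\<^sup>+r\<in>{s<..t}. (INF n. g n r) \<partial>lebesgue)" .
qed

text \<open>The sets along which two gradients can be spliced form a \<open>\<sigma>\<close>-algebra containing the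
  half-lines, since splicing can be iterated.\<close>

definition splicing :: "real \<Rightarrow> (real \<Rightarrow> real) \<Rightarrow> real set \<Rightarrow> bool" where
  "splicing l F C \<longleftrightarrow> C \<in> sets lebesgue \<and> (\<forall>g h.
     g \<in> borel_measurable lebesgue \<longrightarrow> (\<integral>\<^sup>+r. g r \<partial>lebesgue) < \<infinity> \<longrightarrow> interval_gradient l F g \<longrightarrow>
     h \<in> borel_measurable lebesgue \<longrightarrow> (\<integral>\<^sup>+r. h r \<partial>lebesgue) < \<infinity> \<longrightarrow> interval_gradient l F h \<longrightarrow>
     interval_gradient l F (\<lambda>r. if r \<in> C then g r else h r))"

text \<open>The spliced gradient has all the properties required of \<open>g\<close> and
  \<open>h\<close>, so it can be spliced again.\<close>

lemma splicingD:
  assumes "splicing l F C"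
    "g \<in> borel_measurable lebesgue" "(\<integral>\<^sup>+r. g r \<partial>lebesgue) < \<infinity>" "interval_gradient l F g"
    "h \<in> borel_measurable lebesgue" "(\<integral>\<^sup>+r. h r \<partial>lebesgue) < \<infinity>" "interval_gradient l F h"
  shows "(\<lambda>r. if r \<in> C then g r else h r) \<in> borel_measurable lebesgue"
    "(\<integral>\<^sup>+r. (if r \<in> C then g r else h r) \<partial>lebesgue) < \<infinity>"
    "interval_gradient l F (\<lambda>r. if r \<in> C then g r else h r)"
proof -
  show "(\<lambda>r. if r \<in> C then g r else h r) \<in> borel_measurable lebesgue"
    using assms by (intro measurable_If_set) (auto simp: splicing_def)
  have "(\<integral>\<^sup>+r. (if r \<in> C then g r else h r) \<partial>lebesgue) \<le> (\<integral>\<^sup>+r. g r + h r \<partial>lebesgue)"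
    by (rule nn_integral_mono) auto
  also have "\<dots> < \<infinity>"
    using assms by (subst nn_integral_add) auto
  finally show "(\<integral>\<^sup>+r. (if r \<in> C then g r else h r) \<partial>lebesgue) < \<infinity>" .
  show "interval_gradient l F (\<lambda>r. if r \<in> C then g r else h r)"
    using assms by (auto simp: splicing_def)
qed

lemma splicing_Compl: "splicing l F C \<Longrightarrow> splicing l F (- C)"
proof -
  have eq: "(\<lambda>r. if r \<in> - C then g r else h r) = (\<lambda>r. if r \<in> C then h r else g r)" for g h :: "real \<Rightarrow> ennreal"
    by auto
  assume "splicing l F C"
  then show ?thesis
    unfolding splicing_def eq by (simp add: Compl_in_sets_lebesgue)
qed

text \<open>Splice along \<open>D\<close> first and use the result in place of \<open>h\<close> when
  splicing along \<open>C\<close>.\<close>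

lemma splicing_Un:
  assumes "splicing l F C" "splicing l F D"
  shows "splicing l F (C \<union> D)"
  unfolding splicing_def
proof (intro conjI allI impI)
  show "C \<union> D \<in> sets lebesgue" using assms by (auto simp: splicing_def)
  fix g h :: "real \<Rightarrow> ennreal"
  assume g: "g \<in> borel_measurable lebesgue" "(\<integral>\<^sup>+r. g r \<partial>lebesgue) < \<infinity>" "interval_gradient l F g"
    and h: "h \<in> borel_measurable lebesgue" "(\<integral>\<^sup>+r. h r \<partial>lebesgue) < \<infinity>" "interval_gradient l F h"
  have "(\<lambda>r. if r \<in> C \<union> D then g r else h r) = (\<lambda>r. if r \<in> C then g r else if r \<in> D then g r else h r)"
    by auto
  with splicingD(3)[OF assms(1) g splicingD[OF assms(2) g h]]
  show "interval_gradient l F (\<lambda>r. if r \<in> C \<union> D then g r else h r)" by simp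
qed

text \<open>Finite unions increase to the full union, and dominated convergence with the integrable
  bound \<open>g + h\<close> carries the integral inequalities to the limit.\<close>

lemma splicing_Union:
  assumes "\<And>n::nat. splicing l F (C n)"
  shows "splicing l F (\<Union>n. C n)"
  unfolding splicing_def
proof (intro conjI allI impI)
  show meas: "(\<Union>n. C n) \<in> sets lebesgue" using assms by (auto simp: splicing_def)
  fix g h :: "real \<Rightarrow> ennreal"
  assume g: "g \<in> borel_measurable lebesgue" "(\<integral>\<^sup>+r. g r \<partial>lebesgue) < \<infinity>" "interval_gradient l F g"
    and h: "h \<in> borel_measurable lebesgue" "(\<integral>\<^sup>+r. h r \<partial>lebesgue) < \<infinity>" "interval_gradient l F h"
  define D where "D n = (\<Union>i\<le>n. C i)" for n
  have D: "splicing l F (D n)" for n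
    by (induction n) (auto simp: D_def atMost_Suc assms splicing_Un)
  define k where "k n r = (if r \<in> D n then g r else h r)" for n r
  define k' where "k' r = (if r \<in> (\<Union>n. C n) then g r else h r)" for r
  have k: "k n \<in> borel_measurable lebesgue" "interval_gradient l F (k n)" for n
    using splicingD[OF D g h] by (simp_all add: k_def[abs_def])
  have k_le: "k n r \<le> g r + h r" for n r
    by (simp add: k_def)
  have k': "k' \<in> borel_measurable lebesgue"
    using meas g h unfolding k'_def by (intro measurable_If_set) auto
  have lim: "(\<lambda>n. k n r) \<longlonglongrightarrow> k' r" for r
  proof (cases "r \<in> (\<Union>n. C n)")
    case True
    then obtain i where "r \<in> C i" by auto
    then have "\<forall>n\<ge>i. k n r = k' r" by (auto simp: k_def k'_def D_def)
    then show ?thesis by (intro tendsto_eventually) (auto simp: eventually_sequentially)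
  qed (auto simp: k_def k'_def D_def)
  have "interval_gradient l F k'"
    unfolding interval_gradient_def
  proof (intro allI impI)
    fix s t :: real assume st: "0 \<le> s" "s \<le> t" "t \<le> l"
    have "(\<lambda>n. \<integral>\<^sup>+r\<in>{s<..t}. k n r \<partial>lebesgue) \<longlonglongrightarrow> (\<integral>\<^sup>+r\<in>{s<..t}. k' r \<partial>lebesgue)"
    proof (rule nn_integral_dominated_convergence[where w="\<lambda>r. g r + h r"])
      show "(\<integral>\<^sup>+r. g r + h r \<partial>lebesgue) < \<infinity>"
        using g h by (subst nn_integral_add) auto
      show "AE r in lebesgue. (\<lambda>n. k n r * indicator {s<..t} r) \<longlonglongrightarrow> k' r * indicator {s<..t} r"
        using lim by (auto split: split_indicator)
    qed (use g h k(1) k' k_le in \<open>auto split: split_indicator intro!: borel_measurable_times_ennreal borel_measurable_indicator\<close>)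
    then show "ennreal \<bar>F s - F t\<bar> \<le> (\<integral>\<^sup>+r\<in>{s<..t}. k' r \<partial>lebesgue)"
      by (rule LIMSEQ_le_const) (use interval_gradientD[OF k(2) st] in blast)
  qed
  then show "interval_gradient l F (\<lambda>r. if r \<in> (\<Union>n. C n) then g r else h r)"
    by (simp add: k'_def[abs_def])
qed

text \<open>An interval on one side of \<open>a\<close> sees only one of the gradients. An interval
  across \<open>a\<close> is cut there, and the triangle inequality for \<open>F\<close> matches the
  additivity of the integral.\<close>

lemma splicing_atMost: "splicing l F {..a}"
  unfolding splicing_def
proof (intro conjI allI impI)
  show "{..a} \<in> sets lebesgue" by simp
  fix g h :: "real \<Rightarrow> ennreal"
  assume g: "g \<in> borel_measurable lebesgue" "(\<integral>\<^sup>+r. g r \<partial>lebesgue) < \<infinity>" "interval_gradient l F g"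
    and h: "h \<in> borel_measurable lebesgue" "(\<integral>\<^sup>+r. h r \<partial>lebesgue) < \<infinity>" "interval_gradient l F h"
  let ?k = "\<lambda>r. if r \<in> {..a} then g r else h r"
  have k: "?k \<in> borel_measurable lebesgue"
    using g h by (intro measurable_If_set) auto
  have below: "ennreal \<bar>F s - F t\<bar> \<le> (\<integral>\<^sup>+r\<in>{s<..t}. ?k r \<partial>lebesgue)"
    if "0 \<le> s" "s \<le> t" "t \<le> l" "t \<le> a" for s t
  proof -
    have "(\<integral>\<^sup>+r\<in>{s<..t}. g r \<partial>lebesgue) = (\<integral>\<^sup>+r\<in>{s<..t}. ?k r \<partial>lebesgue)"
      by (rule nn_integral_cong) (use that in \<open>auto split: split_indicator\<close>)
    with interval_gradientD[OF g(3) that(1-3)] show ?thesis by simp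
  qed
  have above: "ennreal \<bar>F s - F t\<bar> \<le> (\<integral>\<^sup>+r\<in>{s<..t}. ?k r \<partial>lebesgue)"
    if "0 \<le> s" "s \<le> t" "t \<le> l" "a \<le> s" for s t
  proof -
    have "(\<integral>\<^sup>+r\<in>{s<..t}. h r \<partial>lebesgue) = (\<integral>\<^sup>+r\<in>{s<..t}. ?k r \<partial>lebesgue)"
      by (rule nn_integral_cong) (use that in \<open>auto split: split_indicator\<close>)
    with interval_gradientD[OF h(3) that(1-3)] show ?thesis by simp
  qed
  show "interval_gradient l F ?k"
    unfolding interval_gradient_def
  proof (intro allI impI)
    fix s t :: real assume st: "0 \<le> s" "s \<le> t" "t \<le> l"
    consider "t \<le> a" | "a \<le> s" | "s \<le> a" "a \<le> t" by linarith
    then show "ennreal \<bar>F s - F t\<bar> \<le> (\<integral>\<^sup>+r\<in>{s<..t}. ?k r \<partial>lebesgue)"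
    proof cases
      case 3
      have "ennreal \<bar>F s - F t\<bar> \<le> ennreal \<bar>F s - F a\<bar> + ennreal \<bar>F a - F t\<bar>"
        by (simp add: ennreal_plus[symmetric] del: ennreal_plus)
      also have "\<dots> \<le> (\<integral>\<^sup>+r\<in>{s<..a}. ?k r \<partial>lebesgue) + (\<integral>\<^sup>+r\<in>{a<..t}. ?k r \<partial>lebesgue)"
        using 3 st by (intro add_mono below above) auto
      also have "\<dots> = (\<integral>\<^sup>+r\<in>{s<..t}. ?k r \<partial>lebesgue)"
        by (rule set_nn_integral_split[symmetric]) (use 3 k in auto)
      finally show ?thesis .
    qed (use st above below in blast)+
  qed
qed

lemma splicing_borel:
  assumes "C \<in> sets borel"
  shows "splicing l F C"
proof -
  have "C \<in> sigma_sets UNIV (range (\<lambda>a::real. {..a}))"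
    using assms by (simp add: borel_eq_atMost)
  then show ?thesis
  proof induction
    case (Basic a)
    then show ?case by (auto simp: splicing_atMost)
  next
    case Empty
    show ?case by (simp add: splicing_def)
  next
    case (Compl a)
    then show ?case using splicing_Compl by (simp add: Compl_eq_Diff_UNIV[symmetric])
  next
    case (Union a)
    then show ?case by (simp add: splicing_Union)
  qed
qed

text \<open>A Lebesgue set differs from a Borel set by a null set, which the integral inequalities
  do not see.\<close>

lemma splicing_lebesgue:
  assumes "C \<in> sets lebesgue"
  shows "splicing l F C"
proof -
  obtain S N N' where C: "C = S \<union> N" "N \<subseteq> N'" "N' \<in> null_sets lborel" "S \<in> sets lborel"
    using assms by (rule sets_completionE)
  have "AE r in lebesgue. r \<notin> N"
    using C by (auto intro: AE_completion AE_I' simp: AE_completion_iff)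
  then have "AE r in lebesgue. (if r \<in> S then g r else h r) = (if r \<in> C then g r else h r)" for g h :: "real \<Rightarrow> ennreal"
    by eventually_elim (auto simp: C)
  then have "interval_gradient l F (\<lambda>r. if r \<in> S then g r else h r)
    \<longleftrightarrow> interval_gradient l F (\<lambda>r. if r \<in> C then g r else h r)" for g h
    by (rule interval_gradient_cong_AE)
  moreover have "splicing l F S"
    using C(4) by (intro splicing_borel) simp
  ultimately show ?thesis
    using assms by (simp add: splicing_def)
qed

text \<open>The minimum is the splice of \<open>g\<close> and \<open>h\<close> along the set where
  \<open>g <= h\<close>, which is in general only Lebesgue measurable.\<close>

lemma interval_gradient_min:
  assumes "interval_gradient l F g" "interval_gradient l F h"
    "g \<in> borel_measurable lebesgue" "(\<integral>\<^sup>+r. g r \<partial>lebesgue) < \<infinity>"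
    "h \<in> borel_measurable lebesgue" "(\<integral>\<^sup>+r. h r \<partial>lebesgue) < \<infinity>"
  shows "interval_gradient l F (\<lambda>r. min (g r) (h r))"
proof -
  have "{r \<in> space lebesgue. g r \<le> h r} \<in> sets lebesgue"
    using assms by measurable
  from splicingD(3)[OF splicing_lebesgue[OF this] assms(3,4,1) assms(5,6,2)]
  show ?thesis by (simp add: min_def)
qed

text \<open>\<open>G\<close> is the indefinite integral of \<open>g\<close>. It depends on
  \<open>g\<close> alone and is thus a modulus of continuity shared by all functions with this
  gradient, as equicontinuity of a sequence requires.\<close>

lemma interval_gradient_modulus:
  assumes "g \<in> borel_measurable lebesgue" "(\<integral>\<^sup>+r. g r \<partial>lebesgue) < \<infinity>" "0 \<le> l"
  obtains G where "continuous_on {0..l} G"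
    "\<And>F s t. interval_gradient l F g \<Longrightarrow> s \<in> {0..l} \<Longrightarrow> t \<in> {0..l} \<Longrightarrow> \<bar>F s - F t\<bar> \<le> \<bar>G s - G t\<bar>"
proof -
  define k where "k r = enn2real (g r)" for r
  have k_eq: "AE r in lebesgue. ennreal (k r) = g r"
    using nn_integral_PInf_AE[OF assms(1)] assms(2) unfolding k_def
    by (auto elim!: eventually_mono simp: less_top)
  have k_meas: "k \<in> borel_measurable lebesgue"
    using assms(1) unfolding k_def by measurable
  have "(\<integral>\<^sup>+r. ennreal (norm (k r)) \<partial>lebesgue) = (\<integral>\<^sup>+r. g r \<partial>lebesgue)"
    by (rule nn_integral_cong_AE) (use k_eq in eventually_elim, simp add: k_def)
  then have k: "integrable lebesgue k"
    using assms k_meas by (intro integrableI_bounded) auto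
  have kset: "k absolutely_integrable_on {a..b}" for a b
    unfolding set_integrable_def by (rule integrable_mult_indicator) (simp_all add: k)
  then have kint: "k integrable_on {a..b}" for a b
    using set_lebesgue_integral_eq_integral(1) by blast
  define G where "G t = integral {0..t} k" for t
  have I: "(\<integral>\<^sup>+r\<in>{s<..t}. g r \<partial>lebesgue) = ennreal (G t - G s)" if "0 \<le> s" "s \<le> t" for s t
  proof -
    have "(\<integral>\<^sup>+r\<in>{s<..t}. g r \<partial>lebesgue) = (\<integral>\<^sup>+r\<in>{s..t}. ennreal (k r) \<partial>lebesgue)"
      by (rule nn_integral_cong_AE)
         (use AE_lborel_singleton[of s, THEN AE_completion] k_eq in eventually_elim, auto split: split_indicator)
    also have "\<dots> = (\<integral>\<^sup>+r. ennreal (indicator {s..t} r *\<^sub>R k r) \<partial>lebesgue)"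
      by (rule nn_integral_cong) (auto split: split_indicator)
    also have "\<dots> = ennreal (LINT r:{s..t}|lebesgue. k r)"
      unfolding set_lebesgue_integral_def
      by (rule nn_integral_eq_integral)
         (use kset[of s t] in \<open>auto simp: set_integrable_def k_def\<close>)
    also have "(LINT r:{s..t}|lebesgue. k r) = integral {s..t} k"
      using kset by (rule set_lebesgue_integral_eq_integral(2))
    also have "\<dots> = G t - G s"
      unfolding G_def using Henstock_Kurzweil_Integration.integral_combine[of 0 s t k] that kint by simp
    finally show ?thesis .
  qed
  have G: "\<bar>F s - F t\<bar> \<le> \<bar>G s - G t\<bar>" if F: "interval_gradient l F g" and "0 \<le> s" "s \<le> t" "t \<le> l" for F s t
  proof -
    have "ennreal \<bar>F s - F t\<bar> \<le> ennreal (G t - G s)"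
      using interval_gradientD[OF F that(2-4)] I that by simp
    then show ?thesis
      by (auto simp: ennreal_le_iff2)
  qed
  show ?thesis
  proof (rule that)
    show "continuous_on {0..l} G"
      unfolding G_def using kint by (rule indefinite_integral_continuous_1)
    fix F s t assume "interval_gradient l F g" "s \<in> {0..l}" "t \<in> {0..l}"
    then show "\<bar>F s - F t\<bar> \<le> \<bar>G s - G t\<bar>"
      using G[of F s t] G[of F t s] by (cases "s \<le> t") (auto simp: abs_minus_commute)
  qed
qed

lemma interval_gradient_continuous:
  assumes "interval_gradient l F g" "g \<in> borel_measurable lebesgue" "(\<integral>\<^sup>+r. g r \<partial>lebesgue) < \<infinity>" "0 \<le> l"
  shows "continuous_on {0..l} F"
proof -
  obtain G where G: "continuous_on {0..l} G"
    "\<And>s t. s \<in> {0..l} \<Longrightarrow> t \<in> {0..l} \<Longrightarrow> \<bar>F s - F t\<bar> \<le> \<bar>G s - G t\<bar>"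
    using interval_gradient_modulus[OF assms(2-4)] assms(1) by metis
  then show ?thesis
    unfolding continuous_on_iff dist_real_def
  proof (intro ballI allI impI)
    fix x e :: real assume x: "x \<in> {0..l}" and "e > 0"
    then obtain d where "d > 0" "\<And>y. y \<in> {0..l} \<Longrightarrow> \<bar>y - x\<bar> < d \<Longrightarrow> \<bar>G y - G x\<bar> < e"
      using G(1) unfolding continuous_on_iff dist_real_def by blast
    with G(2)[OF _ x] show "\<exists>d>0. \<forall>y\<in>{0..l}. \<bar>y - x\<bar> < d \<longrightarrow> \<bar>F y - F x\<bar> < e"
      by (intro exI[of _ d] conjI ballI impI) (blast intro: le_less_trans)+
  qed
qed

lemma open_AE_notin_imp_empty:
  fixes U :: "real set"
  assumes "open U" "AE r in lebesgue. r \<notin> U"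
  shows "U = {}"
proof -
  have "U \<in> null_sets lebesgue"
    using assms by (simp add: completion.null_sets_iff_AE)
  then show ?thesis
    using open_not_negligible[OF assms(1)] by (auto simp: negligible_iff_null_sets)
qed

text \<open>If \<open>a\<close> and \<open>b\<close> are the first and the last point where \<open>F = c\<close>, then \<open>F a = F b\<close>, so the
  gradient is only needed before \<open>a\<close> and after \<open>b\<close>.\<close>

lemma interval_gradient_level:
  assumes F: "interval_gradient l F g" and g: "g \<in> borel_measurable lebesgue" "(\<integral>\<^sup>+r. g r \<partial>lebesgue) < \<infinity>"
  shows "interval_gradient l F (\<lambda>r. if F r = c then 0 else g r)"
  unfolding interval_gradient_def
proof (intro allI impI)
  fix s t :: real assume st: "0 \<le> s" "s \<le> t" "t \<le> l"
  let ?k = "\<lambda>r. if F r = c then 0 else g r"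
  define Z where "Z = {r \<in> {s..t}. F r = c}"
  have eq: "(\<integral>\<^sup>+r\<in>A. g r \<partial>lebesgue) \<le> (\<integral>\<^sup>+r\<in>{s<..t}. ?k r \<partial>lebesgue)"
    if "A \<subseteq> {s<..t}" "A \<inter> Z \<subseteq> B" "B \<in> null_sets lebesgue" for A B
    by (rule nn_integral_mono_AE)
       (use AE_not_in[OF that(3)] in eventually_elim, use that(1,2) in \<open>auto simp: Z_def split: split_indicator\<close>)
  show "ennreal \<bar>F s - F t\<bar> \<le> (\<integral>\<^sup>+r\<in>{s<..t}. ?k r \<partial>lebesgue)"
  proof (cases "Z = {}")
    case True
    then show ?thesis
      using interval_gradientD[OF F st] eq[of "{s<..t}" "{}"] by force
  next
    case False
    have "continuous_on {s..t} F"
      using interval_gradient_continuous[OF F g] st by (auto elim: continuous_on_subset)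
    then have "compact Z"
      unfolding Z_def compact_eq_bounded_closed using continuous_closed_preimage_constant[of "{s..t}" F c]
      by (auto intro: bounded_subset[OF bounded_closed_interval])
    then obtain a b where a: "a \<in> Z" "\<forall>r\<in>Z. a \<le> r" and b: "b \<in> Z" "\<forall>r\<in>Z. r \<le> b"
      using compact_attains_inf[of Z] compact_attains_sup[of Z] False by metis
    then have ab: "s \<le> a" "a \<le> b" "b \<le> t" "F a = c" "F b = c" by (auto simp: Z_def)
    have "ennreal \<bar>F s - F t\<bar> \<le> ennreal \<bar>F s - F a\<bar> + ennreal \<bar>F b - F t\<bar>"
      using ab by (simp add: ennreal_plus[symmetric] del: ennreal_plus)
    also have "\<dots> \<le> (\<integral>\<^sup>+r\<in>{s<..a}. g r \<partial>lebesgue) + (\<integral>\<^sup>+r\<in>{b<..t}. g r \<partial>lebesgue)"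
      using ab st by (intro add_mono interval_gradientD[OF F]) auto
    also have "\<dots> = (\<integral>\<^sup>+r. (g r * indicator {s<..a} r + g r * indicator {b<..t} r) \<partial>lebesgue)"
      using g
      by (intro nn_integral_add[symmetric] borel_measurable_times_ennreal borel_measurable_indicator) auto
    also have "\<dots> = (\<integral>\<^sup>+r\<in>{s<..a} \<union> {b<..t}. g r \<partial>lebesgue)"
      using ab by (intro nn_integral_cong) (auto split: split_indicator)
    also have "\<dots> \<le> (\<integral>\<^sup>+r\<in>{s<..t}. ?k r \<partial>lebesgue)"
      \<comment> \<open>By the choice of \<open>a\<close> and \<open>b\<close> the two intervals
        meet \<open>Z\<close> in \<open>a\<close> only: the point \<open>b\<close> is left out by
        the half-open interval.\<close>
      by (rule eq[of _ "{a}"]) (use ab a b in \<open>force+\<close>)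
    finally show ?thesis .
  qed
qed

text \<open>Inside the interval the set where the continuous function \<open>F\<close> differs from
  \<open>c\<close> is open and null, hence empty; continuity covers the endpoints.\<close>

lemma interval_gradient_AE_const:
  assumes F: "interval_gradient l F g" and g: "g \<in> borel_measurable lebesgue" "(\<integral>\<^sup>+r. g r \<partial>lebesgue) < \<infinity>"
    and "0 < l" and "AE r in lebesgue. r \<in> {0..l} \<longrightarrow> F r = c" and "t \<in> {0..l}"
  shows "F t = c"
proof -
  have "continuous_on (closure {0<..<l}) F"
    using interval_gradient_continuous[OF F g] \<open>0 < l\<close> by simp
  moreover have "F r = c" if "r \<in> {0<..<l}" for r
  proof (rule ccontr)
    assume "F r \<noteq> c"
    have "continuous_on {0<..<l} F"
      using \<open>continuous_on (closure {0<..<l}) F\<close> closure_subset by (rule continuous_on_subset)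
    then have op: "open ({0<..<l} \<inter> F -` (- {c}))"
      by (intro continuous_open_preimage) auto
    have "AE r in lebesgue. r \<notin> {0<..<l} \<inter> F -` (- {c})"
      using assms(5) by eventually_elim auto
    with op have "{0<..<l} \<inter> F -` (- {c}) = {}"
      by (rule open_AE_notin_imp_empty)
    with that \<open>F r \<noteq> c\<close> show False by auto
  qed
  ultimately show ?thesis
    using continuous_constant_on_closure[of "{0<..<l}" F c t] assms(4,6) by auto
qed

text \<open>Equicontinuity upgrades convergence almost everywhere to convergence everywhere.\<close>

lemma interval_gradient_lim:
  assumes F: "\<And>n::nat. interval_gradient l (F n) g"
    and g: "g \<in> borel_measurable lebesgue" "(\<integral>\<^sup>+r. g r \<partial>lebesgue) < \<infinity>" and "0 < l"
    and conv: "AE r in lebesgue. r \<in> {0..l} \<longrightarrow> convergent (\<lambda>n. F n r)"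
  shows "t \<in> {0..l} \<Longrightarrow> convergent (\<lambda>n. F n t)"
    and "(\<And>n. interval_gradient l (F n) h) \<Longrightarrow> interval_gradient l (\<lambda>r. lim (\<lambda>n. F n r)) h"
proof -
  obtain G where G: "continuous_on {0..l} G"
    "\<And>n s t. s \<in> {0..l} \<Longrightarrow> t \<in> {0..l} \<Longrightarrow> \<bar>F n s - F n t\<bar> \<le> \<bar>G s - G t\<bar>"
    using interval_gradient_modulus[OF g, of l] F \<open>0 < l\<close> by (metis less_imp_le)
  show conv_all: "convergent (\<lambda>n. F n t)" if t: "t \<in> {0..l}" for t
    unfolding Cauchy_convergent_iff[symmetric] Cauchy_altdef2 dist_real_def
  proof (intro allI impI)
    fix e :: real assume "0 < e"
    then obtain d where d: "d > 0" "\<And>s. s \<in> {0..l} \<Longrightarrow> \<bar>s - t\<bar> < d \<Longrightarrow> \<bar>G s - G t\<bar> < e / 3"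
      using G(1) t unfolding continuous_on_iff dist_real_def by (metis divide_pos_pos zero_less_numeral)
    \<comment> \<open>Such a point exists because divergence occurs on a null set only, whereas
      every neighbourhood of \<open>t\<close> contains a nonempty open part of
      \<open>(0,l)\<close>.\<close>
    obtain s where s: "s \<in> {0..l}" "\<bar>s - t\<bar> < d" "convergent (\<lambda>n. F n s)"
    proof (rule ccontr)
      assume "\<not> thesis"
      then have *: "\<not> convergent (\<lambda>n. F n s)" if "s \<in> {0<..<l} \<inter> {t - d<..<t + d}" for s
        using that \<open>\<And>s. s \<in> {0..l} \<Longrightarrow> \<bar>s - t\<bar> < d \<Longrightarrow> convergent (\<lambda>n. F n s) \<Longrightarrow> thesis\<close>[of s] \<open>\<not> thesis\<close>
        by (auto simp: abs_less_iff)
      have "AE r in lebesgue. r \<notin> {0<..<l} \<inter> {t - d<..<t + d}"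
        using conv by eventually_elim (use * in auto)
      then have "{0<..<l} \<inter> {t - d<..<t + d} = {}"
        by (intro open_AE_notin_imp_empty) auto
      moreover have "max 0 (t - d) < min l (t + d)"
        using t d \<open>0 < l\<close> by auto
      then have "(max 0 (t - d) + min l (t + d)) / 2 \<in> {0<..<l} \<inter> {t - d<..<t + d}"
        by auto
      ultimately show False by blast
    qed
    then obtain N where N: "\<bar>F n s - F N s\<bar> < e / 3" if "n \<ge> N" for n
      using \<open>0 < e\<close> unfolding Cauchy_convergent_iff[symmetric] Cauchy_altdef2 dist_real_def
      by (metis divide_pos_pos zero_less_numeral)
    have "\<bar>F n t - F N t\<bar> < e" if "n \<ge> N" for n
      using N[OF that] G(2)[OF s(1) t, of n] G(2)[OF s(1) t, of N] d(2)[OF s(1,2)] by linarith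
    then show "\<exists>N. \<forall>n\<ge>N. \<bar>F n t - F N t\<bar> < e" by blast
  qed
  assume h: "\<And>n. interval_gradient l (F n) h"
  show "interval_gradient l (\<lambda>r. lim (\<lambda>n. F n r)) h"
    unfolding interval_gradient_def
  proof (intro allI impI)
    fix s t :: real assume st: "0 \<le> s" "s \<le> t" "t \<le> l"
    have "(\<lambda>n. F n r) \<longlonglongrightarrow> lim (\<lambda>n. F n r)" if "r \<in> {0..l}" for r
      using conv_all[OF that] by (simp add: convergent_LIMSEQ_iff)
    then have "(\<lambda>n. ennreal \<bar>F n s - F n t\<bar>) \<longlonglongrightarrow> ennreal \<bar>lim (\<lambda>n. F n s) - lim (\<lambda>n. F n t)\<bar>"
      using st by (intro tendsto_intros) auto
    then show "ennreal \<bar>lim (\<lambda>n. F n s) - lim (\<lambda>n. F n t)\<bar> \<le> (\<integral>\<^sup>+r\<in>{s<..t}. h r \<partial>lebesgue)"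
      by (rule LIMSEQ_le_const2) (use interval_gradientD[OF h st] in blast)
  qed
qed

section \<open>Almost every curve\<close>

abbreviation Lp_integral :: "real \<Rightarrow> 'a measure \<Rightarrow> ('a \<Rightarrow> ennreal) \<Rightarrow> ennreal" where
  "Lp_integral p M g \<equiv> (\<integral>\<^sup>+x. ennpowr (g x) p \<partial>M)"

section \<open>Powers of extended nonnegative numbers\<close>

lemma ennpowr_ennreal: "0 \<le> r \<Longrightarrow> ennpowr (ennreal r) p = ennreal (r powr p)"
  by (simp add: ennpowr_def)

lemma ennpowr_top [simp]: "ennpowr top p = top"
  by (simp add: ennpowr_def)

lemma ennpowr_0 [simp]: "ennpowr 0 p = 0"
  by (simp add: ennpowr_def)

lemma ennpowr_mono: "0 \<le> p \<Longrightarrow> x \<le> y \<Longrightarrow> ennpowr x p \<le> ennpowr y p"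
  by (cases x; cases y) (auto simp: ennpowr_def top_unique intro!: powr_mono2 ennreal_leI)

lemma ennpowr_less_top_iff: "ennpowr x p < top \<longleftrightarrow> x < top"
  by (simp add: ennpowr_def less_top)

lemma ennpowr_ennpowr: "0 < p \<Longrightarrow> ennpowr (ennpowr x p) (1 / p) = x" "0 < p \<Longrightarrow> ennpowr (ennpowr x (1 / p)) p = x"
  by (cases x; simp add: ennpowr_def powr_powr)+

lemma ennpowr_mult: "0 \<le> c \<Longrightarrow> ennpowr (ennreal c * x) p = ennreal (c powr p) * ennpowr x p"
  by (cases x; cases "c = 0") (auto simp: ennpowr_def powr_mult ennreal_mult[symmetric] ennreal_mult_top)

lemma ennpowr_measurable [measurable]: "(\<lambda>x. ennpowr x p) \<in> borel_measurable borel"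
  unfolding ennpowr_def by measurable

text \<open>Monotonicity of the inverse power \<open>1 / p\<close> turns the claim into a bound on
  each \<open>x n\<close>; no continuity of the power is involved.\<close>

lemma ennpowr_SUP_le:
  assumes "0 < p"
  shows "ennpowr (SUP n. x n) p \<le> (SUP n. ennpowr (x n) p)"
proof -
  have "x n \<le> ennpowr (SUP n. ennpowr (x n) p) (1 / p)" for n
    using ennpowr_mono[OF _ SUP_upper[of n UNIV "\<lambda>n. ennpowr (x n) p"], of "1 / p"] assms
    by (simp add: ennpowr_ennpowr)
  then have "ennpowr (SUP n. x n) p \<le> ennpowr (ennpowr (SUP n. ennpowr (x n) p) (1 / p)) p"
    using assms by (intro ennpowr_mono SUP_least) auto
  then show ?thesis using assms by (simp add: ennpowr_ennpowr)
qed

text \<open>Stands in for Minkowski's inequality: the right side can be integrated term by term, so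
  countably many p-integrable functions are combined through a weighted supremum.\<close>

lemma ennpowr_SUP_le_suminf:
  fixes x :: "nat \<Rightarrow> ennreal"
  assumes "0 < p"
  shows "ennpowr (SUP n. x n) p \<le> (\<Sum>n. ennpowr (x n) p)"
proof -
  have "ennpowr (x n) p \<le> (\<Sum>n. ennpowr (x n) p)" for n
    using sum_le_suminf[of "\<lambda>n. ennpowr (x n) p" "{n}"] by auto
  then have "(SUP n. ennpowr (x n) p) \<le> (\<Sum>n. ennpowr (x n) p)"
    by (rule SUP_least)
  with ennpowr_SUP_le[OF assms] show ?thesis by (rule order_trans)
qed

lemma borel_measurable_lebesgue_AE_eq:
  fixes f g :: "'a::euclidean_space \<Rightarrow> ennreal"
  assumes "f \<in> borel_measurable lebesgue" "AE x in lebesgue. f x = g x"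
  shows "g \<in> borel_measurable lebesgue"
proof (rule measurableI)
  fix A :: "ennreal set" assume "A \<in> sets borel"
  with assms(1) have A: "f -` A \<inter> space lebesgue \<in> sets lebesgue"
    by (rule measurable_sets)
  have "AE x in lebesgue. x \<in> f -` A \<inter> space lebesgue \<longleftrightarrow> x \<in> g -` A \<inter> space lebesgue"
    using assms(2) by eventually_elim simp
  from completion.in_sets_AE[OF this A] show "g -` A \<inter> space lebesgue \<in> sets lebesgue"
    by simp
qed simp

lemma curves_in: "c \<in> curves S \<Longrightarrow> t \<in> {0..fst c} \<Longrightarrow> snd c t \<in> S"
  by (auto simp: curves_def)

abbreviation gradient_along :: "('a \<Rightarrow> real) \<Rightarrow> ('a \<Rightarrow> ennreal) \<Rightarrow> 'a curve \<Rightarrow> bool" where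
  "gradient_along f g c \<equiv> interval_gradient (fst c) (\<lambda>t. f (snd c t)) (along g c)"

abbreviation measurable_gradient_along :: "('a \<Rightarrow> real) \<Rightarrow> ('a \<Rightarrow> ennreal) \<Rightarrow> 'a curve \<Rightarrow> bool" where
  "measurable_gradient_along f g c \<equiv> along g c \<in> borel_measurable lebesgue \<and> gradient_along f g c"

abbreviation finite_gradient_along :: "('a \<Rightarrow> real) \<Rightarrow> ('a \<Rightarrow> ennreal) \<Rightarrow> 'a curve \<Rightarrow> bool" where
  "finite_gradient_along f g c \<equiv> along g c \<in> borel_measurable lebesgue \<and> gradient_along f g c \<and>
     (\<integral>\<^sup>+t. along g c t \<partial>lebesgue) < \<infinity>"

section \<open>Exceptional families of curves\<close>

definition ae_curves :: "real \<Rightarrow> 'a::metric_space measure \<Rightarrow> ('a curve \<Rightarrow> bool) \<Rightarrow> bool" where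
  "ae_curves p M P \<longleftrightarrow> zero_modulus p M {c \<in> curves (space M). \<not> P c}"

lemma ae_curvesI:
  assumes "\<rho> \<in> borel_on (space M)" "Lp_integral p M \<rho> < \<infinity>"
    "\<And>c. c \<in> curves (space M) \<Longrightarrow> line_integral \<rho> c < \<infinity> \<Longrightarrow> P c"
  shows "ae_curves p M P"
  unfolding ae_curves_def zero_modulus_def
proof (intro bexI[of _ \<rho>] conjI ballI)
  fix c assume "c \<in> {c \<in> curves (space M). \<not> P c}"
  then show "line_integral \<rho> c = \<infinity>"
    using assms(3)[of c] by (cases "line_integral \<rho> c") auto
qed (use assms in auto)

lemma ae_curvesE:
  assumes "ae_curves p M P"
  obtains \<rho> where "\<rho> \<in> borel_on (space M)" "Lp_integral p M \<rho> < \<infinity>"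
    "\<And>c. c \<in> curves (space M) \<Longrightarrow> line_integral \<rho> c < \<infinity> \<Longrightarrow> P c"
proof -
  obtain \<rho> where \<rho>: "\<rho> \<in> borel_on (space M)" "Lp_integral p M \<rho> < \<infinity>"
    and *: "\<forall>c\<in>{c \<in> curves (space M). \<not> P c}. line_integral \<rho> c = \<infinity>"
    using assms unfolding ae_curves_def zero_modulus_def by blast
  have "P c" if "c \<in> curves (space M)" "line_integral \<rho> c < \<infinity>" for c
    using bspec[OF *, of c] that by (cases "P c") simp_all
  with \<rho> show thesis by (rule that)
qed

lemma ae_curves_mono:
  assumes "ae_curves p M P" "\<And>c. c \<in> curves (space M) \<Longrightarrow> P c \<Longrightarrow> Q c"
  shows "ae_curves p M Q"
  using assms(1)
proof (rule ae_curvesE)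
  fix \<rho> assume "\<rho> \<in> borel_on (space M)" "Lp_integral p M \<rho> < \<infinity>"
    and "\<And>c. c \<in> curves (space M) \<Longrightarrow> line_integral \<rho> c < \<infinity> \<Longrightarrow> P c"
  note \<rho> = this
  show ?thesis by (rule ae_curvesI[OF \<rho>(1,2) assms(2)[OF _ \<rho>(3)]])
qed

text \<open>The integral of \<rho> along a subcurve is at most that along the curve, so the curves
  of finite \<rho>-integral are closed under passing to subcurves and the same \<rho>
  serves.\<close>

lemma ae_curves_subcurve:
  assumes "ae_curves p M P"
  shows "ae_curves p M (\<lambda>c. \<forall>s t. 0 \<le> s \<longrightarrow> s < t \<longrightarrow> t \<le> fst c \<longrightarrow> P (subcurve s t c))"
  using assms
proof (rule ae_curvesE)
  fix \<rho> assume \<rho>: "\<rho> \<in> borel_on (space M)" "Lp_integral p M \<rho> < \<infinity>"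
    and P: "\<And>c. c \<in> curves (space M) \<Longrightarrow> line_integral \<rho> c < \<infinity> \<Longrightarrow> P c"
  from \<rho> show ?thesis
  proof (rule ae_curvesI, intro allI impI)
    fix c s t assume c: "c \<in> curves (space M)" "line_integral \<rho> c < \<infinity>" and st: "0 \<le> s" "s < t" "t \<le> fst c"
    have "snd c ` {s..t} \<subseteq> space M"
      using curves_in[OF c(1)] st by auto
    moreover have "line_integral \<rho> (subcurve s t c) < \<infinity>"
      using subcurve_integral_le[OF \<rho>(1) c(1) st] c(2) by (rule le_less_trans)
    ultimately show "P (subcurve s t c)"
      using c st by (intro P subcurve_curves)
  qed
qed

text \<open>The interface that a bounded open subset of the space offers as a space on its own.
  \<open>borel_majorant\<close> is the form in which completion enters: equality almost everywhere
  keeps integrals, and the bound everywhere keeps comparisons along every curve.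
  \<open>ball_pos\<close> yields countable covers.\<close>

locale metric_measure_domain =
  fixes N :: "'a::metric_space measure" and p :: real
  assumes p: "1 < p"
    and emeasure_finite: "emeasure N (space N) < \<infinity>"
    and borel_sets: "sets (restrict_space borel (space N)) \<subseteq> sets N"
    and borel_majorant: "g \<in> borel_measurable N \<Longrightarrow>
      \<exists>h\<in>borel_on (space N). (\<forall>x\<in>space N. g x \<le> (h x :: ennreal)) \<and> (AE x in N. g x = h x)"
    and ball_pos: "x \<in> space N \<Longrightarrow> 0 < r \<Longrightarrow> 0 < emeasure N (ball x r \<inter> space N)"
begin

lemma borel_measurableI:
  fixes h :: "'a \<Rightarrow> 'b::topological_space"
  assumes "h \<in> borel_on (space N)"
  shows "h \<in> borel_measurable N"
proof (rule measurableI)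
  fix A :: "'b set" assume "A \<in> sets borel"
  from measurable_sets[OF assms this] have "h -` A \<inter> space N \<in> sets (restrict_space borel (space N))"
    by (simp add: space_restrict_space)
  then show "h -` A \<inter> space N \<in> sets N"
    by (rule subsetD[OF borel_sets])
qed simp

lemma borel_majorantE:
  fixes g :: "'a \<Rightarrow> ennreal"
  assumes "g \<in> borel_measurable N"
  obtains h where "h \<in> borel_on (space N)"
    "\<And>x. x \<in> space N \<Longrightarrow> g x \<le> h x" "AE x in N. g x = h x"
proof -
  from borel_majorant[OF assms] obtain h where "h \<in> borel_on (space N)"
    and "(\<forall>x\<in>space N. g x \<le> h x) \<and> (AE x in N. g x = h x)" by (rule bexE)
  then show thesis by (intro that[of h]) simp_all
qed

lemma open_sets:
  assumes "open U" shows "U \<inter> space N \<in> sets N"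
proof -
  have "U \<inter> space N \<in> sets (restrict_space borel (space N))"
    unfolding sets_restrict_space using assms by (intro image_eqI[of _ _ U]) auto
  then show ?thesis
    by (rule subsetD[OF borel_sets])
qed

text \<open>Take \<rho> infinite on a null set containing the bad points. Its p-integral is zero,
  and a curve along which it has finite integral spends no length in that set.\<close>

lemma ae_curves_AE:
  assumes "AE x in N. P x"
  shows "ae_curves p N (\<lambda>c. AE t in lebesgue. t \<in> {0..fst c} \<longrightarrow> P (snd c t))"
proof -
  obtain Z where Z: "{x \<in> space N. \<not> P x} \<subseteq> Z" "Z \<in> sets N" "emeasure N Z = 0"
    using assms by (rule AE_E)
  define g :: "'a \<Rightarrow> ennreal" where "g x = top * indicator Z x" for x
  have g: "g \<in> borel_measurable N"
    using Z unfolding g_def by measurable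
  obtain h where h: "h \<in> borel_on (space N)"
    "\<And>x. x \<in> space N \<Longrightarrow> g x \<le> h x" "AE x in N. g x = h x"
    by (rule borel_majorantE[OF g]) (rule that)
  have "AE x in N. x \<notin> Z"
    using Z by (intro AE_not_in) auto
  then have h0: "Lp_integral p N h = (\<integral>\<^sup>+x. 0 \<partial>N)"
    by (intro nn_integral_cong_AE) (use \<open>AE x in N. x \<notin> Z\<close> h(3) in eventually_elim, auto simp: g_def)
  show ?thesis
  proof (rule ae_curvesI[OF h(1)])
    show "Lp_integral p N h < \<infinity>" by (simp add: h0)
    fix c assume c: "c \<in> curves (space N)" "line_integral h c < \<infinity>"
    have "AE t in lebesgue. along h c t \<noteq> \<infinity>"
      using c along_borel[OF h(1) c(1)] by (intro nn_integral_PInf_AE) (auto simp: line_integral_eq)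
    then show "AE t in lebesgue. t \<in> {0..fst c} \<longrightarrow> P (snd c t)"
    proof eventually_elim
      case (elim t)
      show ?case
      proof
        assume t: "t \<in> {0..fst c}"
        then have S: "snd c t \<in> space N" by (rule curves_in[OF c(1)])
        have "g (snd c t) \<noteq> \<infinity>"
          using elim h(2)[OF S] t by (auto simp: along_def top_unique)
        then show "P (snd c t)"
          using Z(1) S by (auto simp: g_def)
      qed
    qed
  qed
qed

text \<open>A single function has to serve all \<open>n\<close>. A weighted supremum of the
  individual \<rho> does: it is p-integrable by summing the weighted p-th powers, and with positive
  weights its finite line integral bounds each of theirs.\<close>

lemma ae_curves_all_nat:
  assumes "\<And>n::nat. ae_curves p N (P n)"
  shows "ae_curves p N (\<lambda>c. \<forall>n. P n c)"
proof -
  have "\<forall>n. \<exists>\<rho>. \<rho> \<in> borel_on (space N) \<and> Lp_integral p N \<rho> < \<infinity> \<and>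
    (\<forall>c\<in>curves (space N). line_integral \<rho> c < \<infinity> \<longrightarrow> P n c)"
  proof
    fix n
    show "\<exists>\<rho>. \<rho> \<in> borel_on (space N) \<and> Lp_integral p N \<rho> < \<infinity> \<and>
      (\<forall>c\<in>curves (space N). line_integral \<rho> c < \<infinity> \<longrightarrow> P n c)"
      using assms[of n] by (rule ae_curvesE) blast
  qed
  then obtain \<rho> where \<rho>: "\<And>n. \<rho> n \<in> borel_on (space N)"
    "\<And>n. Lp_integral p N (\<rho> n) < \<infinity>"
    "\<And>n c. c \<in> curves (space N) \<Longrightarrow> line_integral (\<rho> n) c < \<infinity> \<Longrightarrow> P n c"
    by metis
  define K where "K n = enn2real (Lp_integral p N (\<rho> n))" for n
  have K: "Lp_integral p N (\<rho> n) = ennreal (K n)" "0 \<le> K n" for n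
    using \<rho>(2)[of n] by (auto simp: K_def)
  \<comment> \<open>Chosen so that \<open>a n powr p * K n\<close> is at most
    \<open>1 / 2 ^ n\<close>; the added 1 keeps the denominator positive when
    \<open>K n = 0\<close>.\<close>
  define a where "a n = (1 / (2 ^ n * (K n + 1))) powr (1 / p)" for n
  have a: "a n > 0" "a n powr p = 1 / (2 ^ n * (K n + 1))" for n
    using K(2)[of n] p by (auto simp: a_def powr_powr)
  define r where "r x = (SUP n. ennreal (a n) * \<rho> n x)" for x
  have r: "r \<in> borel_on (space N)"
    unfolding r_def using \<rho>(1) by measurable
  have "Lp_integral p N r \<le> (\<integral>\<^sup>+x. (\<Sum>n. ennpowr (ennreal (a n) * \<rho> n x) p) \<partial>N)"
    unfolding r_def using p by (intro nn_integral_mono ennpowr_SUP_le_suminf) auto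
  also have "\<dots> = (\<Sum>n. \<integral>\<^sup>+x. ennpowr (ennreal (a n) * \<rho> n x) p \<partial>N)"
    using borel_measurableI[OF \<rho>(1)] by (intro nn_integral_suminf) measurable
  also have "\<dots> = (\<Sum>n. ennreal (a n powr p) * ennreal (K n))"
    using a(1) borel_measurableI[OF \<rho>(1)]
    by (intro suminf_cong) (simp add: ennpowr_mult less_imp_le nn_integral_cmult K(1))
  also have "\<dots> \<le> (\<Sum>n. ennreal ((1 / 2) ^ n))"
  proof (intro suminf_le allI)
    fix n
    have "a n powr p * K n \<le> (1 / 2) ^ n"
      using K(2)[of n] mult_left_mono[of "K n" "K n + 1" "1 / (2 ^ n * (K n + 1))"]
      by (simp add: a power_one_over)
    then show "ennreal (a n powr p) * ennreal (K n) \<le> ennreal ((1 / 2) ^ n)"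
      using K(2)[of n] by (simp add: ennreal_mult[symmetric] ennreal_leI)
  qed auto
  also have "\<dots> = ennreal (\<Sum>n. (1 / 2) ^ n)"
    by (rule suminf_ennreal2) (auto intro: summable_geometric)
  also have "\<dots> < \<infinity>" by simp
  finally have "Lp_integral p N r < \<infinity>" .
  with r show ?thesis
  proof (rule ae_curvesI, intro allI)
    fix c n assume c: "c \<in> curves (space N)" "line_integral r c < \<infinity>"
    have "ennreal (a n) * line_integral (\<rho> n) c = (\<integral>\<^sup>+t. ennreal (a n) * along (\<rho> n) c t \<partial>lebesgue)"
      unfolding line_integral_eq by (rule nn_integral_cmult[symmetric]) (rule along_borel[OF \<rho>(1) c(1)])
    also have "\<dots> \<le> line_integral r c"
      unfolding line_integral_eq
      by (rule nn_integral_mono) (auto simp: along_def r_def intro!: SUP_upper split: split_indicator)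
    also have "\<dots> < \<infinity>" by (rule c)
    finally have "line_integral (\<rho> n) c < \<infinity>"
      using a(1)[of n] by (auto simp: ennreal_mult_less_top)
    then show "P n c" by (rule \<rho>(3)[OF c(1)])
  qed
qed

lemma ae_curves_ball_countable:
  assumes "countable I" "\<And>i. i \<in> I \<Longrightarrow> ae_curves p N (P i)"
  shows "ae_curves p N (\<lambda>c. \<forall>i\<in>I. P i c)"
proof (cases "I = {}")
  case True
  then show ?thesis by (intro ae_curvesI[of "\<lambda>_. 0"]) auto
next
  case False
  then have "ae_curves p N (\<lambda>c. \<forall>n. P (from_nat_into I n) c)"
    by (intro ae_curves_all_nat assms(2) from_nat_into)
  then show ?thesis
    by (rule ae_curves_mono) (metis assms(1) from_nat_into_surj)
qed

lemma ae_curves_conj: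
  assumes "ae_curves p N P" "ae_curves p N Q"
  shows "ae_curves p N (\<lambda>c. P c \<and> Q c)"
proof -
  have "ae_curves p N (\<lambda>c. \<forall>b\<in>(UNIV::bool set). if b then P c else Q c)"
  proof (rule ae_curves_ball_countable)
    show "ae_curves p N (\<lambda>c. if b then P c else Q c)" for b
      using assms by (cases b) auto
  qed simp
  then show ?thesis
  proof (rule ae_curves_mono)
    fix c assume *: "\<forall>b\<in>UNIV. if b then P c else Q c"
    show "P c \<and> Q c" using bspec[OF *, of True] bspec[OF *, of False] by simp
  qed
qed

text \<open>Along almost every curve \<open>g\<close> agrees at almost every parameter with its
  Borel majorant, whose composition with the curve is measurable, and Lebesgue measure is
  complete.\<close>

lemma ae_curves_measurable:
  assumes "g \<in> borel_measurable N"
  shows "ae_curves p N (\<lambda>c. along g c \<in> borel_measurable lebesgue)"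
proof -
  obtain h where h: "h \<in> borel_on (space N)" "AE x in N. g x = h x"
    by (rule borel_majorantE[OF assms]) (rule that)
  show ?thesis
  proof (rule ae_curves_mono[OF ae_curves_AE[OF h(2)]])
    fix c assume c: "c \<in> curves (space N)"
      and "AE t in lebesgue. t \<in> {0..fst c} \<longrightarrow> g (snd c t) = h (snd c t)"
    then have "AE t in lebesgue. along h c t = along g c t"
      by (auto simp: along_def elim!: eventually_mono split: split_indicator)
    with along_borel[OF h(1) c] show "along g c \<in> borel_measurable lebesgue"
      by (rule borel_measurable_lebesgue_AE_eq)
  qed
qed

text \<open>The Borel majorant of \<open>g\<close> itself exhibits the exceptional family; being a
  bound everywhere, it allows comparison on every curve.\<close>

lemma ae_curves_integral_finite:
  assumes "g \<in> borel_measurable N" "Lp_integral p N g < \<infinity>"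
  shows "ae_curves p N (\<lambda>c. line_integral g c < \<infinity>)"
proof -
  obtain h where h: "h \<in> borel_on (space N)"
    "\<And>x. x \<in> space N \<Longrightarrow> g x \<le> h x" "AE x in N. g x = h x"
    by (rule borel_majorantE[OF assms(1)]) (rule that)
  have "Lp_integral p N h = Lp_integral p N g"
    by (intro nn_integral_cong_AE) (use h(3) in eventually_elim, simp)
  then have h_fin: "Lp_integral p N h < \<infinity>"
    using assms(2) by simp
  show ?thesis
  proof (rule ae_curvesI[OF h(1) h_fin])
    fix c assume c: "c \<in> curves (space N)" "line_integral h c < \<infinity>"
    have "line_integral g c \<le> line_integral h c"
      unfolding line_integral_eq
    proof (rule nn_integral_mono)
      fix t
      show "along g c t \<le> along h c t"
        unfolding along_def using h(2)[OF curves_in[OF c(1)]]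
        by (cases "t \<in> {0..fst c}") simp_all
    qed
    then show "line_integral g c < \<infinity>" using c(2) by (rule le_less_trans)
  qed
qed

text \<open>Fix \<open>e\<close> and consider the centres with radius above \<open>e\<close>. A
  maximal subset with mutual distances at least \<open>e\<close> has covering balls by maximality.
  It is countable, because the balls of radius \<open>e / 2\<close> around it are disjoint, have
  positive measure and fit into finite total measure. Letting \<open>e\<close> run through the
  numbers \<open>1 / Suc n\<close> reaches every centre.\<close>

lemma countable_ball_cover:
  assumes r: "\<And>x. x \<in> space N \<Longrightarrow> 0 < r x"
  obtains D where "countable D" "D \<subseteq> space N" "space N \<subseteq> (\<Union>x\<in>D. ball x (r x))"
proof -
  have ex: "\<exists>D\<subseteq>{x \<in> space N. e < r x}. countable D \<and> {x \<in> space N. e < r x} \<subseteq> (\<Union>x\<in>D. ball x (r x))"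
    if "0 < e" for e
  proof -
    define X where "X = {x \<in> space N. e < r x}"
    define F where "F = {D. D \<subseteq> X \<and> (\<forall>x\<in>D. \<forall>y\<in>D. x \<noteq> y \<longrightarrow> e \<le> dist x y)}"
    have "\<exists>D\<in>F. \<forall>E\<in>F. D \<subseteq> E \<longrightarrow> E = D"
    proof (rule subset_Zorn_nonempty)
      fix C assume C: "C \<noteq> {}" "subset.chain F C"
      have "\<exists>D\<in>C. x \<in> D \<and> y \<in> D" if "x \<in> \<Union>C" "y \<in> \<Union>C" for x y
        using that C(2) unfolding subset_chain_def by (elim conjE UnionE) (meson subsetD)
      moreover have "\<forall>D\<in>C. D \<in> F"
        using C(2) unfolding subset_chain_def by (meson subsetD)
      ultimately show "\<Union>C \<in> F"
        unfolding F_def by blast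
    next
      show "F \<noteq> {}" unfolding F_def by blast
    qed
    then obtain D where DF: "D \<in> F" and max: "\<forall>E\<in>F. D \<subseteq> E \<longrightarrow> E = D" by (rule bexE)
    have D: "D \<subseteq> X" "\<And>x y. x \<in> D \<Longrightarrow> y \<in> D \<Longrightarrow> x \<noteq> y \<Longrightarrow> e \<le> dist x y"
      using DF by (simp_all add: F_def)
    have cover: "X \<subseteq> (\<Union>x\<in>D. ball x (r x))"
    proof
      fix x assume x: "x \<in> X"
      show "x \<in> (\<Union>x\<in>D. ball x (r x))"
      proof (cases "\<exists>y\<in>D. dist y x < e")
        case True
        then obtain y where y: "y \<in> D" "dist y x < e" ..
        then have "e < r y" using D(1) by (auto simp: X_def)
        with y show ?thesis by (intro UN_I[of y]) simp_all
      next
        case False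
        then have far: "e \<le> dist y x" if "y \<in> D" for y
          using that by (meson not_less)
        then have "insert x D \<in> F"
          using D x by (simp add: F_def dist_commute)
        from bspec[OF max this] have "x \<in> D" by blast
        then show ?thesis
          using x \<open>0 < e\<close> by (intro UN_I[of x]) (simp_all add: X_def)
      qed
    qed
    define B where "B x = ball x (e / 2) \<inter> space N" for x
    have B: "B x \<in> sets N" "0 < measure N (B x)" if "x \<in> D" for x
    proof -
      show "B x \<in> sets N" unfolding B_def by (rule open_sets) simp
      have "x \<in> space N" using that D(1) by (auto simp: X_def)
      then have "0 < emeasure N (B x)" unfolding B_def using \<open>0 < e\<close> by (intro ball_pos) simp_all
      moreover have "emeasure N (B x) < \<infinity>"
        using emeasure_finite emeasure_space[of N "B x"] by (rule le_less_trans[rotated])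
      ultimately show "0 < measure N (B x)"
        by (simp add: measure_def enn2real_positive_iff less_top)
    qed
    have disj: "disjoint_family_on B D"
      unfolding disjoint_family_on_def
    proof (intro ballI impI equals0I)
      fix x y z assume xy: "x \<in> D" "y \<in> D" "x \<noteq> y" and z: "z \<in> B x \<inter> B y"
      then have "dist x y < e"
        using dist_triangle_half_r[of z x e y] by (simp add: B_def dist_commute)
      with D(2)[OF xy] show False by simp
    qed
    interpret fin: finite_measure N
      by (rule finite_measureI) (use emeasure_finite in simp)
    \<comment> \<open>Disjointness allows at most \<open>measure N (space N) * Suc k\<close> balls
      of measure above \<open>1 / Suc k\<close>.\<close>
    have fin: "finite {x \<in> D. 1 / real (Suc k) < measure N (B x)}" for k
    proof (rule conjunct1[OF finite_if_finite_subsets_card_bdd[where C="nat \<lceil>measure N (space N) * Suc k\<rceil>"]])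
      fix G assume G: "G \<subseteq> {x \<in> D. 1 / real (Suc k) < measure N (B x)}" "finite G"
      have "real (card G) * (1 / real (Suc k)) \<le> (\<Sum>x\<in>G. measure N (B x))"
        using G by (intro sum_bounded_below) (auto simp: less_imp_le)
      also have "\<dots> = measure N (\<Union>x\<in>G. B x)"
        using G B disj by (intro fin.finite_measure_finite_Union[symmetric])
          (auto simp: disjoint_family_on_def subset_iff)
      also have "\<dots> \<le> measure N (space N)"
        by (rule fin.bounded_measure)
      finally have "real (card G) \<le> measure N (space N) * Suc k"
        by (simp add: field_simps)
      then show "card G \<le> nat \<lceil>measure N (space N) * Suc k\<rceil>"
        by linarith
    qed
    have "D \<subseteq> (\<Union>k. {x \<in> D. 1 / real (Suc k) < measure N (B x)})"
      using B(2) reals_Archimedean by (fastforce simp: inverse_eq_divide)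
    then have "countable D"
      by (rule countable_subset) (use fin in \<open>auto intro: countable_finite\<close>)
    with D(1) cover show ?thesis unfolding X_def by blast
  qed
  then have "\<forall>n. \<exists>D. D \<subseteq> {x \<in> space N. 1 / real (Suc n) < r x} \<and> countable D \<and>
      {x \<in> space N. 1 / real (Suc n) < r x} \<subseteq> (\<Union>x\<in>D. ball x (r x))"
    by simp
  from choice[OF this]
  obtain D where D: "\<forall>n. D n \<subseteq> {x \<in> space N. 1 / real (Suc n) < r x} \<and> countable (D n) \<and>
      {x \<in> space N. 1 / real (Suc n) < r x} \<subseteq> (\<Union>x\<in>D n. ball x (r x))" ..
  show ?thesis
  proof (rule that)
    show "countable (\<Union>n. D n)" "(\<Union>n. D n) \<subseteq> space N" using D by auto
    show "space N \<subseteq> (\<Union>x\<in>(\<Union>n. D n). ball x (r x))"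
    proof
      fix x assume x: "x \<in> space N"
      obtain n where n: "1 / real (Suc n) < r x"
        using reals_Archimedean[OF r[OF x]] by (auto simp: inverse_eq_divide)
      have "{x \<in> space N. 1 / real (Suc n) < r x} \<subseteq> (\<Union>x\<in>D n. ball x (r x))"
        using D by simp
      with x n show "x \<in> (\<Union>x\<in>(\<Union>n. D n). ball x (r x))" by blast
    qed
  qed
qed

lemma AE_local:
  assumes "\<And>x. x \<in> space N \<Longrightarrow> \<exists>r>0. AE y in N. y \<in> ball x r \<longrightarrow> P y"
  shows "AE y in N. P y"
proof -
  obtain r where r: "\<And>x. x \<in> space N \<Longrightarrow> 0 < r x" "\<And>x. x \<in> space N \<Longrightarrow> AE y in N. y \<in> ball x (r x) \<longrightarrow> P y"
    using assms by metis
  obtain D where D: "countable D" "D \<subseteq> space N" "space N \<subseteq> (\<Union>x\<in>D. ball x (r x))"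
    using countable_ball_cover[of r] r(1) by blast
  have "AE y in N. \<forall>x\<in>D. y \<in> ball x (r x) \<longrightarrow> P y"
    using D r(2) by (subst AE_ball_countable) auto
  with AE_space show ?thesis
    by eventually_elim (use D(3) in blast)
qed

text \<open>Countably many balls on which \<open>g\<close> is p-integrable cover the space. On
  almost every curve all localized integrals are finite, and finitely many of the balls cover its
  compact image.\<close>

lemma ae_curves_integral_finite_Lp_loc:
  assumes "g \<in> Lp_loc p N"
  shows "ae_curves p N (\<lambda>c. line_integral g c < \<infinity>)"
proof -
  have g: "g \<in> borel_measurable N" using assms by (simp add: Lp_loc_def)
  obtain r where r: "\<And>x. x \<in> space N \<Longrightarrow> 0 < r x"
    "\<And>x. x \<in> space N \<Longrightarrow> (\<integral>\<^sup>+y\<in>ball x (r x). ennpowr (g y) p \<partial>N) < \<infinity>"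
    using assms unfolding Lp_loc_def by (auto simp: Ball_def) metis
  obtain D where D: "countable D" "D \<subseteq> space N" "space N \<subseteq> (\<Union>x\<in>D. ball x (r x))"
    using countable_ball_cover[of r] r(1) by blast
  define G where "G x y = g y * indicator (ball x (r x) \<inter> space N) y" for x y
  have "ae_curves p N (\<lambda>c. \<forall>x\<in>D. line_integral (G x) c < \<infinity> \<and> along (G x) c \<in> borel_measurable lebesgue)"
  proof (intro ae_curves_ball_countable ae_curves_conj ae_curves_integral_finite ae_curves_measurable)
    fix x assume "x \<in> D"
    then have "(\<integral>\<^sup>+y. ennpowr (G x y) p \<partial>N) = (\<integral>\<^sup>+y\<in>ball x (r x). ennpowr (g y) p \<partial>N)"
      by (intro nn_integral_cong) (auto simp: G_def split: split_indicator)
    then show "(\<integral>\<^sup>+y. ennpowr (G x y) p \<partial>N) < \<infinity>"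
      using r(2) D \<open>x \<in> D\<close> by auto
    show "G x \<in> borel_measurable N"
      unfolding G_def using g open_sets[of "ball x (r x)"] by measurable
    then show "G x \<in> borel_measurable N" .
  qed (rule D)
  then show ?thesis
  proof (rule ae_curves_mono)
    fix c assume c: "c \<in> curves (space N)"
      and fin: "\<forall>x\<in>D. line_integral (G x) c < \<infinity> \<and> along (G x) c \<in> borel_measurable lebesgue"
    have sub: "snd c ` {0..fst c} \<subseteq> space N" "continuous_on {0..fst c} (snd c)"
      using c by (auto simp: curves_def)
    then have cpt: "compact (snd c ` {0..fst c})"
      by (intro compact_continuous_image) auto
    have "snd c ` {0..fst c} \<subseteq> (\<Union>x\<in>D. ball x (r x))"
      using sub(1) D(3) by (rule order_trans)
    from compactE_image[OF cpt _ this]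
    obtain E where E: "E \<subseteq> D" "finite E" "snd c ` {0..fst c} \<subseteq> (\<Union>x\<in>E. ball x (r x))"
      by (metis open_ball)
    have "line_integral g c \<le> (\<integral>\<^sup>+t. (\<Sum>x\<in>E. along (G x) c t) \<partial>lebesgue)"
      unfolding line_integral_eq
    proof (rule nn_integral_mono)
      fix t
      show "along g c t \<le> (\<Sum>x\<in>E. along (G x) c t)"
      proof (cases "t \<in> {0..fst c}")
        case True
        then obtain x where x: "x \<in> E" "snd c t \<in> ball x (r x)" using E(3) by blast
        then have "along g c t = along (G x) c t"
          using curves_in[OF c True] True by (simp add: along_def G_def)
        also have "\<dots> \<le> (\<Sum>x\<in>E. along (G x) c t)"
          using x E(2) by (intro member_le_sum) auto
        finally show ?thesis .
      qed (simp add: along_def)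
    qed
    also have "\<dots> = (\<Sum>x\<in>E. line_integral (G x) c)"
      unfolding line_integral_eq using fin E by (intro nn_integral_sum) auto
    also have "\<dots> < \<infinity>"
      using fin E by (auto simp: subset_iff)
    finally show "line_integral g c < \<infinity>" .
  qed
qed

end

section \<open>Weak upper gradients of real functions\<close>

lemma Lp_locI:
  assumes "g \<in> borel_measurable M" "Lp_integral p M g < \<infinity>"
  shows "g \<in> Lp_loc p M"
  unfolding Lp_loc_def using assms(1) set_nn_integral_finite[OF assms(2)]
  by (auto intro: exI[of _ "1::real"])

lemma ennpowr_add_le:
  assumes "0 < p"
  shows "ennpowr (a + b) p \<le> ennreal (2 powr p) * (ennpowr a p + ennpowr b p)"
proof -
  have "a + b \<le> ennreal 2 * max a b"
    by (simp add: mult_2 add_mono)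
  then have "ennpowr (a + b) p \<le> ennreal (2 powr p) * ennpowr (max a b) p"
    using ennpowr_mono[of p "a + b" "ennreal 2 * max a b"] assms ennpowr_mult[of 2 "max a b" p] by simp
  also have "ennpowr (max a b) p \<le> ennpowr a p + ennpowr b p"
    by (simp add: max_def)
  finally show ?thesis by (simp add: mult_left_mono)
qed

lemma nn_integral_ennpowr_add_finite:
  assumes "0 < p" "f \<in> borel_measurable M" "g \<in> borel_measurable M"
    "Lp_integral p M f < \<infinity>" "Lp_integral p M g < \<infinity>"
  shows "(\<integral>\<^sup>+x. ennpowr (f x + g x) p \<partial>M) < \<infinity>"
proof -
  have "(\<integral>\<^sup>+x. ennpowr (f x + g x) p \<partial>M) \<le>
      (\<integral>\<^sup>+x. ennreal (2 powr p) * (ennpowr (f x) p + ennpowr (g x) p) \<partial>M)"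
    using assms(1) by (intro nn_integral_mono ennpowr_add_le)
  also have "\<dots> = ennreal (2 powr p) * (Lp_integral p M f + Lp_integral p M g)"
    using assms(2,3) by (subst nn_integral_cmult) (simp_all add: nn_integral_add)
  also have "\<dots> < \<infinity>"
    using assms(4,5) by (simp add: ennreal_mult_less_top)
  finally show ?thesis .
qed

lemma ennreal_inverse_inverse: "inverse (inverse x) = (x :: ennreal)"
  including ennreal.lifting
proof transfer
  fix x :: ereal assume "0 \<le> x"
  then show "inverse (inverse x) = x" by (cases x) auto
qed

lemma ennreal_inverse_antimono: "x \<le> y \<Longrightarrow> inverse y \<le> inverse (x :: ennreal)"
  including ennreal.lifting by transfer (rule ereal_inverse_antimono)

lemma nn_integral_eq_imp_AE_eq:
  assumes "f \<in> borel_measurable M" "g \<in> borel_measurable M" "\<And>x. x \<in> space M \<Longrightarrow> f x \<le> g x"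
    "(\<integral>\<^sup>+x. g x \<partial>M) \<le> (\<integral>\<^sup>+x. f x \<partial>M)" "(\<integral>\<^sup>+x. g x \<partial>M) < \<infinity>"
  shows "AE x in M. f x = (g x :: ennreal)"
proof -
  have le: "AE x in M. f x \<le> g x" using assms(3) by (intro AE_I2)
  have "(\<integral>\<^sup>+x. f x \<partial>M) \<le> (\<integral>\<^sup>+x. g x \<partial>M)" using le by (rule nn_integral_mono_AE)
  then have fin: "(\<integral>\<^sup>+x. f x \<partial>M) \<noteq> \<infinity>" using assms(5) by (auto dest: le_less_trans)
  have "(\<integral>\<^sup>+x. g x - f x \<partial>M) = (\<integral>\<^sup>+x. g x \<partial>M) - (\<integral>\<^sup>+x. f x \<partial>M)"
    by (rule nn_integral_diff[OF assms(2,1) fin le])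
  also have "\<dots> = 0" using assms(4,5) by (simp add: diff_eq_0_iff_ennreal)
  finally have "AE x in M. g x - f x = 0"
    using assms(1,2) by (subst (asm) nn_integral_0_iff_AE) simp_all
  moreover have "AE x in M. g x \<noteq> \<infinity>"
    using assms(2,5) by (intro nn_integral_PInf_AE) auto
  ultimately show ?thesis
    using le by eventually_elim (auto simp: diff_eq_0_iff_ennreal)
qed

context metric_measure_domain
begin

text \<open>Admissible functions take values in \<open>[0,1]\<close>, so real functions suffice and
  endpoint differences become ordinary absolute values.\<close>

abbreviation wug :: "('a \<Rightarrow> real) \<Rightarrow> ('a \<Rightarrow> ennreal) \<Rightarrow> bool" where
  "wug f \<equiv> weak_upper_gradient p N (\<lambda>x. ereal (f x))"

abbreviation E :: "('a \<Rightarrow> real) \<Rightarrow> ennreal" where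
  "E f \<equiv> energy p N (\<lambda>x. ereal (f x))"

lemma wug_measurable: "wug f g \<Longrightarrow> g \<in> borel_measurable N"
  by (simp add: weak_upper_gradient_def)

lemma along_subcurve_integral_le_line_integral:
  "(\<integral>\<^sup>+r\<in>{s<..t}. along g c r \<partial>lebesgue) \<le> line_integral g c"
  unfolding line_integral_eq by (rule nn_integral_mono) (auto split: split_indicator)

text \<open>The definition compares only the endpoints of a curve. Applied to all subcurves of
  almost every curve, it controls every pair of parameters.\<close>

lemma wug_interval_gradient:
  assumes "wug f g"
  shows "ae_curves p N (\<lambda>c. measurable_gradient_along f g c)"
proof (rule ae_curves_mono[OF ae_curves_conj])
  show "ae_curves p N (\<lambda>c. along g c \<in> borel_measurable lebesgue)"
    using wug_measurable[OF assms] by (rule ae_curves_measurable)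
  show "ae_curves p N (\<lambda>c. \<forall>s t. 0 \<le> s \<longrightarrow> s < t \<longrightarrow> t \<le> fst c \<longrightarrow>
      line_integral_defined g (subcurve s t c) \<and>
      endpoint_diff (\<lambda>x. ereal (f x)) (subcurve s t c) \<le> line_integral g (subcurve s t c))"
    using assms unfolding weak_upper_gradient_def
    by (intro ae_curves_subcurve) (simp add: ae_curves_def)
  fix c assume c: "c \<in> curves (space N)"
    and *: "along g c \<in> borel_measurable lebesgue \<and> (\<forall>s t. 0 \<le> s \<longrightarrow> s < t \<longrightarrow> t \<le> fst c \<longrightarrow>
      line_integral_defined g (subcurve s t c) \<and>
      endpoint_diff (\<lambda>x. ereal (f x)) (subcurve s t c) \<le> line_integral g (subcurve s t c))"
  show "measurable_gradient_along f g c"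
    unfolding interval_gradient_def
  proof (intro conjI allI impI)
    show m: "along g c \<in> borel_measurable lebesgue" using * by simp
    fix s t assume st: "0 \<le> s" "s \<le> t" "t \<le> fst c"
    show "ennreal \<bar>f (snd c s) - f (snd c t)\<bar> \<le> (\<integral>\<^sup>+r\<in>{s<..t}. along g c r \<partial>lebesgue)"
    proof (cases "s = t")
      case False
      then have "s < t" using st by simp
      with * st have "endpoint_diff (\<lambda>x. ereal (f x)) (subcurve s t c) \<le> line_integral g (subcurve s t c)"
        by simp
      then show ?thesis
        using m st \<open>s < t\<close> by (simp add: endpoint_diff_subcurve line_integral_subcurve)
    qed simp
  qed
qed

lemma wugI:
  assumes "g \<in> borel_measurable N"
    "ae_curves p N (\<lambda>c. gradient_along f g c)"
  shows "wug f g"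
  unfolding weak_upper_gradient_def ae_curves_def[symmetric]
proof (intro conjI assms(1))
  show "ae_curves p N (\<lambda>c. line_integral_defined g c \<and>
    endpoint_diff (\<lambda>x. ereal (f x)) c \<le> line_integral g c)"
  proof (rule ae_curves_mono[OF ae_curves_conj[OF ae_curves_measurable[OF assms(1)] assms(2)]])
    fix c assume "c \<in> curves (space N)" and *: "measurable_gradient_along f g c"
    then have "0 \<le> fst c" by (auto simp: curves_def)
    then have "ennreal \<bar>f (snd c 0) - f (snd c (fst c))\<bar> \<le> (\<integral>\<^sup>+r\<in>{0<..fst c}. along g c r \<partial>lebesgue)"
      using * by (intro interval_gradientD[where F="\<lambda>t. f (snd c t)" and l="fst c"]) auto
    also have "\<dots> \<le> line_integral g c"
      by (rule along_subcurve_integral_le_line_integral)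
    finally show "line_integral_defined g c \<and> endpoint_diff (\<lambda>x. ereal (f x)) c \<le> line_integral g c"
      using * by (simp add: endpoint_diff_real line_integral_defined_iff)
  qed
qed

lemma endpoint_diff_cong:
  assumes "\<And>x. x \<in> S \<Longrightarrow> u x = v x" "c \<in> curves S"
  shows "endpoint_diff u c = endpoint_diff v c"
proof -
  have "0 \<le> fst c" using assms(2) by (auto simp: curves_def)
  then have "snd c 0 \<in> S" "snd c (fst c) \<in> S"
    by (auto intro!: curves_in[OF assms(2)])
  then show ?thesis by (simp add: endpoint_diff_def assms(1))
qed

lemma wug_cong:
  assumes "\<And>x. x \<in> space N \<Longrightarrow> u x = v x"
  shows "weak_upper_gradient p N u g \<longleftrightarrow> weak_upper_gradient p N v g"
proof -
  have "endpoint_diff u c = endpoint_diff v c" if "c \<in> curves (space N)" for c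
    using assms that by (rule endpoint_diff_cong)
  then have "{c \<in> curves (space N). \<not> (line_integral_defined g c \<and> endpoint_diff u c \<le> line_integral g c)} =
    {c \<in> curves (space N). \<not> (line_integral_defined g c \<and> endpoint_diff v c \<le> line_integral g c)}"
    by auto
  then show ?thesis by (simp add: weak_upper_gradient_def)
qed

lemma Lp_loc_measurable: "g \<in> Lp_loc p N \<Longrightarrow> g \<in> borel_measurable N"
  by (simp add: Lp_loc_def)

lemma Lp_loc_mono:
  assumes "g \<in> Lp_loc p N" "h \<in> borel_measurable N" "\<And>x. x \<in> space N \<Longrightarrow> h x \<le> g x"
  shows "h \<in> Lp_loc p N"
proof -
  have "(\<integral>\<^sup>+y\<in>A. ennpowr (h y) p \<partial>N) \<le> (\<integral>\<^sup>+y\<in>A. ennpowr (g y) p \<partial>N)" for A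
    using assms(3) p by (intro nn_integral_mono mult_right_mono ennpowr_mono) auto
  then show ?thesis
    using assms(1,2) unfolding Lp_loc_def by (blast intro: le_less_trans)
qed

lemma wug_mono_AE:
  assumes "wug f g" "h \<in> borel_measurable N" "AE x in N. g x \<le> h x"
  shows "wug f h"
proof (rule wugI[OF assms(2)])
  show "ae_curves p N (\<lambda>c. gradient_along f h c)"
    using ae_curves_conj[OF wug_interval_gradient[OF assms(1)] ae_curves_AE[OF assms(3)]]
  proof (rule ae_curves_mono)
    fix c assume "c \<in> curves (space N)" and
      *: "(measurable_gradient_along f g c) \<and>
        (AE t in lebesgue. t \<in> {0..fst c} \<longrightarrow> g (snd c t) \<le> h (snd c t))"
    have "AE r in lebesgue. r \<in> {0..fst c} \<longrightarrow> along g c r \<le> along h c r"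
      using conjunct2[OF *] by eventually_elim (auto simp: along_def)
    with conjunct2[OF conjunct1[OF *]] show "gradient_along f h c"
      by (rule interval_gradient_mono_AE)
  qed
qed

lemma wug_Lp_loc_interval_gradient:
  assumes "g \<in> Lp_loc p N" "wug f g"
  shows "ae_curves p N (\<lambda>c. finite_gradient_along f g c)"
  using ae_curves_conj[OF wug_interval_gradient[OF assms(2)] ae_curves_integral_finite_Lp_loc[OF assms(1)]]
  by (rule ae_curves_mono) (simp add: line_integral_eq)

text \<open>Local p-integrability makes both gradients integrable along almost every curve, which is
  what splicing on the parameter interval requires.\<close>

lemma wug_min:
  assumes "g \<in> Lp_loc p N" "wug f g" "h \<in> Lp_loc p N" "wug f h"
  shows "wug f (\<lambda>x. min (g x) (h x))"
proof (rule wugI)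
  show "(\<lambda>x. min (g x) (h x)) \<in> borel_measurable N"
    using assms by (intro borel_measurable_min wug_measurable)
  show "ae_curves p N (\<lambda>c. gradient_along f (\<lambda>x. min (g x) (h x)) c)"
    using ae_curves_conj[OF wug_Lp_loc_interval_gradient[OF assms(1,2)] wug_Lp_loc_interval_gradient[OF assms(3,4)]]
  proof (rule ae_curves_mono)
    fix c
    have "along (\<lambda>x. min (g x) (h x)) c = (\<lambda>t. min (along g c t) (along h c t))"
      by (auto simp: along_def split: split_indicator)
    moreover assume "(finite_gradient_along f g c) \<and>
       finite_gradient_along f h c"
    ultimately show "gradient_along f (\<lambda>x. min (g x) (h x)) c"
      by (simp add: interval_gradient_min)
  qed
qed

lemma wug_INF:
  assumes "\<And>n::nat. g n \<in> Lp_loc p N" "\<And>n. wug f (g n)" "decseq g"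
  shows "wug f (\<lambda>x. INF n. g n x)"
proof (rule wugI)
  show "(\<lambda>x. INF n. g n x) \<in> borel_measurable N"
    using Lp_loc_measurable[OF assms(1)] by (intro borel_measurable_INF) auto
  show "ae_curves p N (\<lambda>c. gradient_along f (\<lambda>x. INF n. g n x) c)"
    using ae_curves_all_nat[OF wug_Lp_loc_interval_gradient[OF assms(1,2)]]
  proof (rule ae_curves_mono)
    fix c
    have eq: "along (\<lambda>x. INF n. g n x) c = (\<lambda>t. INF n. along (g n) c t)"
      by (auto simp: along_def split: split_indicator)
    have dec: "decseq (\<lambda>n. along (g n) c)"
      using assms(3) by (intro decseq_SucI le_funI) (auto simp: along_def intro!: mult_right_mono dest: decseq_SucD le_funD)
    assume *: "\<forall>n. finite_gradient_along f (g n) c"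
    show "gradient_along f (\<lambda>x. INF n. g n x) c"
      unfolding eq by (rule interval_gradient_INF[OF _ _ dec]) (use * in auto)
  qed
qed

text \<open>The minimal weak upper gradient maximizes the bounded functional \<open>g \<mapsto> \<integral> 1 / (1 + g)\<close>.\<close>

lemma minimal_weak_upper_gradient_exists:
  assumes g0: "g0 \<in> Lp_loc p N" "wug f g0"
  shows "\<exists>g. is_minimal_weak_upper_gradient p N (\<lambda>x. ereal (f x)) g"
proof -
  define G where "G = {g \<in> Lp_loc p N. wug f g}"
  define \<Psi> where "\<Psi> g = (\<integral>\<^sup>+x. inverse (1 + g x) \<partial>N)" for g :: "'a \<Rightarrow> ennreal"
  have G_meas: "g \<in> borel_measurable N" if "g \<in> G" for g
    using that by (simp add: G_def Lp_loc_measurable)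
  have \<Psi>_mono: "\<Psi> g \<le> \<Psi> h" if "\<And>x. x \<in> space N \<Longrightarrow> h x \<le> g x" for g h
    unfolding \<Psi>_def using that by (intro nn_integral_mono) (simp add: ennreal_inverse_antimono add_left_mono)
  have \<Psi>_fin: "\<Psi> g < \<infinity>" for g
  proof -
    have "\<Psi> g \<le> (\<integral>\<^sup>+x. 1 \<partial>N)"
      unfolding \<Psi>_def using ennreal_inverse_antimono[of 1] by (intro nn_integral_mono) simp
    then show ?thesis using emeasure_finite by (simp add: le_less_trans)
  qed
  have G_min: "(\<lambda>x. min (g x) (h x)) \<in> G" if "g \<in> G" "h \<in> G" for g h
  proof -
    have m: "wug f (\<lambda>x. min (g x) (h x))"
      using that by (intro wug_min) (simp_all add: G_def)
    with that show ?thesis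
      using Lp_loc_mono[of g, OF _ wug_measurable[OF m]] by (simp add: G_def)
  qed
  have "G \<noteq> {}" using g0 by (auto simp: G_def)
  from ennreal_SUP_countable_SUP[OF this, of \<Psi>]
  obtain F :: "nat \<Rightarrow> ennreal" where F: "range F \<subseteq> \<Psi> ` G" "(SUP g\<in>G. \<Psi> g) = (SUP n. F n)" by auto
  have "\<forall>n. \<exists>g. g \<in> G \<and> F n = \<Psi> g" using F(1) by auto
  from choice[OF this] obtain g where g: "\<forall>n. g n \<in> G \<and> F n = \<Psi> (g n)" ..
  \<comment> \<open>Running minima of a maximizing sequence: they stay in \<open>G\<close>, and they
    decrease, as \<open>wug_INF\<close> demands.\<close>
  define m where "m = rec_nat (g 0) (\<lambda>n h x. min (h x) (g (Suc n) x))"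
  have m_simps: "m 0 = g 0" "m (Suc n) = (\<lambda>x. min (m n x) (g (Suc n) x))" for n
    by (simp_all add: m_def)
  have mG: "m n \<in> G" for n
    by (induction n) (use g in \<open>auto simp: m_simps intro!: G_min\<close>)
  have m_le: "m n x \<le> g n x" for n x by (cases n) (auto simp: m_simps)
  have dec: "decseq m" by (intro decseq_SucI le_funI) (simp add: m_simps)
  define k where "k x = (INF n. m n x)" for x
  have "wug f k"
    unfolding k_def using mG dec by (intro wug_INF) (auto simp: G_def)
  moreover have "k \<in> Lp_loc p N"
    using mG[of 0] wug_measurable[OF \<open>wug f k\<close>]
    by (intro Lp_loc_mono[of "m 0" k]) (auto simp: G_def k_def intro: INF_lower)
  ultimately have k: "k \<in> G" by (simp add: G_def)
  have \<Psi>_le: "\<Psi> h \<le> \<Psi> k" if "h \<in> G" for h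
  proof -
    have "\<Psi> h \<le> (SUP n. F n)" using that F(2) by (metis SUP_upper)
    also have "\<dots> \<le> \<Psi> k"
    proof (rule SUP_least)
      fix n
      have "k x \<le> g n x" for x
        unfolding k_def using m_le[of n x] by (rule INF_lower2[OF UNIV_I])
      then show "F n \<le> \<Psi> k" using g by (simp add: \<Psi>_mono)
    qed
    finally show ?thesis .
  qed
  have "AE x in N. k x \<le> h x" if h: "h \<in> Lp_loc p N" "wug f h" for h
  proof -
    have hG: "h \<in> G" using h by (simp add: G_def)
    \<comment> \<open>The minimum of \<open>k\<close> and \<open>h\<close> lies in \<open>G\<close>
      and can only raise the functional, while \<open>k\<close> already attains the supremum. Equal
      finite integrals of ordered functions force equality almost everywhere, that is,
      \<open>k <= h\<close>.\<close>
    have "AE x in N. inverse (1 + k x) = inverse (1 + min (k x) (h x))"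
    proof (rule nn_integral_eq_imp_AE_eq)
      show "inverse (1 + k x) \<le> inverse (1 + min (k x) (h x))" for x
        by (intro ennreal_inverse_antimono add_left_mono) simp
      show "(\<integral>\<^sup>+x. inverse (1 + min (k x) (h x)) \<partial>N) \<le> (\<integral>\<^sup>+x. inverse (1 + k x) \<partial>N)"
        using \<Psi>_le[OF G_min[OF k hG]] by (simp add: \<Psi>_def)
      show "(\<integral>\<^sup>+x. inverse (1 + min (k x) (h x)) \<partial>N) < \<infinity>"
        using \<Psi>_fin by (simp add: \<Psi>_def)
    qed (use G_meas[OF k] G_meas[OF hG] in measurable)
    then show ?thesis
    proof eventually_elim
      case (elim x)
      then have "1 + k x = 1 + min (k x) (h x)"
        by (metis ennreal_inverse_inverse)
      then show ?case by (simp add: ennreal_add_left_cancel min_def split: if_splits)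
    qed
  qed
  then show ?thesis
    using k by (auto simp: is_minimal_weak_upper_gradient_def G_def intro!: exI[of _ k])
qed

lemma min_weak_upper_gradient:
  assumes "g \<in> Lp_loc p N" "wug f g"
  shows "is_minimal_weak_upper_gradient p N (\<lambda>x. ereal (f x)) (min_weak_upper_gradient p N (\<lambda>x. ereal (f x)))"
  using someI_ex[OF minimal_weak_upper_gradient_exists[OF assms]]
  by (simp add: min_weak_upper_gradient_def)

lemma energy_le:
  assumes "wug f g" "Lp_integral p N g < \<infinity>"
  shows "E f \<le> Lp_integral p N g"
proof -
  have "g \<in> Lp_loc p N" using assms by (intro Lp_locI wug_measurable)
  with min_weak_upper_gradient[OF this assms(1)] assms(1)
  have "AE x in N. min_weak_upper_gradient p N (\<lambda>x. ereal (f x)) x \<le> g x"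
    by (simp add: is_minimal_weak_upper_gradient_def)
  then show ?thesis
    unfolding energy_def using p
    by (intro nn_integral_mono_AE) (auto elim!: eventually_mono intro: ennpowr_mono)
qed

lemma energy_cong:
  assumes "\<And>x. x \<in> space N \<Longrightarrow> u x = v x"
  shows "energy p N u = energy p N v"
  using wug_cong[of u v] assms
  by (simp add: energy_def min_weak_upper_gradient_def is_minimal_weak_upper_gradient_def)

text \<open>Add to a Borel majorant of \<open>g\<close> the function \<rho> that exhibits the
  exceptional curves: on those curves the sum has infinite integral, on all others the majorant
  alone suffices. \<open>newtonian_space\<close> asks for such a genuine upper gradient.\<close>

lemma wug_imp_upper_gradient:
  assumes "wug f g" "Lp_integral p N g < \<infinity>"
  shows "\<exists>h\<in>Lp_loc p N. upper_gradient N (\<lambda>x. ereal (f x)) h"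
proof -
  obtain h where h: "h \<in> borel_on (space N)"
    "\<And>x. x \<in> space N \<Longrightarrow> g x \<le> h x" "AE x in N. g x = h x"
    by (rule borel_majorantE[OF wug_measurable[OF assms(1)]]) (rule that)
  have "Lp_integral p N h = Lp_integral p N g"
    by (intro nn_integral_cong_AE) (use h(3) in eventually_elim, simp)
  then have h_fin: "Lp_integral p N h < \<infinity>"
    using assms(2) by simp
  have "ae_curves p N (\<lambda>c. line_integral_defined g c \<and> endpoint_diff (\<lambda>x. ereal (f x)) c \<le> line_integral g c)"
    using assms(1) by (simp only: weak_upper_gradient_def ae_curves_def)
  then show ?thesis
  proof (rule ae_curvesE)
    fix \<rho> assume \<rho>: "\<rho> \<in> borel_on (space N)" "Lp_integral p N \<rho> < \<infinity>"
      and *: "\<And>c. c \<in> curves (space N) \<Longrightarrow> line_integral \<rho> c < \<infinity> \<Longrightarrow>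
        line_integral_defined g c \<and> endpoint_diff (\<lambda>x. ereal (f x)) c \<le> line_integral g c"
    have meas: "(\<lambda>x. h x + \<rho> x) \<in> borel_on (space N)"
      using h(1) \<rho>(1) by (rule borel_measurable_add)
    have "(\<lambda>x. h x + \<rho> x) \<in> Lp_loc p N"
      using h(1) h_fin \<rho> p
      by (intro Lp_locI borel_measurableI[OF meas] nn_integral_ennpowr_add_finite borel_measurableI) auto
    moreover have "endpoint_diff (\<lambda>x. ereal (f x)) c \<le> line_integral (\<lambda>x. h x + \<rho> x) c"
      if c: "c \<in> curves (space N)" for c
    proof (cases "line_integral \<rho> c < \<infinity>")
      case True
      have "endpoint_diff (\<lambda>x. ereal (f x)) c \<le> line_integral g c" by (rule conjunct2[OF *[OF c True]])
      also have "\<dots> \<le> line_integral (\<lambda>x. h x + \<rho> x) c"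
        unfolding line_integral_eq
      proof (rule nn_integral_mono)
        fix t
        show "along g c t \<le> along (\<lambda>x. h x + \<rho> x) c t"
        proof (cases "t \<in> {0..fst c}")
          case True
          have "g (snd c t) \<le> h (snd c t) + \<rho> (snd c t)"
            using h(2)[OF curves_in[OF c True]] by (rule order_trans) simp
          with True show ?thesis by (simp add: along_def)
        qed (simp add: along_def)
      qed
      finally show ?thesis .
    next
      case False
      have "line_integral \<rho> c \<le> line_integral (\<lambda>x. h x + \<rho> x) c"
        unfolding line_integral_eq by (rule nn_integral_mono) (auto simp: along_def intro!: mult_right_mono)
      then have "line_integral (\<lambda>x. h x + \<rho> x) c = \<infinity>"
        using False by (simp add: less_top[symmetric] top_unique)
      then show ?thesis by simp
    qed
    ultimately show ?thesis
      using meas by (intro bexI[of _ "\<lambda>x. h x + \<rho> x"]) (simp_all add: upper_gradient_def)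
  qed
qed

lemma newtonian_spaceI:
  assumes "f \<in> borel_measurable N" "\<And>x. x \<in> space N \<Longrightarrow> \<bar>f x\<bar> \<le> 1" "wug f g" "Lp_integral p N g < \<infinity>"
  shows "(\<lambda>x. ereal (f x)) \<in> newtonian_space p N"
proof -
  have "ennpowr (e2ennreal \<bar>ereal (f x)\<bar>) p \<le> 1" if "x \<in> space N" for x
    using assms(2)[OF that] p by (simp add: e2ennreal_ereal ennpowr_ennreal powr_le1)
  then have "(\<integral>\<^sup>+x. ennpowr (e2ennreal \<bar>ereal (f x)\<bar>) p \<partial>N) \<le> (\<integral>\<^sup>+x. 1 \<partial>N)"
    by (rule nn_integral_mono)
  also have "\<dots> < \<infinity>" using emeasure_finite by simp
  finally have "newtonian_norm p N (\<lambda>x. ereal (f x)) < \<infinity>"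
    using energy_le[OF assms(3,4)] assms(4)
    by (simp add: newtonian_norm_def ennpowr_less_top_iff le_less_trans)
  with wug_imp_upper_gradient[OF assms(3,4)] assms(1) show ?thesis
    by (simp add: newtonian_space_def)
qed

text \<open>A genuine upper gradient is a weak one with empty exceptional family, so a minimal
  gradient exists. Finiteness of the norm makes it p-integrable globally, not just locally.\<close>

lemma newtonian_spaceE:
  assumes "(\<lambda>x. ereal (f x)) \<in> newtonian_space p N"
  obtains g where "f \<in> borel_measurable N" "wug f g" "Lp_integral p N g < \<infinity>"
    "Lp_integral p N g = E f"
proof -
  let ?g = "min_weak_upper_gradient p N (\<lambda>x. ereal (f x))"
  obtain h where h: "h \<in> Lp_loc p N" "upper_gradient N (\<lambda>x. ereal (f x)) h"
    using assms by (auto simp: newtonian_space_def)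
  have "zero_modulus p N {}"
    by (auto simp: zero_modulus_def intro!: bexI[of _ "\<lambda>_. 0"])
  moreover have "{c \<in> curves (space N). \<not> (line_integral_defined h c \<and> endpoint_diff (\<lambda>x. ereal (f x)) c \<le> line_integral h c)} = {}"
    using h(2) by (auto simp: upper_gradient_def line_integral_defined_iff along_borel)
  ultimately have "wug f h"
    using Lp_loc_measurable[OF h(1)] by (simp only: weak_upper_gradient_def)
  from min_weak_upper_gradient[OF h(1) this] have "wug f ?g"
    by (simp add: is_minimal_weak_upper_gradient_def)
  moreover have "f \<in> borel_measurable N"
    using assms by (simp add: newtonian_space_def borel_measurable_ereal_iff)
  moreover have "E f < \<infinity>"
    using assms by (auto simp: newtonian_space_def newtonian_norm_def ennpowr_less_top_iff)
  ultimately show thesis by (intro that[of ?g]) (simp_all add: energy_def)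
qed

text \<open>The two-point bound is what lattice operations such as \<open>max f (min f' a)\<close>
  satisfy. Both increments are bounded by the same integral, so no sum of gradients arises.\<close>

lemma wug_max_gradient:
  assumes "wug f g" "wug f' g"
    and le: "\<And>x y. x \<in> space N \<Longrightarrow> y \<in> space N \<Longrightarrow> \<bar>h x - h y\<bar> \<le> max \<bar>f x - f y\<bar> \<bar>f' x - f' y\<bar>"
  shows "wug h g"
proof (rule wugI[OF wug_measurable[OF assms(1)]])
  show "ae_curves p N (\<lambda>c. gradient_along h g c)"
    using ae_curves_conj[OF wug_interval_gradient[OF assms(1)] wug_interval_gradient[OF assms(2)]]
  proof (rule ae_curves_mono)
    fix c assume c: "c \<in> curves (space N)" and
      *: "(measurable_gradient_along f g c) \<and>
        measurable_gradient_along f' g c"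
    show "gradient_along h g c"
      unfolding interval_gradient_def
    proof (intro allI impI)
      fix s t assume st: "0 \<le> s" "s \<le> t" "t \<le> fst c"
      have "\<bar>h (snd c s) - h (snd c t)\<bar> \<le> max \<bar>f (snd c s) - f (snd c t)\<bar> \<bar>f' (snd c s) - f' (snd c t)\<bar>"
        using st by (intro le curves_in[OF c]) auto
      then have "ennreal \<bar>h (snd c s) - h (snd c t)\<bar> \<le>
          max (ennreal \<bar>f (snd c s) - f (snd c t)\<bar>) (ennreal \<bar>f' (snd c s) - f' (snd c t)\<bar>)"
        by (auto simp: le_max_iff_disj intro: ennreal_leI)
      also have "\<dots> \<le> (\<integral>\<^sup>+r\<in>{s<..t}. along g c r \<partial>lebesgue)"
        using * interval_gradientD[OF _ st, of "\<lambda>t. f (snd c t)" "along g c"]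
          interval_gradientD[OF _ st, of "\<lambda>t. f' (snd c t)" "along g c"] by simp
      finally show "ennreal \<bar>h (snd c s) - h (snd c t)\<bar> \<le> (\<integral>\<^sup>+r\<in>{s<..t}. along g c r \<partial>lebesgue)" .
    qed
  qed
qed

text \<open>Serves midpoints with \<open>a = 1 / 2\<close> and differences with
  \<open>a = 1\<close>.\<close>

lemma wug_linear_gradient:
  assumes "wug f g" "wug f' g'" "0 \<le> a"
    and le: "\<And>x y. x \<in> space N \<Longrightarrow> y \<in> space N \<Longrightarrow> \<bar>h x - h y\<bar> \<le> a * (\<bar>f x - f y\<bar> + \<bar>f' x - f' y\<bar>)"
  shows "wug h (\<lambda>x. ennreal a * (g x + g' x))"
proof (rule wugI)
  show "(\<lambda>x. ennreal a * (g x + g' x)) \<in> borel_measurable N"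
    using wug_measurable[OF assms(1)] wug_measurable[OF assms(2)] by measurable
  show "ae_curves p N (\<lambda>c. gradient_along h (\<lambda>x. ennreal a * (g x + g' x)) c)"
    using ae_curves_conj[OF wug_interval_gradient[OF assms(1)] wug_interval_gradient[OF assms(2)]]
  proof (rule ae_curves_mono)
    fix c assume c: "c \<in> curves (space N)" and
      *: "(measurable_gradient_along f g c) \<and>
        measurable_gradient_along f' g' c"
    show "gradient_along h (\<lambda>x. ennreal a * (g x + g' x)) c"
      unfolding interval_gradient_def
    proof (intro allI impI)
      fix s t assume st: "0 \<le> s" "s \<le> t" "t \<le> fst c"
      have "\<bar>h (snd c s) - h (snd c t)\<bar> \<le> a * (\<bar>f (snd c s) - f (snd c t)\<bar> + \<bar>f' (snd c s) - f' (snd c t)\<bar>)"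
        using st by (intro le curves_in[OF c]) auto
      then have "ennreal \<bar>h (snd c s) - h (snd c t)\<bar> \<le>
          ennreal a * (ennreal \<bar>f (snd c s) - f (snd c t)\<bar> + ennreal \<bar>f' (snd c s) - f' (snd c t)\<bar>)"
        using \<open>0 \<le> a\<close> by (simp add: ennreal_mult[symmetric] ennreal_plus[symmetric] ennreal_leI del: ennreal_plus)
      also have "\<dots> \<le> ennreal a * ((\<integral>\<^sup>+r\<in>{s<..t}. along g c r \<partial>lebesgue) + (\<integral>\<^sup>+r\<in>{s<..t}. along g' c r \<partial>lebesgue))"
        using * interval_gradientD[OF _ st, of "\<lambda>t. f (snd c t)" "along g c"]
          interval_gradientD[OF _ st, of "\<lambda>t. f' (snd c t)" "along g' c"]
        by (intro mult_left_mono add_mono) simp_all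
      also have "\<dots> = ennreal a * (\<integral>\<^sup>+r. along g c r * indicator {s<..t} r + along g' c r * indicator {s<..t} r \<partial>lebesgue)"
        using * by (subst nn_integral_add) (auto intro!: borel_measurable_times_ennreal borel_measurable_indicator)
      also have "\<dots> = (\<integral>\<^sup>+r. ennreal a * (along g c r * indicator {s<..t} r + along g' c r * indicator {s<..t} r) \<partial>lebesgue)"
        using * by (intro nn_integral_cmult[symmetric])
          (auto intro!: borel_measurable_add borel_measurable_times_ennreal borel_measurable_indicator)
      also have "\<dots> = (\<integral>\<^sup>+r\<in>{s<..t}. along (\<lambda>x. ennreal a * (g x + g' x)) c r \<partial>lebesgue)"
        by (intro nn_integral_cong) (auto simp: along_def distrib_left split: split_indicator)
      finally show "ennreal \<bar>h (snd c s) - h (snd c t)\<bar> \<le> (\<integral>\<^sup>+r\<in>{s<..t}. along (\<lambda>x. ennreal a * (g x + g' x)) c r \<partial>lebesgue)" .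
    qed
  qed
qed

lemma wug_level:
  assumes "g \<in> Lp_loc p N" "wug f g" "f \<in> borel_measurable N"
  shows "wug f (\<lambda>x. if f x = a then 0 else g x)"
proof (rule wugI)
  show "(\<lambda>x. if f x = a then 0 else g x) \<in> borel_measurable N"
    using assms(3) Lp_loc_measurable[OF assms(1)] by measurable
  show "ae_curves p N (\<lambda>c. gradient_along f (\<lambda>x. if f x = a then 0 else g x) c)"
    using wug_Lp_loc_interval_gradient[OF assms(1,2)]
  proof (rule ae_curves_mono)
    fix c assume c: "c \<in> curves (space N)" and *: "finite_gradient_along f g c"
    have "along (\<lambda>x. if f x = a then 0 else g x) c = (\<lambda>r. if f (snd c r) = a then 0 else along g c r)"
      by (auto simp: along_def)
    with * show "gradient_along f (\<lambda>x. if f x = a then 0 else g x) c"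
      by (simp add: interval_gradient_level)
  qed
qed

text \<open>On almost every curve \<open>f\<close> is continuous and equals \<open>a\<close> at
  almost every parameter, hence at all of them. In this way a null set is recognized as one that
  almost no curve meets.\<close>

lemma wug_AE_const:
  assumes "g \<in> Lp_loc p N" "wug f g" "AE x in N. f x = a"
  shows "ae_curves p N (\<lambda>c. \<forall>t\<in>{0..fst c}. f (snd c t) = a)"
  using ae_curves_conj[OF wug_Lp_loc_interval_gradient[OF assms(1,2)] ae_curves_AE[OF assms(3)]]
proof (rule ae_curves_mono, intro ballI)
  fix c t assume c: "c \<in> curves (space N)" and t: "t \<in> {0..fst c}" and
    *: "(finite_gradient_along f g c) \<and>
      (AE t in lebesgue. t \<in> {0..fst c} \<longrightarrow> f (snd c t) = a)"
  have "0 < fst c" using c by (auto simp: curves_def)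
  with * t show "f (snd c t) = a"
    by (intro interval_gradient_AE_const[of "fst c" "\<lambda>t. f (snd c t)" "along g c" a t]) auto
qed

text \<open>Two gradients play different roles: \<open>g\<close> belongs to all \<open>f n\<close>
  and supplies equicontinuity, whereas \<open>h\<close> belongs only to the tail and is inherited by
  the limit.\<close>

lemma wug_lim:
  assumes f: "\<And>n::nat. wug (f n) g" and g: "g \<in> Lp_loc p N" and conv: "AE x in N. convergent (\<lambda>n. f n x)"
    and lim: "\<And>x L. x \<in> space N \<Longrightarrow> (\<lambda>n. f n x) \<longlonglongrightarrow> L \<Longrightarrow> u x = L"
    and h: "\<And>n. n \<ge> k \<Longrightarrow> wug (f n) h"
  shows "wug u h"
proof (rule wugI)
  show "h \<in> borel_measurable N" using wug_measurable[OF h[of k]] by simp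
  have "ae_curves p N (\<lambda>c. \<forall>n. along h c \<in> borel_measurable lebesgue \<and>
      gradient_along (f (n + k)) h c)"
    by (intro ae_curves_all_nat wug_interval_gradient h) simp
  from ae_curves_conj[OF ae_curves_conj[OF this ae_curves_all_nat[OF wug_Lp_loc_interval_gradient[OF g f]]]
      ae_curves_AE[OF conv]]
  show "ae_curves p N (\<lambda>c. gradient_along u h c)"
  proof (rule ae_curves_mono)
    fix c assume c: "c \<in> curves (space N)" and *: "((\<forall>n. along h c \<in> borel_measurable lebesgue \<and>
        gradient_along (f (n + k)) h c) \<and>
        (\<forall>n. finite_gradient_along (f n) g c)) \<and>
        (AE t in lebesgue. t \<in> {0..fst c} \<longrightarrow> convergent (\<lambda>n. f n (snd c t)))"
    have "0 < fst c" using c by (auto simp: curves_def)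
    have shift: "convergent (\<lambda>n. X (n + k)) = convergent X" for X :: "nat \<Rightarrow> real"
      by (rule convergent_ignore_initial_segment)
    have facts: "gradient_along (f (n + k)) g c"
      "along g c \<in> borel_measurable lebesgue" "(\<integral>\<^sup>+t. along g c t \<partial>lebesgue) < \<infinity>"
      "AE r in lebesgue. r \<in> {0..fst c} \<longrightarrow> convergent (\<lambda>n. f (n + k) (snd c r))"
      "gradient_along (f (n + k)) h c" for n
      using conjunct2[OF conjunct1[OF *]] conjunct2[OF *] conjunct1[OF conjunct1[OF *]]
      by (simp_all only: shift[of "\<lambda>n. f n x" for x])
    \<comment> \<open>On these curves the sequence converges at every parameter, so \<open>u\<close>
      is the limit there, whatever values it takes at points of divergence.\<close>
    have u: "u (snd c t) = lim (\<lambda>n. f (n + k) (snd c t))" if t: "t \<in> {0..fst c}" for t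
    proof -
      have "convergent (\<lambda>n. f (n + k) (snd c t))"
        by (rule interval_gradient_lim(1)[where F="\<lambda>n t. f (n + k) (snd c t)",
              OF facts(1-3) \<open>0 < fst c\<close> facts(4) t])
      then have "(\<lambda>n. f (n + k) (snd c t)) \<longlonglongrightarrow> lim (\<lambda>n. f (n + k) (snd c t))"
        by (simp add: convergent_LIMSEQ_iff)
      then have "(\<lambda>n. f n (snd c t)) \<longlonglongrightarrow> lim (\<lambda>n. f (n + k) (snd c t))"
        by (rule LIMSEQ_offset)
      then show ?thesis by (rule lim[OF curves_in[OF c t]])
    qed
    have "interval_gradient (fst c) (\<lambda>t. lim (\<lambda>n. f (n + k) (snd c t))) (along h c)"
      by (rule interval_gradient_lim(2)[where F="\<lambda>n t. f (n + k) (snd c t)",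
            OF facts(1-3) \<open>0 < fst c\<close> facts(4,5)])
    then show "gradient_along u h c"
      by (simp add: interval_gradient_def u)
  qed
qed

end

section \<open>Uniform convexity of the Lebesgue spaces\<close>

text \<open>The power lies strictly above its tangent at 1, by the mean value theorem on either
  side. Strictness is what later makes the modulus of convexity positive.\<close>

lemma Bernoulli_powr_strict:
  fixes p y :: real
  assumes "1 < p" "0 \<le> y" "y \<noteq> 1"
  shows "1 + p * (y - 1) < y powr p"
proof -
  have deriv: "((\<lambda>x. x powr p) has_real_derivative p * x powr (p - 1)) (at x)" if "0 < x" for x
    using that by (rule has_real_derivative_powr)
  consider "y = 0" | "0 < y" "y < 1" | "1 < y" using assms by linarith
  then show ?thesis
  proof cases
    case 1
    then show ?thesis using assms by simp
  next
    case 2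
    obtain z where z: "y < z" "z < 1" "1 powr p - y powr p = (1 - y) * (p * z powr (p - 1))"
      using MVT2[of y 1 "\<lambda>x. x powr p" "\<lambda>x. p * x powr (p - 1)"] 2 deriv by force
    have "z powr (p - 1) < 1 powr (p - 1)"
      using z 2 assms by (intro powr_less_mono2) auto
    then have "(1 - y) * (p * z powr (p - 1)) < (1 - y) * p"
      using 2 assms by simp
    with z show ?thesis by (simp add: algebra_simps)
  next
    case 3
    obtain z where z: "1 < z" "z < y" "y powr p - 1 powr p = (y - 1) * (p * z powr (p - 1))"
      using MVT2[of 1 y "\<lambda>x. x powr p" "\<lambda>x. p * x powr (p - 1)"] 3 deriv by force
    have "1 powr (p - 1) < z powr (p - 1)"
      using z assms by (intro powr_less_mono2) auto
    then have "(y - 1) * p < (y - 1) * (p * z powr (p - 1))"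
      using 3 assms by simp
    with z show ?thesis by (simp add: algebra_simps)
  qed
qed

lemma Bernoulli_powr:
  fixes p y :: real
  assumes "1 < p" "0 \<le> y"
  shows "1 + p * (y - 1) \<le> y powr p"
  using Bernoulli_powr_strict[OF assms] by (cases "y = 1") auto

text \<open>After division by the midpoint \<open>m\<close>, the tangent bounds at
  \<open>a / m\<close> and \<open>b / m\<close> are added and their linear terms cancel.\<close>

lemma powr_midpoint_le:
  fixes a b p :: real
  assumes "1 < p" "0 \<le> a" "0 \<le> b"
  shows "((a + b) / 2) powr p \<le> (a powr p + b powr p) / 2"
proof (cases "a + b = 0")
  case False
  define m where "m = (a + b) / 2"
  have m: "0 < m" using False assms by (simp add: m_def)
  have "1 + p * (a / m - 1) \<le> (a / m) powr p" "1 + p * (b / m - 1) \<le> (b / m) powr p"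
    using assms m by (auto intro!: Bernoulli_powr)
  moreover have "a + b = 2 * m" by (simp add: m_def)
  then have "a / m + b / m = 2"
    using m unfolding add_divide_distrib[symmetric] by simp
  then have "p * (a / m - 1) + p * (b / m - 1) = 0"
    unfolding distrib_left[symmetric] by simp
  ultimately have "2 \<le> (a / m) powr p + (b / m) powr p" by linarith
  then have "2 \<le> (a powr p + b powr p) / m powr p"
    using assms m by (simp add: powr_divide add_divide_distrib)
  then show ?thesis using m by (simp add: field_simps m_def)
qed (use assms in simp)

text \<open>A pointwise substitute for Clarkson's inequalities, uniform in \<open>p > 1\<close>: the
  distance is bounded by the midpoint defect up to a small multiple of the powers. Homogeneity
  reduces it to the pair \<open>1 + s\<close>, \<open>1 - s\<close>, whose defect is
  \<open>\<phi> s\<close>. Small \<open>s\<close> is absorbed by \<epsilon>; away from 0 compactness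
  bounds \<phi> below.\<close>

lemma powr_uniform_convexity:
  fixes p \<epsilon> :: real
  assumes p: "1 < p" and \<epsilon>: "0 < \<epsilon>"
  obtains C where "0 \<le> C" "\<And>a b. 0 \<le> a \<Longrightarrow> 0 \<le> b \<Longrightarrow> \<bar>a - b\<bar> powr p \<le>
    \<epsilon> * (a powr p + b powr p) + C * ((a powr p + b powr p) / 2 - ((a + b) / 2) powr p)"
proof -
  define \<phi> where "\<phi> s = ((1 + s) powr p + (1 - s) powr p) / 2 - 1" for s
  have \<phi>_pos: "0 < \<phi> s" if "0 < s" "s \<le> 1" for s
    using Bernoulli_powr_strict[OF p, of "1 + s"] Bernoulli_powr_strict[OF p, of "1 - s"] that
    by (simp add: \<phi>_def)
  have \<phi>_nonneg: "0 \<le> \<phi> s" if "0 \<le> s" "s \<le> 1" for s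
    using Bernoulli_powr[OF p, of "1 + s"] Bernoulli_powr[OF p, of "1 - s"] that
    by (simp add: \<phi>_def)
  \<comment> \<open>Up to \<open>s0\<close> the left side \<open>(2 * s) powr p\<close> is at most
    \<epsilon>, and the factor next to \<epsilon> is at least 2 by convexity.\<close>
  define s0 where "s0 = min 1 (\<epsilon> powr (1 / p) / 2)"
  have s0: "0 < s0" "s0 \<le> 1" using \<epsilon> by (simp_all add: s0_def)
  have "continuous_on {s0..1} \<phi>"
    unfolding \<phi>_def using s0 p by (intro continuous_intros continuous_on_powr') auto
  then obtain x where x: "x \<in> {s0..1}" "\<forall>s\<in>{s0..1}. \<phi> x \<le> \<phi> s"
    using continuous_attains_inf[of "{s0..1}" \<phi>] s0 by auto
  \<comment> \<open>Above \<open>s0\<close> the left side is at most \<open>2 powr p\<close>, while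
    \<phi> is at least its positive minimum \<open>\<phi> x\<close>.\<close>
  define C where "C = 2 powr p / \<phi> x"
  have \<phi>x: "0 < \<phi> x" using x(1) s0 by (intro \<phi>_pos) auto
  have C: "0 \<le> C" using \<phi>x by (simp add: C_def)
  have unit: "(2 * s) powr p \<le> \<epsilon> * ((1 + s) powr p + (1 - s) powr p) + C * \<phi> s" if s: "0 \<le> s" "s \<le> 1" for s
  proof (cases "s \<le> s0")
    case True
    have "(2 * s) powr p \<le> (\<epsilon> powr (1 / p)) powr p"
      using True s p by (intro powr_mono2) (auto simp: s0_def)
    also have "\<dots> = \<epsilon>" using \<epsilon> p by (simp add: powr_powr)
    also have "\<dots> \<le> \<epsilon> * ((1 + s) powr p + (1 - s) powr p)"
      using \<phi>_nonneg[OF s] \<epsilon> by (simp add: \<phi>_def)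
    also have "\<dots> \<le> \<epsilon> * ((1 + s) powr p + (1 - s) powr p) + C * \<phi> s"
      using C \<phi>_nonneg[OF s] by simp
    finally show ?thesis .
  next
    case False
    have "(2 * s) powr p \<le> 2 powr p"
      using s p by (intro powr_mono2) auto
    also have "\<dots> = C * \<phi> x" using \<phi>x by (simp add: C_def)
    also have "\<dots> \<le> C * \<phi> s" using x(2) False s C by (intro mult_left_mono) auto
    also have "\<dots> \<le> \<epsilon> * ((1 + s) powr p + (1 - s) powr p) + C * \<phi> s" using \<epsilon> by simp
    finally show ?thesis .
  qed
  have ordered: "\<bar>a - b\<bar> powr p \<le>
    \<epsilon> * (a powr p + b powr p) + C * ((a powr p + b powr p) / 2 - ((a + b) / 2) powr p)"
    if ab: "0 \<le> b" "b \<le> a" for a b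
  proof (cases "a = 0")
    case False
    define m where "m = (a + b) / 2"
    \<comment> \<open>The relative half-difference, so that \<open>a = m * (1 + s)\<close> and
      \<open>b = m * (1 - s)\<close>.\<close>
    define s where "s = (a - b) / (2 * m)"
    have m: "0 < m" using ab False by (simp add: m_def)
    have s: "0 \<le> s" "s \<le> 1" using ab m by (simp_all add: s_def m_def field_simps)
    have eq: "a = m * (1 + s)" "b = m * (1 - s)" "\<bar>a - b\<bar> = m * (2 * s)"
      using m ab by (simp_all add: s_def m_def field_simps)
    have pw: "a powr p = m powr p * (1 + s) powr p" "b powr p = m powr p * (1 - s) powr p"
      "\<bar>a - b\<bar> powr p = m powr p * (2 * s) powr p"
      unfolding eq(3) using m s by (simp_all add: powr_mult eq(1,2))
    have "m powr p * (2 * s) powr p \<le> m powr p * (\<epsilon> * ((1 + s) powr p + (1 - s) powr p) + C * \<phi> s)"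
      using unit[OF s] by (intro mult_left_mono) auto
    also have "\<dots> = \<epsilon> * (a powr p + b powr p) + C * ((a powr p + b powr p) / 2 - m powr p)"
      unfolding pw(1,2) \<phi>_def by (simp add: field_simps)
    finally show ?thesis by (simp add: pw(3) m_def)
  qed (use ab in simp)
  show thesis
  proof (rule that[OF C])
    fix a b :: real assume "0 \<le> a" "0 \<le> b"
    then show "\<bar>a - b\<bar> powr p \<le>
      \<epsilon> * (a powr p + b powr p) + C * ((a powr p + b powr p) / 2 - ((a + b) / 2) powr p)"
      using ordered[of b a] ordered[of a b] by (cases "b \<le> a") (simp_all add: abs_minus_commute add.commute)
  qed
qed

section \<open>Cauchy sequences and rapid convergence in Lebesgue spaces\<close>

abbreviation Lp_power :: "real \<Rightarrow> 'a measure \<Rightarrow> ('a \<Rightarrow> real) \<Rightarrow> ennreal" where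
  "Lp_power p M f \<equiv> (\<integral>\<^sup>+x. ennreal (f x powr p) \<partial>M)"

abbreviation Lp_dist :: "real \<Rightarrow> 'a measure \<Rightarrow> ('a \<Rightarrow> real) \<Rightarrow> ('a \<Rightarrow> real) \<Rightarrow> ennreal" where
  "Lp_dist p M f g \<equiv> (\<integral>\<^sup>+x. ennreal (\<bar>f x - g x\<bar> powr p) \<partial>M)"

abbreviation Lp_mid :: "real \<Rightarrow> 'a measure \<Rightarrow> ('a \<Rightarrow> real) \<Rightarrow> ('a \<Rightarrow> real) \<Rightarrow> ennreal" where
  "Lp_mid p M f g \<equiv> (\<integral>\<^sup>+x. ennreal (((f x + g x) / 2) powr p) \<partial>M)"

text \<open>If p-th powers of norms are eventually near \<open>c\<close> from above and midpoints do
  not fall noticeably below \<open>c\<close>, the integrated midpoint defect is small. Integrating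
  the pointwise convexity inequality then makes the distances small.\<close>

lemma Lp_Cauchy_of_midpoints:
  fixes a :: "nat \<Rightarrow> 'a \<Rightarrow> real"
  assumes p: "1 < p" and c: "0 \<le> c"
    and meas [measurable]: "\<And>n. a n \<in> borel_measurable M" and nonneg: "\<And>n x. 0 \<le> a n x"
    and upper: "\<And>e. 0 < e \<Longrightarrow> \<exists>K. \<forall>n\<ge>K. Lp_power p M (a n) \<le> ennreal (c + e)"
    and lower: "\<And>e. 0 < e \<Longrightarrow>
      \<exists>K. \<forall>n\<ge>K. \<forall>m\<ge>n. ennreal (c - e) \<le> Lp_mid p M (a n) (a m)"
    and e: "0 < e"
  shows "\<exists>K. \<forall>n\<ge>K. \<forall>m\<ge>n. Lp_dist p M (a n) (a m) \<le> ennreal e"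
proof -
  \<comment> \<open>The final estimate is \<open>2 * \<epsilon> * (c + d) + 2 * C * d\<close>. With
    \<open>d <= 1\<close>, the choices of \<epsilon> and of \<open>d\<close> below make each summand
    at most \<open>e / 2\<close>. Since \<open>C\<close> depends on \<epsilon>, \<open>d\<close> is
    chosen last.\<close>
  define \<epsilon> where "\<epsilon> = e / (4 * (c + 1))"
  have \<epsilon>: "0 < \<epsilon>" using e c by (simp add: \<epsilon>_def)
  obtain C where C: "0 \<le> C" "\<And>a b. 0 \<le> a \<Longrightarrow> 0 \<le> b \<Longrightarrow> \<bar>a - b\<bar> powr p \<le>
      \<epsilon> * (a powr p + b powr p) + C * ((a powr p + b powr p) / 2 - ((a + b) / 2) powr p)"
    using powr_uniform_convexity[OF p \<epsilon>] by blast
  define d where "d = min 1 (e / (4 * (C + 1)))"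
  have d: "0 < d" "d \<le> 1" using e C(1) by (simp_all add: d_def)
  obtain K1 where K1: "\<forall>n\<ge>K1. Lp_power p M (a n) \<le> ennreal (c + d)"
    using upper[OF d(1)] ..
  obtain K2 where K2: "\<forall>n\<ge>K2. \<forall>m\<ge>n. ennreal (c - d) \<le> Lp_mid p M (a n) (a m)"
    using lower[OF d(1)] ..
  have "Lp_dist p M (a n) (a m) \<le> ennreal e"
    if nm: "n \<ge> max K1 K2" "m \<ge> n" for n m
  proof -
    let ?X = "\<integral>\<^sup>+x. ennreal (\<bar>a n x - a m x\<bar> powr p) \<partial>M"
    let ?Y = "\<integral>\<^sup>+x. ennreal (((a n x + a m x) / 2) powr p) \<partial>M"
    \<comment> \<open>The midpoint term stands on the left, which avoids subtraction of extended
      numbers.\<close>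
    have pointwise: "ennreal (\<bar>a n x - a m x\<bar> powr p) + ennreal C * ennreal (((a n x + a m x) / 2) powr p)
        \<le> ennreal (\<epsilon> + C / 2) * (ennreal (a n x powr p) + ennreal (a m x powr p))" for x
    proof -
      have "\<bar>a n x - a m x\<bar> powr p + C * ((a n x + a m x) / 2) powr p
          \<le> (\<epsilon> + C / 2) * (a n x powr p + a m x powr p)"
        using C(2)[OF nonneg nonneg, of n x m x] by (simp add: algebra_simps add_divide_distrib)
      then show ?thesis
        using C(1) \<epsilon> by (simp add: ennreal_mult[symmetric] ennreal_plus[symmetric] ennreal_leI del: ennreal_plus)
    qed
    have "?X + ennreal C * ?Y = (\<integral>\<^sup>+x. ennreal (\<bar>a n x - a m x\<bar> powr p) +
        ennreal C * ennreal (((a n x + a m x) / 2) powr p) \<partial>M)"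
      by (simp add: nn_integral_add nn_integral_cmult)
    also have "\<dots> \<le> (\<integral>\<^sup>+x. ennreal (\<epsilon> + C / 2) * (ennreal (a n x powr p) + ennreal (a m x powr p)) \<partial>M)"
      by (intro nn_integral_mono pointwise)
    also have "\<dots> = ennreal (\<epsilon> + C / 2) * (Lp_power p M (a n) + Lp_power p M (a m))"
      by (simp add: nn_integral_add nn_integral_cmult)
    also have "\<dots> \<le> ennreal (\<epsilon> + C / 2) * (ennreal (c + d) + ennreal (c + d))"
      using K1 nm by (intro mult_left_mono add_mono) auto
    also have "\<dots> = ennreal ((\<epsilon> + C / 2) * (2 * (c + d)))"
      using c d C(1) \<epsilon> by (simp add: ennreal_mult[symmetric] ennreal_plus[symmetric] algebra_simps del: ennreal_plus)
    finally have XY: "?X + ennreal C * ?Y \<le> ennreal ((\<epsilon> + C / 2) * (2 * (c + d)))" .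
    have "ennreal C * ennreal (c - d) \<le> ennreal C * ?Y"
      using K2 nm by (intro mult_left_mono) auto
    then have "?X + ennreal C * ennreal (c - d) \<le> ?X + ennreal C * ?Y"
      by (rule add_left_mono)
    with XY have le: "?X + ennreal C * ennreal (c - d) \<le> ennreal ((\<epsilon> + C / 2) * (2 * (c + d)))"
      by (rule order_trans[rotated])
    have "?X \<le> ?X + ennreal C * ennreal (c - d)" by simp
    with le have X_le: "?X \<le> ennreal ((\<epsilon> + C / 2) * (2 * (c + d)))" by (rule order_trans[rotated])
    then have "?X < top" by (rule le_less_trans) simp
    then obtain x where x: "?X = ennreal x" "0 \<le> x" by (cases ?X) auto
    \<comment> \<open>For \<open>c < d\<close> the number \<open>ennreal (c - d)\<close> is
      truncated to 0 and carries no information, but then \<open>C * (c - d)\<close> is nonpositive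
      and can be added freely.\<close>
    have "x + C * (c - d) \<le> (\<epsilon> + C / 2) * (2 * (c + d))"
    proof (cases "0 \<le> c - d")
      case True
      then have "ennreal (x + C * (c - d)) \<le> ennreal ((\<epsilon> + C / 2) * (2 * (c + d)))"
        using le x C(1) by (simp add: ennreal_mult ennreal_plus)
      then show ?thesis
        using c d C(1) \<epsilon> by (subst (asm) ennreal_le_iff) auto
    next
      case False
      have "x \<le> (\<epsilon> + C / 2) * (2 * (c + d))"
        using X_le c d C(1) \<epsilon> unfolding x(1) by (subst (asm) ennreal_le_iff) auto
      moreover have "C * (c - d) \<le> 0"
        using False C(1) by (intro mult_nonneg_nonpos) auto
      ultimately show ?thesis by linarith
    qed
    then have "x \<le> 2 * \<epsilon> * (c + d) + 2 * C * d"
      by (simp add: algebra_simps)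
    also have "2 * \<epsilon> * (c + d) \<le> 2 * \<epsilon> * (c + 1)"
      using \<epsilon> d by (intro mult_left_mono) auto
    also have "2 * \<epsilon> * (c + 1) = e / 2"
      using c by (simp add: \<epsilon>_def field_simps)
    also have "2 * C * d \<le> 2 * C * (e / (4 * (C + 1)))"
      using C(1) by (intro mult_left_mono) (auto simp: d_def)
    also have "\<dots> \<le> e / 2"
      using C(1) e by (simp add: field_simps)
    finally have "x \<le> e" by simp
    then show ?thesis unfolding x(1) by (rule ennreal_leI)
  qed
  then show ?thesis by blast
qed

text \<open>The Cauchy criterion is applied to the alternating sequence of \<open>f\<close> and
  \<open>g\<close>: arbitrarily late neighbours have the distance of \<open>f\<close> and
  \<open>g\<close>, which is therefore 0.\<close>

lemma Lp_midpoint_eq_imp_AE_eq: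
  fixes f g :: "'a \<Rightarrow> real"
  assumes p: "1 < p" and c: "0 \<le> c"
    and [measurable]: "f \<in> borel_measurable M" "g \<in> borel_measurable M"
    and nonneg: "\<And>x. 0 \<le> f x" "\<And>x. 0 \<le> g x"
    and fg: "Lp_power p M f = ennreal c" "Lp_power p M g = ennreal c"
    and mid: "ennreal c \<le> Lp_mid p M f g"
  shows "AE x in M. f x = g x"
proof -
  define a where "a n = (if even n then f else g)" for n :: nat
  have "Lp_dist p M f g \<le> ennreal e" if "0 < e" for e
  proof -
    have le: "ennreal (c - e) \<le> ennreal c" if "0 < e" for e
      using that by (intro ennreal_leI) simp
    have mid': "ennreal c \<le> Lp_mid p M g f"
      using mid by (simp add: add.commute)
    have "\<exists>K. \<forall>n\<ge>K. \<forall>m\<ge>n. Lp_dist p M (a n) (a m) \<le> ennreal e"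
    proof (rule Lp_Cauchy_of_midpoints[OF p c _ _ _ _ \<open>0 < e\<close>])
      show "\<exists>K. \<forall>n\<ge>K. Lp_power p M (a n) \<le> ennreal (c + e)" if "0 < e" for e
        using that fg by (auto simp: a_def intro!: ennreal_leI)
      show "\<exists>K. \<forall>n\<ge>K. \<forall>m\<ge>n. ennreal (c - e) \<le> Lp_mid p M (a n) (a m)"
        if "0 < e" for e
        using order_trans[OF le[OF that] mid] order_trans[OF le[OF that] mid'] fg le[OF that]
        by (simp add: a_def)
    qed (auto simp: a_def nonneg)
    then obtain K where "\<forall>n\<ge>K. \<forall>m\<ge>n. Lp_dist p M (a n) (a m) \<le> ennreal e" ..
    then have "Lp_dist p M (a (2 * K)) (a (Suc (2 * K))) \<le> ennreal e" by simp
    then show ?thesis by (simp add: a_def)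
  qed
  then have "Lp_dist p M f g \<le> 0"
    by (intro ennreal_le_epsilon[where y=0]) simp_all
  then have "Lp_dist p M f g = 0"
    by simp
  then have "AE x in M. ennreal (\<bar>f x - g x\<bar> powr p) = 0"
    by (subst (asm) nn_integral_0_iff_AE) simp_all
  then show ?thesis by eventually_elim (auto simp: ennreal_eq_0_iff)
qed

text \<open>\<open>P\<close> may be a conjunction, so that functions and gradients converge rapidly
  along one and the same subsequence.\<close>

lemma common_rapid_subsequence:
  assumes "\<And>k. \<exists>K. \<forall>n\<ge>K. \<forall>m\<ge>n. P k n m"
  shows "\<exists>r :: nat \<Rightarrow> nat. strict_mono r \<and> (\<forall>k. P k (r k) (r (Suc k)))"
proof -
  from choice[of "\<lambda>k K. \<forall>n\<ge>K. \<forall>m\<ge>n. P k n m"] assms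
  obtain K where K: "\<forall>k. \<forall>n\<ge>K k. \<forall>m\<ge>n. P k n m" by blast
  \<comment> \<open>The sum of all thresholds so far exceeds each of them, and the summand
    \<open>k\<close> makes the sequence strictly increasing.\<close>
  define r where "r k = k + (\<Sum>i\<le>k. K i)" for k
  have "strict_mono r" by (rule strict_monoI_Suc) (simp add: r_def)
  moreover have "K k \<le> r k" for k
    unfolding r_def by (rule trans_le_add2) (simp add: member_le_sum)
  moreover have "r k \<le> r (Suc k)" for k by (simp add: r_def)
  ultimately show ?thesis using K by blast
qed

text \<open>\<open>s\<close> is the sum of the absolute increments, so its finiteness gives
  convergence and it dominates the whole sequence. The rate \<open>1 / 4 ^ k\<close> leaves a factor
  \<open>1 / 2 ^ k\<close> after the weights \<open>2 ^ k\<close> have been used up.\<close>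

lemma Lp_rapid_convergence:
  fixes f :: "nat \<Rightarrow> 'a \<Rightarrow> real"
  assumes p: "1 < p" and meas [measurable]: "\<And>n. f n \<in> borel_measurable M"
    and rapid: "\<And>k. Lp_dist p M (f k) (f (Suc k)) \<le> ennreal ((1 / 4 ^ k) powr p)"
  obtains s where "s \<in> borel_measurable M" "Lp_integral p M s < \<infinity>"
    "\<And>k x. ennreal \<bar>f k x\<bar> \<le> ennreal \<bar>f 0 x\<bar> + s x" "AE x in M. convergent (\<lambda>k. f k x)"
proof -
  define d where "d k x = \<bar>f k x - f (Suc k) x\<bar>" for k x
  have [measurable]: "d k \<in> borel_measurable M" for k unfolding d_def by measurable
  define s where "s x = (\<Sum>k. ennreal (d k x))" for x
  have s_meas: "s \<in> borel_measurable M" unfolding s_def by measurable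
  have geo: "(\<Sum>k. ennreal ((1 / 2) ^ k)) = ennreal 2"
    by (subst suminf_ennreal2) (simp_all add: summable_geometric suminf_geometric)
  \<comment> \<open>The weights trade the sum for a supremum, at the price of the geometric series
    with sum 2; the p-th power of a supremum is then bounded by a series.\<close>
  have s_le: "s x \<le> ennreal 2 * (SUP k. ennreal (2 ^ k) * ennreal (d k x))" for x
  proof -
    have "ennreal (d k x) \<le> ennreal ((1 / 2) ^ k) * (SUP k. ennreal (2 ^ k) * ennreal (d k x))" for k
    proof -
      have "ennreal (d k x) = ennreal ((1 / 2) ^ k) * (ennreal (2 ^ k) * ennreal (d k x))"
        by (simp add: ennreal_mult[symmetric] d_def power_one_over)
      also have "\<dots> \<le> ennreal ((1 / 2) ^ k) * (SUP k. ennreal (2 ^ k) * ennreal (d k x))"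
        by (intro mult_left_mono SUP_upper) auto
      finally show ?thesis .
    qed
    then have "s x \<le> (\<Sum>k. ennreal ((1 / 2) ^ k) * (SUP k. ennreal (2 ^ k) * ennreal (d k x)))"
      unfolding s_def by (intro suminf_le) auto
    also have "\<dots> = ennreal 2 * (SUP k. ennreal (2 ^ k) * ennreal (d k x))"
      by (simp only: ennreal_suminf_multc geo)
    finally show ?thesis .
  qed
  have "Lp_integral p M s \<le> (\<integral>\<^sup>+x. ennreal (2 powr p) * (\<Sum>k. ennpowr (ennreal (2 ^ k) * ennreal (d k x)) p) \<partial>M)"
  proof (rule nn_integral_mono)
    fix x
    have "ennpowr (s x) p \<le> ennpowr (ennreal 2 * (SUP k. ennreal (2 ^ k) * ennreal (d k x))) p"
      using p s_le by (intro ennpowr_mono) auto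
    also have "\<dots> = ennreal (2 powr p) * ennpowr (SUP k. ennreal (2 ^ k) * ennreal (d k x)) p"
      by (rule ennpowr_mult) simp
    also have "\<dots> \<le> ennreal (2 powr p) * (\<Sum>k. ennpowr (ennreal (2 ^ k) * ennreal (d k x)) p)"
      using p by (intro mult_left_mono ennpowr_SUP_le_suminf) auto
    finally show "ennpowr (s x) p \<le> ennreal (2 powr p) * (\<Sum>k. ennpowr (ennreal (2 ^ k) * ennreal (d k x)) p)" .
  qed
  also have "\<dots> = ennreal (2 powr p) * (\<Sum>k. \<integral>\<^sup>+x. ennpowr (ennreal (2 ^ k) * ennreal (d k x)) p \<partial>M)"
    by (simp add: nn_integral_cmult nn_integral_suminf)
  also have "ennreal (2 powr p) * (\<Sum>k. \<integral>\<^sup>+x. ennpowr (ennreal (2 ^ k) * ennreal (d k x)) p \<partial>M) \<le>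
      ennreal (2 powr p) * (\<Sum>k. ennreal ((1 / 2) ^ k))"
  proof (intro mult_left_mono suminf_le)
    fix k
    have "(\<integral>\<^sup>+x. ennpowr (ennreal (2 ^ k) * ennreal (d k x)) p \<partial>M) =
        ennreal ((2 ^ k) powr p) * Lp_power p M (d k)"
      by (simp add: ennpowr_mult ennpowr_ennreal d_def nn_integral_cmult)
    also have "\<dots> \<le> ennreal ((2 ^ k) powr p) * ennreal ((1 / 4 ^ k) powr p)"
      using rapid[of k] by (intro mult_left_mono) (simp_all add: d_def)
    also have "\<dots> = ennreal ((2 ^ k * (1 / 4 ^ k)) powr p)"
    proof -
      have "(2 ^ k * (1 / 4 ^ k)) powr p = (2 ^ k) powr p * (1 / 4 ^ k :: real) powr p"
        using powr_mult[of "2 ^ k :: real" "1 / 4 ^ k" p] by simp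
      then show ?thesis by (simp only: ennreal_mult''[OF powr_ge_zero])
    qed
    also have "2 ^ k * (1 / 4 ^ k) = (1 / 2 :: real) ^ k"
      using power_mult_distrib[of 2 "2 :: real" k] by (simp add: power_divide)
    also have "ennreal (((1 / 2) ^ k) powr p) \<le> ennreal (((1 / 2) ^ k) powr 1)"
      using p by (intro ennreal_leI powr_mono') (auto simp: power_le_one)
    finally show "(\<integral>\<^sup>+x. ennpowr (ennreal (2 ^ k) * ennreal (d k x)) p \<partial>M) \<le> ennreal ((1 / 2) ^ k)"
      by simp
  qed auto
  finally have "Lp_integral p M s \<le> ennreal (2 powr p) * ennreal 2"
    by (simp only: geo)
  also have "\<dots> < \<infinity>" by (simp add: ennreal_mult_less_top)
  finally have s_fin: "Lp_integral p M s < \<infinity>" .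
  have bound: "ennreal \<bar>f k x\<bar> \<le> ennreal \<bar>f 0 x\<bar> + s x" for k x
  proof -
    have "\<bar>f k x\<bar> \<le> \<bar>f 0 x\<bar> + (\<Sum>i<k. d i x)"
      by (induction k) (auto simp: d_def)
    then have "ennreal \<bar>f k x\<bar> \<le> ennreal \<bar>f 0 x\<bar> + (\<Sum>i<k. ennreal (d i x))"
      by (simp add: ennreal_plus[symmetric] sum_ennreal d_def sum_nonneg ennreal_leI del: ennreal_plus)
    also have "(\<Sum>i<k. ennreal (d i x)) \<le> s x"
      unfolding s_def by (rule sum_le_suminf) auto
    finally show ?thesis by (simp add: add_left_mono)
  qed
  have "AE x in M. ennpowr (s x) p \<noteq> \<infinity>"
    using s_fin s_meas by (intro nn_integral_PInf_AE) auto
  then have conv: "AE x in M. convergent (\<lambda>k. f k x)"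
  proof eventually_elim
    case (elim x)
    then have "s x \<noteq> top" by auto
    then have "summable (\<lambda>k. d k x)"
      unfolding s_def by (rule summable_suminf_not_top[rotated]) (simp add: d_def)
    then have "summable (\<lambda>k. \<bar>f (Suc k) x - f k x\<bar>)"
      by (simp add: d_def abs_minus_commute)
    then have "summable (\<lambda>k. f (Suc k) x - f k x)"
      by (rule summable_rabs_cancel)
    then have "convergent (\<lambda>n. \<Sum>k<n. f (Suc k) x - f k x)"
      by (simp add: summable_iff_convergent)
    then have "convergent (\<lambda>n. f 0 x + (\<Sum>k<n. f (Suc k) x - f k x))"
      by (intro convergent_add convergent_const)
    then show ?case by (simp add: sum_lessThan_telescope[of "\<lambda>k. f k x"])
  qed
  show thesis by (rule that[OF s_meas s_fin bound conv])
qed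

section \<open>Admissible functions and existence of minimizers\<close>

context metric_measure_domain
begin

definition admissible :: "'a set \<Rightarrow> 'a set \<Rightarrow> ('a \<Rightarrow> real) set" where
  "admissible A\<^sub>0 A\<^sub>1 = {f. (\<lambda>x. ereal (f x)) \<in> newtonian_space p N \<and>
     (\<forall>x\<in>space N. 0 \<le> f x \<and> f x \<le> 1) \<and> (\<forall>x\<in>A\<^sub>0. f x = 0) \<and> (\<forall>x\<in>A\<^sub>1. f x = 1)}"

abbreviation min_energy :: "'a set \<Rightarrow> 'a set \<Rightarrow> ennreal" where
  "min_energy A\<^sub>0 A\<^sub>1 \<equiv> (INF f\<in>admissible A\<^sub>0 A\<^sub>1. E f)"

lemma admissibleI:
  assumes "f \<in> borel_measurable N" "\<And>x. x \<in> space N \<Longrightarrow> 0 \<le> f x \<and> f x \<le> 1"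
    "\<And>x. x \<in> A\<^sub>0 \<Longrightarrow> f x = 0" "\<And>x. x \<in> A\<^sub>1 \<Longrightarrow> f x = 1" "wug f g" "Lp_integral p N g < \<infinity>"
  shows "f \<in> admissible A\<^sub>0 A\<^sub>1"
proof -
  have "(\<lambda>x. ereal (f x)) \<in> newtonian_space p N"
    using assms(1,2,5,6) by (intro newtonian_spaceI[where g=g]) auto
  then show ?thesis using assms(2-4) by (simp add: admissible_def)
qed

text \<open>The convexity results concern real functions. The minimal gradient is finite almost
  everywhere, so \<open>enn2real\<close> changes it on a null set only.\<close>

lemma admissible_gradientE:
  assumes "f \<in> admissible A\<^sub>0 A\<^sub>1"
  obtains g where "f \<in> borel_measurable N" "g \<in> borel_measurable N" "\<And>x. 0 \<le> g x"
    "wug f (\<lambda>x. ennreal (g x))" "Lp_power p N g = E f" "E f < \<infinity>"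
proof -
  have "(\<lambda>x. ereal (f x)) \<in> newtonian_space p N" using assms by (simp add: admissible_def)
  then show thesis
  proof (rule newtonian_spaceE)
    fix g assume f: "f \<in> borel_measurable N" and g: "wug f g" "Lp_integral p N g < \<infinity>"
      "Lp_integral p N g = E f"
    define h where "h x = enn2real (g x)" for x
    have [measurable]: "g \<in> borel_measurable N" by (rule wug_measurable[OF g(1)])
    have h: "h \<in> borel_measurable N" unfolding h_def by measurable
    have h_nonneg: "0 \<le> h x" for x by (simp add: h_def)
    have "AE x in N. ennpowr (g x) p \<noteq> \<infinity>"
      using g(2) by (intro nn_integral_PInf_AE) auto
    then have gh: "AE x in N. g x = ennreal (h x)"
    proof eventually_elim
      case (elim x)
      then have "g x \<noteq> top" by auto
      then show ?case by (cases "g x") (simp_all add: h_def)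
    qed
    have "wug f (\<lambda>x. ennreal (h x))"
      using g(1) by (rule wug_mono_AE) (use h gh in \<open>auto elim: eventually_mono\<close>)
    moreover have "Lp_power p N h = E f"
      unfolding g(3)[symmetric]
      by (intro nn_integral_cong_AE) (use gh in eventually_elim, simp add: ennpowr_ennreal h_nonneg)
    ultimately show thesis
      using f h g(2,3) by (intro that[of h]) (simp_all add: h_def)
  qed
qed

lemma wug_midpoint:
  assumes "wug f (\<lambda>x. ennreal (g x))" "wug f' (\<lambda>x. ennreal (g' x))" "\<And>x. 0 \<le> g x" "\<And>x. 0 \<le> g' x"
  shows "wug (\<lambda>x. (f x + f' x) / 2) (\<lambda>x. ennreal ((g x + g' x) / 2))"
proof -
  have "wug (\<lambda>x. (f x + f' x) / 2) (\<lambda>x. ennreal (1 / 2) * (ennreal (g x) + ennreal (g' x)))"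
    using assms(1,2)
  proof (rule wug_linear_gradient)
    show "\<bar>(f x + f' x) / 2 - (f y + f' y) / 2\<bar> \<le> 1 / 2 * (\<bar>f x - f y\<bar> + \<bar>f' x - f' y\<bar>)" for x y
      by (simp add: abs_if field_simps)
  qed simp
  moreover have "(\<lambda>x. ennreal (1 / 2) * (ennreal (g x) + ennreal (g' x))) = (\<lambda>x. ennreal ((g x + g' x) / 2))"
  proof
    fix x
    have "ennreal (g x) + ennreal (g' x) = ennreal (g x + g' x)"
      using assms(3,4) by simp
    moreover have "ennreal (1 / 2) * ennreal (g x + g' x) = ennreal (1 / 2 * (g x + g' x))"
      using assms(3,4) by (intro ennreal_mult''[symmetric]) simp
    ultimately show "ennreal (1 / 2) * (ennreal (g x) + ennreal (g' x)) = ennreal ((g x + g' x) / 2)"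
      by (simp only: mult_1 times_divide_eq_left)
  qed
  ultimately show ?thesis by simp
qed

text \<open>Two bounds for two purposes: that by the mean of the gradients yields the lower bound in
  the Cauchy criterion, that by \<open>e\<close> keeps midpoints among the near-minimizers. The
  latter follows from the former by convexity of the power.\<close>

lemma admissible_midpoint:
  assumes f: "f \<in> admissible A\<^sub>0 A\<^sub>1" "f' \<in> admissible A\<^sub>0 A\<^sub>1"
    and g: "wug f (\<lambda>x. ennreal (g x))" "\<And>x. 0 \<le> g x" "Lp_power p N g = E f"
      "g \<in> borel_measurable N"
    and g': "wug f' (\<lambda>x. ennreal (g' x))" "\<And>x. 0 \<le> g' x" "Lp_power p N g' = E f'"
      "g' \<in> borel_measurable N"
    and e: "E f \<le> ennreal e" "E f' \<le> ennreal e"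
  shows "(\<lambda>x. (f x + f' x) / 2) \<in> admissible A\<^sub>0 A\<^sub>1"
    "E (\<lambda>x. (f x + f' x) / 2) \<le> Lp_mid p N g g'"
    "E (\<lambda>x. (f x + f' x) / 2) \<le> ennreal e"
proof -
  have meas [measurable]: "f \<in> borel_measurable N" "f' \<in> borel_measurable N"
    using f by (auto elim: admissible_gradientE)
  note [measurable] = g(4) g'(4)
  let ?I = "\<integral>\<^sup>+x. ennreal (((g x + g' x) / 2) powr p) \<partial>N"
  have "?I \<le> (\<integral>\<^sup>+x. ennreal (1 / 2) * (ennreal (g x powr p) + ennreal (g' x powr p)) \<partial>N)"
  proof (rule nn_integral_mono)
    fix x
    have "ennreal (((g x + g' x) / 2) powr p) \<le> ennreal ((1 / 2) * (g x powr p + g' x powr p))"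
      using powr_midpoint_le[OF p g(2) g'(2), of x x] by (intro ennreal_leI) simp
    also have "\<dots> = ennreal (1 / 2) * (ennreal (g x powr p) + ennreal (g' x powr p))"
      by (subst ennreal_mult'') simp_all
    finally show "ennreal (((g x + g' x) / 2) powr p) \<le> ennreal (1 / 2) * (ennreal (g x powr p) + ennreal (g' x powr p))" .
  qed
  also have "\<dots> = ennreal (1 / 2) * (E f + E f')"
    by (simp add: nn_integral_cmult nn_integral_add g(3) g'(3))
  also have "\<dots> \<le> ennreal (1 / 2) * (ennreal e + ennreal e)"
    using e by (intro mult_left_mono add_mono) auto
  also have "\<dots> = ennreal e"
  proof (cases "0 \<le> e")
    case True
    have "ennreal e + ennreal e = ennreal (e + e)"
      using True by (intro ennreal_plus[symmetric])
    then have "ennreal (1 / 2) * (ennreal e + ennreal e) = ennreal (1 / 2) * ennreal (e + e)"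
      by (simp only:)
    also have "\<dots> = ennreal (1 / 2 * (e + e))"
      using True by (intro ennreal_mult''[symmetric]) simp
    finally show ?thesis by simp
  qed (simp add: ennreal_neg)
  finally have I: "?I \<le> ennreal e" .
  have w: "wug (\<lambda>x. (f x + f' x) / 2) (\<lambda>x. ennreal ((g x + g' x) / 2))"
    by (rule wug_midpoint[OF g(1) g'(1) g(2) g'(2)])
  have eq: "(\<integral>\<^sup>+x. ennpowr (ennreal ((g x + g' x) / 2)) p \<partial>N) = ?I"
    using g(2) g'(2) by (simp add: ennpowr_ennreal)
  have fin: "(\<integral>\<^sup>+x. ennpowr (ennreal ((g x + g' x) / 2)) p \<partial>N) < \<infinity>"
    unfolding eq using I by (rule le_less_trans) simp
  show "(\<lambda>x. (f x + f' x) / 2) \<in> admissible A\<^sub>0 A\<^sub>1"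
  proof (rule admissibleI[OF _ _ _ _ w fin])
    fix x assume "x \<in> space N"
    then have "0 \<le> f x" "f x \<le> 1" "0 \<le> f' x" "f' x \<le> 1" using f by (simp_all add: admissible_def)
    then show "0 \<le> (f x + f' x) / 2 \<and> (f x + f' x) / 2 \<le> 1" by simp
  qed (use f in \<open>simp_all add: admissible_def\<close>)
  show "E (\<lambda>x. (f x + f' x) / 2) \<le> ?I"
    using energy_le[OF w fin] by (simp only: eq)
  then show "E (\<lambda>x. (f x + f' x) / 2) \<le> ennreal e"
    using I by (rule order_trans)
qed

text \<open>Tail suprema of the gradients mediate between the sequence and its limit. Each is a
  gradient of a whole tail and hence of \<open>u\<close>; as the tails shrink they decrease to the
  limit of the \<open>g k\<close> almost everywhere.\<close>

lemma admissible_lim: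
  assumes f: "\<And>k::nat. f k \<in> admissible A\<^sub>0 A\<^sub>1"
    and g: "\<And>k. g k \<in> borel_measurable N" "\<And>k x. 0 \<le> g k x" "\<And>k. wug (f k) (\<lambda>x. ennreal (g k x))"
      "Lp_power p N (g 0) < \<infinity>"
    and f_rapid: "\<And>k. Lp_dist p N (f k) (f (Suc k)) \<le> ennreal ((1 / 4 ^ k) powr p)"
    and g_rapid: "\<And>k. Lp_dist p N (g k) (g (Suc k)) \<le> ennreal ((1 / 4 ^ k) powr p)"
  shows "\<exists>u\<in>admissible A\<^sub>0 A\<^sub>1. E u \<le> liminf (\<lambda>k. \<integral>\<^sup>+x. ennreal (g k x powr p) \<partial>N)"
proof -
  have f_meas [measurable]: "f k \<in> borel_measurable N" for k
    using f[of k] by (auto elim: admissible_gradientE)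
  note [measurable] = g(1)
  obtain s where s: "s \<in> borel_measurable N" "Lp_integral p N s < \<infinity>"
    "\<And>k x. ennreal \<bar>g k x\<bar> \<le> ennreal \<bar>g 0 x\<bar> + s x" and g_conv: "AE x in N. convergent (\<lambda>k. g k x)"
    using Lp_rapid_convergence[of p g N, OF p g(1) g_rapid] by blast
  have f_conv: "AE x in N. convergent (\<lambda>k. f k x)"
    using Lp_rapid_convergence[of p f N, OF p f_meas f_rapid] by blast
  \<comment> \<open>\<open>h m\<close> is a gradient of every \<open>f k\<close> with
    \<open>m <= k\<close>, and all \<open>h m\<close> are dominated by the p-integrable
    \<open>g 0 + s\<close>.\<close>
  define h where "h m x = (SUP k. ennreal (g (m + k) x))" for m x
  have h_meas [measurable]: "h m \<in> borel_measurable N" for m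
    unfolding h_def by measurable
  have h_dec: "h (Suc m) x \<le> h m x" for m x
    unfolding h_def by (rule SUP_least) (rule SUP_upper2[of "Suc k" for k], auto)
  have "Lp_integral p N (h 0) \<le> (\<integral>\<^sup>+x. ennpowr (ennreal (g 0 x) + s x) p \<partial>N)"
  proof (intro nn_integral_mono ennpowr_mono)
    show "h 0 x \<le> ennreal (g 0 x) + s x" for x
      unfolding h_def using s(3)[of _ x] g(2) by (intro SUP_least) simp
  qed (use p in simp)
  also have "\<dots> < \<infinity>"
    using g(2,4) s(1,2) p by (intro nn_integral_ennpowr_add_finite) (simp_all add: ennpowr_ennreal)
  finally have h0: "Lp_integral p N (h 0) < \<infinity>" .
  have h_fin: "Lp_integral p N (h m) < \<infinity>" for m
  proof -
    have "h m x \<le> h 0 x" for x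
      by (rule lift_Suc_antimono_le[of "\<lambda>m. h m x"]) (simp_all add: h_dec)
    then have "Lp_integral p N (h m) \<le> Lp_integral p N (h 0)"
      using p by (intro nn_integral_mono ennpowr_mono) auto
    then show ?thesis using h0 by (rule le_less_trans)
  qed
  have wug_h: "wug (f k) (h m)" if "m \<le> k" for k m
    using g(3)[of k] h_meas
  proof (rule wug_mono_AE)
    have "ennreal (g k x) \<le> h m x" for x
      unfolding h_def using that by (intro SUP_upper2[of "k - m"]) auto
    then show "AE x in N. ennreal (g k x) \<le> h m x" by simp
  qed
  \<comment> \<open>The default 0 respects \<open>0 <= u <= 1\<close>. It never touches the boundary
    values, since on \<open>A\<^sub>0\<close> and on \<open>A\<^sub>1\<close> the sequence is
    constant and converges.\<close>
  define u where "u x = (if convergent (\<lambda>k. f k x) then lim (\<lambda>k. f k x) else 0)" for x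
  have u_lim: "u x = L" if "(\<lambda>k. f k x) \<longlonglongrightarrow> L" for x L
    using that by (auto simp: u_def convergent_def limI)
  have "{x \<in> space N. convergent (\<lambda>k. f k x)} \<in> sets N"
    unfolding Cauchy_convergent_iff[symmetric] by (rule sets_Collect_Cauchy) (rule f_meas)
  then have u_meas: "u \<in> borel_measurable N"
    unfolding u_def by (intro measurable_If borel_measurable_lim_metric f_meas) auto
  have wug_u: "wug u (h m)" for m
    by (rule wug_lim[where f=f and g="h 0" and k=m])
       (use wug_h f_conv u_lim Lp_locI[OF h_meas h0] in auto)
  have u_bounds: "0 \<le> u x \<and> u x \<le> 1" if x: "x \<in> space N" for x
  proof (cases "convergent (\<lambda>k. f k x)")
    case True
    then obtain L where L: "(\<lambda>k. f k x) \<longlonglongrightarrow> L" by (auto simp: convergent_def)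
    have "0 \<le> f k x \<and> f k x \<le> 1" for k using f[of k] x by (simp add: admissible_def)
    then have "0 \<le> L" "L \<le> 1"
      using LIMSEQ_le_const[OF L, of 0] LIMSEQ_le_const2[OF L, of 1] by blast+
    then show ?thesis using u_lim[OF L] by simp
  qed (simp add: u_def)
  have const: "u x = a" if "\<And>k. f k x = a" for x a
    by (rule u_lim) (simp add: that)
  have u: "u \<in> admissible A\<^sub>0 A\<^sub>1"
    using f by (intro admissibleI[OF u_meas u_bounds _ _ wug_u[of 0] h0] const) (simp_all add: admissible_def)
  \<comment> \<open>Monotone convergence, with \<open>h0\<close> finite, moves the infimum inside.
    Where \<open>g k x\<close> converges, the infimum is at most the limit of the powers, and
    Fatou's lemma takes the lower limit outside.\<close>
  have "E u \<le> (INF m. \<integral>\<^sup>+x. ennpowr (h m x) p \<partial>N)"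
    by (intro INF_greatest energy_le[OF wug_u h_fin])
  also have "\<dots> = (\<integral>\<^sup>+x. (INF m. ennpowr (h m x) p) \<partial>N)"
    using p h0 h_dec
    by (intro nn_integral_monotone_convergence_INF_decseq[symmetric, where i=0] decseq_SucI le_funI ennpowr_mono) auto
  also have "\<dots> \<le> (\<integral>\<^sup>+x. liminf (\<lambda>k. ennreal (g k x powr p)) \<partial>N)"
  proof (rule nn_integral_mono_AE)
    show "AE x in N. (INF m. ennpowr (h m x) p) \<le> liminf (\<lambda>k. ennreal (g k x powr p))"
      using g_conv
    proof eventually_elim
      case (elim x)
      then obtain L where L: "(\<lambda>k. g k x) \<longlonglongrightarrow> L" by (auto simp: convergent_def)
      have "0 \<le> L" using LIMSEQ_le_const[OF L, of 0] g(2) by blast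
      have lim: "(\<lambda>k. ennreal (g k x powr p)) \<longlonglongrightarrow> ennreal (L powr p)"
        using p g(2) \<open>0 \<le> L\<close>
        by (intro tendsto_ennrealI tendsto_powr'[OF L tendsto_const]) auto
      have "(INF m. ennpowr (h m x) p) \<le> limsup (\<lambda>k. ennreal (g k x powr p))"
        unfolding limsup_INF_SUP
      proof (rule INF_mono)
        fix n
        have "ennpowr (h n x) p \<le> (SUP k. ennpowr (ennreal (g (n + k) x)) p)"
          unfolding h_def using p by (intro ennpowr_SUP_le) simp
        also have "\<dots> \<le> (SUP k\<in>{n..}. ennreal (g k x powr p))"
          using g(2) by (intro SUP_least) (auto simp: ennpowr_ennreal intro!: SUP_upper)
        finally show "\<exists>m\<in>UNIV. ennpowr (h m x) p \<le> (SUP k\<in>{n..}. ennreal (g k x powr p))" by blast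
      qed
      also have "\<dots> = ennreal (L powr p)"
        by (rule lim_imp_Limsup[OF sequentially_bot lim])
      also have "\<dots> = liminf (\<lambda>k. ennreal (g k x powr p))"
        by (rule lim_imp_Liminf[OF sequentially_bot lim, symmetric])
      finally show ?case .
    qed
  qed
  also have "\<dots> \<le> liminf (\<lambda>k. \<integral>\<^sup>+x. ennreal (g k x powr p) \<partial>N)"
    by (rule nn_integral_liminf) measurable
  finally show ?thesis using u by blast
qed

lemma admissible_minimizer:
  assumes fin: "min_energy A\<^sub>0 A\<^sub>1 < \<infinity>"
  shows "\<exists>u\<in>admissible A\<^sub>0 A\<^sub>1. E u \<le> min_energy A\<^sub>0 A\<^sub>1"
proof -
  obtain c where c: "min_energy A\<^sub>0 A\<^sub>1 = ennreal c" "0 \<le> c"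
    using fin by (cases "min_energy A\<^sub>0 A\<^sub>1") auto
  have E_ge: "ennreal c \<le> E f" if "f \<in> admissible A\<^sub>0 A\<^sub>1" for f
    unfolding c(1)[symmetric] using that by (rule INF_lower)
  define \<epsilon> where "\<epsilon> n = inverse (real (Suc n))" for n
  have \<epsilon>: "0 < \<epsilon> n" for n by (simp add: \<epsilon>_def)
  have \<epsilon>_mono: "\<epsilon> m \<le> \<epsilon> n" if "n \<le> m" for n m using that by (simp add: \<epsilon>_def)
  have \<epsilon>_small: "\<exists>K. \<epsilon> K < e" if "0 < e" for e
    using reals_Archimedean[OF that] by (simp add: \<epsilon>_def)
  define K where "K n = {f \<in> admissible A\<^sub>0 A\<^sub>1. E f \<le> ennreal (c + \<epsilon> n)}" for n
  define \<psi> where "\<psi> f = (\<integral>\<^sup>+x. ennreal (\<bar>f x\<bar> powr p) \<partial>N)" for f :: "'a \<Rightarrow> real"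
  have K_ne: "\<exists>f. f \<in> K n" for n
  proof -
    have "min_energy A\<^sub>0 A\<^sub>1 < ennreal (c + \<epsilon> n)"
      unfolding c(1) using \<epsilon>[of n] c(2) by (intro ennreal_lessI) auto
    then obtain f where "f \<in> admissible A\<^sub>0 A\<^sub>1" "E f < ennreal (c + \<epsilon> n)"
      unfolding INF_less_iff by blast
    then show ?thesis by (auto simp: K_def intro: less_imp_le)
  qed
  have K_mono: "K m \<subseteq> K n" if "n \<le> m" for n m
  proof
    fix f assume f: "f \<in> K m"
    have "E f \<le> ennreal (c + \<epsilon> m)" using f by (simp add: K_def)
    also have "\<dots> \<le> ennreal (c + \<epsilon> n)" using \<epsilon>_mono[OF that] by (intro ennreal_leI) simp
    finally show "f \<in> K n" using f by (simp add: K_def)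
  qed
  \<comment> \<open>\<open>K n\<close> shrinks, so these infima increase to a finite limit
    \<open>c'\<close>. The choice of \<open>v n\<close> keeps \<open>\<psi> (v n)\<close> below
    \<open>c' + \<epsilon> n\<close>, while midpoints of later terms stay in \<open>K n\<close> and
    so have \<psi> at least \<open>m n\<close>. These are the hypotheses of the Cauchy criterion for
    the functions.\<close>
  define m where "m n = (INF f\<in>K n. \<psi> f)" for n
  have m_le: "m n \<le> emeasure N (space N)" for n
  proof -
    obtain f where f: "f \<in> K n" using K_ne by blast
    have "\<psi> f \<le> (\<integral>\<^sup>+x. 1 \<partial>N)"
      unfolding \<psi>_def
    proof (rule nn_integral_mono)
      fix x assume "x \<in> space N"
      then have "0 \<le> f x" "f x \<le> 1" using f by (simp_all add: K_def admissible_def)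
      then show "ennreal (\<bar>f x\<bar> powr p) \<le> 1" using p by (simp add: powr_le1)
    qed
    moreover have "m n \<le> \<psi> f" unfolding m_def using f by (rule INF_lower)
    ultimately show ?thesis by simp
  qed
  have m_mono: "m n \<le> m n'" if "n \<le> n'" for n n'
    unfolding m_def using K_mono[OF that] by (rule INF_superset_mono) simp
  have "(SUP n. m n) \<le> emeasure N (space N)" using m_le by (rule SUP_least)
  then have "(SUP n. m n) < \<infinity>" using emeasure_finite by (rule le_less_trans)
  then obtain c' where c': "(SUP n. m n) = ennreal c'" "0 \<le> c'"
    by (cases "SUP n. m n") auto
  have "\<exists>f. f \<in> K n \<and> \<psi> f \<le> m n + ennreal (\<epsilon> n)" for n
  proof -
    have "m n < \<infinity>" using m_le emeasure_finite by (rule le_less_trans)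
    then have "m n < m n + ennreal (\<epsilon> n)"
      using \<epsilon>[of n] by (cases "m n") (auto simp: ennreal_plus[symmetric] ennreal_less_iff simp del: ennreal_plus)
    then obtain f where "f \<in> K n" "\<psi> f < m n + ennreal (\<epsilon> n)"
      unfolding m_def INF_less_iff by blast
    then show ?thesis by (auto intro: less_imp_le)
  qed
  then obtain v where v: "\<And>n. v n \<in> K n" "\<And>n. \<psi> (v n) \<le> m n + ennreal (\<epsilon> n)" by metis
  have v_adm: "v n \<in> admissible A\<^sub>0 A\<^sub>1" and E_v: "E (v n) \<le> ennreal (c + \<epsilon> n)" for n
    using v(1)[of n] by (simp_all add: K_def)
  have "\<exists>g. v n \<in> borel_measurable N \<and> g \<in> borel_measurable N \<and> (\<forall>x. 0 \<le> g x) \<and> wug (v n) (\<lambda>x. ennreal (g x)) \<and>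
      Lp_power p N g = E (v n)" for n
    using v_adm[of n] by (rule admissible_gradientE) blast
  then obtain g where v_meas [measurable]: "\<And>n. v n \<in> borel_measurable N"
    and g: "\<And>n. g n \<in> borel_measurable N" "\<And>n x. 0 \<le> g n x" "\<And>n. wug (v n) (\<lambda>x. ennreal (g n x))"
    "\<And>n. Lp_power p N (g n) = E (v n)" by metis
  have mid: "(\<lambda>x. (v i x + v j x) / 2) \<in> K n"
      "ennreal c \<le> Lp_mid p N (g i) (g j)"
    if "n \<le> i" "n \<le> j" for n i j
  proof -
    have "E (v i) \<le> ennreal (c + \<epsilon> n)" "E (v j) \<le> ennreal (c + \<epsilon> n)"
      using v(1)[of i] v(1)[of j] K_mono[OF that(1)] K_mono[OF that(2)] by (auto simp: K_def)
    note mid = admissible_midpoint[OF v_adm v_adm g(3,2,4,1) g(3,2,4,1) this]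
    from mid(1,3) show "(\<lambda>x. (v i x + v j x) / 2) \<in> K n" by (simp add: K_def)
    from E_ge[OF mid(1)] mid(2) show "ennreal c \<le> Lp_mid p N (g i) (g j)"
      by (rule order_trans)
  qed
  have g_Cauchy: "\<exists>K. \<forall>i\<ge>K. \<forall>j\<ge>i. Lp_dist p N (g i) (g j) \<le> ennreal e" if "0 < e" for e
  proof (rule Lp_Cauchy_of_midpoints[OF p c(2) g(1,2) _ _ that])
    show "\<exists>K. \<forall>n\<ge>K. Lp_power p N (g n) \<le> ennreal (c + e)" if "0 < e" for e
    proof -
      obtain k where k: "\<epsilon> k < e" using \<epsilon>_small[OF \<open>0 < e\<close>] ..
      have "Lp_power p N (g n) \<le> ennreal (c + e)" if "k \<le> n" for n
        unfolding g(4) using k \<epsilon>_mono[OF that] by (intro order_trans[OF E_v] ennreal_leI) simp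
      then show ?thesis by blast
    qed
    show "\<exists>K. \<forall>n\<ge>K. \<forall>m\<ge>n. ennreal (c - e) \<le> Lp_mid p N (g n) (g m)"
      if "0 < e" for e
    proof -
      have "ennreal (c - e) \<le> ennreal c" using that by (intro ennreal_leI) simp
      then show ?thesis using mid(2)[of 0] by (blast intro: order_trans)
    qed
  qed
  have v_nonneg: "0 \<le> v n x" if "x \<in> space N" for n x
    using v_adm[of n] that by (simp add: admissible_def)
  \<comment> \<open>The criterion asks for nonnegativity at all points of the type, but
    \<open>v n\<close> is nonnegative only on the space; hence the absolute values.\<close>
  have v_Cauchy: "\<exists>K. \<forall>i\<ge>K. \<forall>j\<ge>i. (\<integral>\<^sup>+x. ennreal (\<bar>\<bar>v i x\<bar> - \<bar>v j x\<bar>\<bar> powr p) \<partial>N) \<le> ennreal e" if "0 < e" for e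
  proof (rule Lp_Cauchy_of_midpoints[OF p c'(2) _ _ _ _ that])
    show "\<exists>K. \<forall>n\<ge>K. (\<integral>\<^sup>+x. ennreal (\<bar>v n x\<bar> powr p) \<partial>N) \<le> ennreal (c' + e)" if "0 < e" for e
    proof -
      obtain k where k: "\<epsilon> k < e" using \<epsilon>_small[OF \<open>0 < e\<close>] ..
      have "\<psi> (v n) \<le> ennreal (c' + e)" if "k \<le> n" for n
      proof -
        have "\<psi> (v n) \<le> ennreal c' + ennreal (\<epsilon> n)"
          unfolding c'(1)[symmetric] by (rule order_trans[OF v(2)]) (intro add_right_mono SUP_upper UNIV_I)
        also have "\<dots> = ennreal (c' + \<epsilon> n)"
          using c'(2) \<epsilon>[of n] by (intro ennreal_plus[symmetric]) auto
        also have "\<dots> \<le> ennreal (c' + e)"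
          using k \<epsilon>_mono[OF that] by (intro ennreal_leI) simp
        finally show ?thesis .
      qed
      then show ?thesis unfolding \<psi>_def by blast
    qed
    show "\<exists>K. \<forall>n\<ge>K. \<forall>j\<ge>n. ennreal (c' - e) \<le> (\<integral>\<^sup>+x. ennreal (((\<bar>v n x\<bar> + \<bar>v j x\<bar>) / 2) powr p) \<partial>N)"
      if "0 < e" for e
    proof -
      \<comment> \<open>For \<open>c' > 0\<close> the supremum of the \<open>m n\<close> lies
        strictly above \<open>c' - e\<close>; for \<open>c' = 0\<close> the difference is truncated
        to 0.\<close>
      have "\<exists>k. ennreal (c' - e) \<le> m k"
      proof (cases "0 < c'")
        case True
        have "ennreal (c' - e) < (SUP n. m n)"
          unfolding c'(1) using True \<open>0 < e\<close> by (intro ennreal_lessI) auto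
        then show ?thesis unfolding less_SUP_iff by (auto intro: less_imp_le)
      next
        case False
        then have "ennreal (c' - e) = 0" using \<open>0 < e\<close> by (intro ennreal_neg) simp
        then show ?thesis by simp
      qed
      then obtain k where k: "ennreal (c' - e) \<le> m k" ..
      have "ennreal (c' - e) \<le> (\<integral>\<^sup>+x. ennreal (((\<bar>v n x\<bar> + \<bar>v j x\<bar>) / 2) powr p) \<partial>N)" if "k \<le> n" "n \<le> j" for n j
      proof -
        have "ennreal (c' - e) \<le> m n" using k m_mono[OF that(1)] by (rule order_trans)
        also have "\<dots> \<le> \<psi> (\<lambda>x. (v n x + v j x) / 2)"
          unfolding m_def using that by (intro INF_lower mid(1)) auto
        also have "\<dots> = (\<integral>\<^sup>+x. ennreal (((\<bar>v n x\<bar> + \<bar>v j x\<bar>) / 2) powr p) \<partial>N)"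
          unfolding \<psi>_def using v_nonneg by (intro nn_integral_cong) simp
        finally show ?thesis .
      qed
      then show ?thesis by blast
    qed
  qed auto
  have "\<exists>K. \<forall>i\<ge>K. \<forall>j\<ge>i. Lp_dist p N (v i) (v j) \<le> ennreal ((1 / 4 ^ k) powr p) \<and>
      Lp_dist p N (g i) (g j) \<le> ennreal ((1 / 4 ^ k) powr p)" for k :: nat
  proof -
    have pos: "0 < (1 / 4 ^ k :: real) powr p" by simp
    obtain K1 where K1: "\<forall>i\<ge>K1. \<forall>j\<ge>i. (\<integral>\<^sup>+x. ennreal (\<bar>\<bar>v i x\<bar> - \<bar>v j x\<bar>\<bar> powr p) \<partial>N) \<le> ennreal ((1 / 4 ^ k) powr p)"
      using v_Cauchy[OF pos] ..
    obtain K2 where K2: "\<forall>i\<ge>K2. \<forall>j\<ge>i. Lp_dist p N (g i) (g j) \<le> ennreal ((1 / 4 ^ k) powr p)"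
      using g_Cauchy[OF pos] ..
    have "(\<integral>\<^sup>+x. ennreal (\<bar>\<bar>v i x\<bar> - \<bar>v j x\<bar>\<bar> powr p) \<partial>N) = Lp_dist p N (v i) (v j)" for i j
      using v_nonneg by (intro nn_integral_cong) simp
    with K1 K2 show ?thesis by (intro exI[of _ "max K1 K2"]) simp
  qed
  from common_rapid_subsequence[of "\<lambda>k i j. Lp_dist p N (v i) (v j) \<le> ennreal ((1 / 4 ^ k) powr p) \<and>
      Lp_dist p N (g i) (g j) \<le> ennreal ((1 / 4 ^ k) powr p)", OF this]
  obtain r :: "nat \<Rightarrow> nat" where r: "strict_mono r"
    "\<And>k. Lp_dist p N (v (r k)) (v (r (Suc k))) \<le> ennreal ((1 / 4 ^ k) powr p)"
    "\<And>k. Lp_dist p N (g (r k)) (g (r (Suc k))) \<le> ennreal ((1 / 4 ^ k) powr p)" by blast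
  have "Lp_power p N (g (r 0)) < \<infinity>"
    unfolding g(4) by (rule le_less_trans[OF E_v]) simp
  from admissible_lim[of "\<lambda>k. v (r k)", OF v_adm g(1,2,3) this r(2,3)]
  obtain u where u: "u \<in> admissible A\<^sub>0 A\<^sub>1" "E u \<le> liminf (\<lambda>k. E (v (r k)))"
    unfolding g(4) by blast
  have "liminf (\<lambda>k. E (v (r k))) \<le> liminf (\<lambda>k. ennreal (c + \<epsilon> k))"
  proof (intro Liminf_mono always_eventually allI)
    fix k
    have "\<epsilon> (r k) \<le> \<epsilon> k" using seq_suble[OF r(1)] by (rule \<epsilon>_mono)
    then show "E (v (r k)) \<le> ennreal (c + \<epsilon> k)"
      by (intro order_trans[OF E_v] ennreal_leI) simp
  qed
  also have "\<dots> = ennreal c"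
    unfolding \<epsilon>_def by (rule lim_imp_Liminf[OF sequentially_bot])
      (intro tendsto_ennrealI LIMSEQ_inverse_real_of_nat_add)
  finally show ?thesis using u unfolding c(1) by (blast intro: order_trans)
qed

end

section \<open>Uniqueness\<close>

context metric_measure_domain
begin

text \<open>A chord is no longer than its arc, so arc length parametrizations are 1-Lipschitz and
  \<open>f\<close> varies by at most \<open>L\<close> times the parameter.\<close>

lemma wug_lipschitz:
  assumes "0 \<le> L" "\<And>x y. x \<in> space N \<Longrightarrow> y \<in> space N \<Longrightarrow> \<bar>f x - f y\<bar> \<le> L * dist x y"
  shows "wug f (\<lambda>_. ennreal L)"
proof (rule wugI)
  show "ae_curves p N (\<lambda>c. gradient_along f (\<lambda>_. ennreal L) c)"
  proof (rule ae_curvesI[of "\<lambda>_. 0"])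
    fix c assume c: "c \<in> curves (space N)"
    obtain l \<gamma> where c_eq: "c = (l, \<gamma>)" by force
    show "gradient_along f (\<lambda>_. ennreal L) c"
      unfolding interval_gradient_def
    proof (intro allI impI)
      fix s t assume st: "0 \<le> s" "s \<le> t" "t \<le> fst c"
      have "ennreal (dist (\<gamma> s) (\<gamma> t)) \<le> ennreal (t - s)"
        using dist_le_curve_length[OF st(2), of \<gamma>] curves_curve_length[of l \<gamma> "space N" s t] c st
        by (simp add: c_eq)
      then have "dist (\<gamma> s) (\<gamma> t) \<le> t - s" using st by (simp add: ennreal_le_iff)
      then have "L * dist (\<gamma> s) (\<gamma> t) \<le> L * (t - s)" using assms(1) by (rule mult_left_mono)
      moreover have "\<bar>f (snd c s) - f (snd c t)\<bar> \<le> L * dist (snd c s) (snd c t)"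
        using st by (intro assms(2) curves_in[OF c]) auto
      ultimately have "ennreal \<bar>f (snd c s) - f (snd c t)\<bar> \<le> ennreal (L * (t - s))"
        by (intro ennreal_leI) (simp add: c_eq)
      also have "\<dots> = (\<integral>\<^sup>+r\<in>{s<..t}. ennreal L \<partial>lebesgue)"
        using assms(1) st by (simp add: nn_integral_cmult_indicator ennreal_mult)
      also have "\<dots> = (\<integral>\<^sup>+r\<in>{s<..t}. along (\<lambda>_. ennreal L) c r \<partial>lebesgue)"
        using st by (intro nn_integral_cong) (auto simp: along_def split: split_indicator)
      finally show "ennreal \<bar>f (snd c s) - f (snd c t)\<bar> \<le> (\<integral>\<^sup>+r\<in>{s<..t}. along (\<lambda>_. ennreal L) c r \<partial>lebesgue)" .
    qed
  qed auto
qed simp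

lemma admissible_nonempty:
  assumes "0 < d" "\<And>x y. x \<in> A\<^sub>0 \<Longrightarrow> y \<in> A\<^sub>1 \<Longrightarrow> d \<le> dist x y"
  shows "admissible A\<^sub>0 A\<^sub>1 \<noteq> {}"
proof -
  \<comment> \<open>\<open>infdist\<close> to the empty set is 0, so that case is set apart: the
    constant 1 then meets both boundary conditions.\<close>
  define f where "f x = (if A\<^sub>0 = {} then 1 else min 1 (infdist x A\<^sub>0 / d))" for x
  have lip: "\<bar>f x - f y\<bar> \<le> (1 / d) * dist x y" for x y
  proof (cases "A\<^sub>0 = {}")
    case False
    have "\<bar>f x - f y\<bar> \<le> \<bar>infdist x A\<^sub>0 / d - infdist y A\<^sub>0 / d\<bar>"
      using False by (auto simp: f_def min_def)
    also have "\<dots> = \<bar>infdist x A\<^sub>0 - infdist y A\<^sub>0\<bar> / d"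
      using \<open>0 < d\<close> by (simp flip: diff_divide_distrib)
    also have "\<dots> \<le> dist x y / d"
      using \<open>0 < d\<close> infdist_triangle_abs[of x A\<^sub>0 y] by (intro divide_right_mono) auto
    finally show ?thesis by simp
  qed (use \<open>0 < d\<close> in \<open>simp add: f_def\<close>)
  have "continuous_on UNIV f"
    unfolding f_def using \<open>0 < d\<close> by (cases "A\<^sub>0 = {}") (auto intro!: continuous_intros)
  then have "f \<in> borel_on (space N)"
    by (intro measurable_restrict_space1 borel_measurable_continuous_onI)
  then have f_meas: "f \<in> borel_measurable N" by (rule borel_measurableI)
  have "d \<le> infdist y A\<^sub>0" if "y \<in> A\<^sub>1" "A\<^sub>0 \<noteq> {}" for y
    unfolding infdist_notempty[OF that(2)] using assms(2) that by (intro cINF_greatest) (auto simp: dist_commute)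
  then have f1: "f y = 1" if "y \<in> A\<^sub>1" for y
    using that \<open>0 < d\<close> by (simp add: f_def min_def)
  have wug: "wug f (\<lambda>_. ennreal (1 / d))"
    using \<open>0 < d\<close> by (intro wug_lipschitz lip) simp
  have "(\<integral>\<^sup>+x. ennpowr (ennreal (1 / d)) p \<partial>N) < \<infinity>"
    using emeasure_finite \<open>0 < d\<close> by (simp add: ennpowr_ennreal ennreal_mult_less_top)
  then have "f \<in> admissible A\<^sub>0 A\<^sub>1"
    using f_meas f1 wug \<open>0 < d\<close>
    by (intro admissibleI[where g="\<lambda>_. ennreal (1 / d)"]) (auto simp: f_def infdist_nonneg)
  then show ?thesis by blast
qed

text \<open>If \<open>f \<le> a \<le> f'\<close> then \<open>max f (min f' a) = a\<close>, so this competitor needs no gradient there.\<close>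

lemma common_gradient_vanishes:
  assumes f: "f \<in> admissible A\<^sub>0 A\<^sub>1" "f' \<in> admissible A\<^sub>0 A\<^sub>1"
    and G: "G \<in> borel_measurable N" "\<And>x. 0 \<le> G x" "wug f (\<lambda>x. ennreal (G x))" "wug f' (\<lambda>x. ennreal (G x))"
    and minimal: "Lp_power p N G \<le> min_energy A\<^sub>0 A\<^sub>1"
      "Lp_power p N G < \<infinity>"
  shows "AE x in N. f x < f' x \<longrightarrow> G x = 0"
proof -
  note [measurable] = G(1)
  have f_meas [measurable]: "f \<in> borel_measurable N" "f' \<in> borel_measurable N"
    using f by (auto elim: admissible_gradientE)
  have G_Lp: "(\<lambda>x. ennreal (G x)) \<in> Lp_loc p N"
    using G(1,2) minimal(2) by (intro Lp_locI) (simp_all add: ennpowr_ennreal)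
  have level: "AE x in N. f x \<le> a \<and> a \<le> f' x \<longrightarrow> G x = 0" if a: "0 \<le> a" "a \<le> 1" for a
  proof -
    \<comment> \<open>The range \<open>0 <= a <= 1\<close> preserves the boundary values: where both
      functions are 0, or both are 1, so is \<open>w\<close>.\<close>
    define w where "w x = max (f x) (min (f' x) a)" for x
    define k where "k x = (if w x = a then 0 else ennreal (G x))" for x
    have w_meas [measurable]: "w \<in> borel_measurable N" unfolding w_def by measurable
    have "wug w (\<lambda>x. ennreal (G x))"
      using G(3,4) by (rule wug_max_gradient) (auto simp: w_def max_def min_def)
    then have k: "wug w k"
      unfolding k_def using G_Lp w_meas by (intro wug_level)
    have k_eq: "ennpowr (k x) p = (if w x = a then 0 else ennreal (G x powr p))" for x
      using G(2) by (simp add: k_def ennpowr_ennreal)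
    have "Lp_integral p N k \<le> Lp_power p N G"
      by (intro nn_integral_mono) (simp add: k_eq)
    then have k_fin: "Lp_integral p N k < \<infinity>"
      using minimal(2) by (rule le_less_trans)
    have "w \<in> admissible A\<^sub>0 A\<^sub>1"
      using f a by (intro admissibleI[OF w_meas _ _ _ k k_fin]) (auto simp: admissible_def w_def)
    \<comment> \<open>Minimality closes the chain: the p-integral of \<open>G\<close> is at most the
      energy of \<open>w\<close>, hence at most the p-integral of \<open>k\<close>, although
      \<open>k\<close> is pointwise at most \<open>G\<close>. So they agree almost
      everywhere.\<close>
    then have "min_energy A\<^sub>0 A\<^sub>1 \<le> E w" by (rule INF_lower)
    also have "\<dots> \<le> Lp_integral p N k" by (rule energy_le[OF k k_fin])
    finally have "Lp_power p N G \<le> Lp_integral p N k"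
      by (rule order_trans[OF minimal(1)])
    then have "AE x in N. ennpowr (k x) p = ennreal (G x powr p)"
      using minimal(2) wug_measurable[OF k]
      by (intro nn_integral_eq_imp_AE_eq) (simp_all add: k_eq)
    then show ?thesis
    proof eventually_elim
      case (elim x)
      show ?case
      proof
        assume "f x \<le> a \<and> a \<le> f' x"
        then have "w x = a" by (simp add: w_def)
        with elim show "G x = 0" using G(2)[of x] by (simp add: k_eq ennreal_eq_0_iff)
      qed
    qed
  qed
  \<comment> \<open>Countably many levels suffice, since a rational number separates
    \<open>f x\<close> from \<open>f' x\<close> wherever they differ.\<close>
  have "AE x in N. \<forall>q\<in>\<rat> \<inter> {0..1}. f x \<le> q \<and> q \<le> f' x \<longrightarrow> G x = 0"
    using countable_rat level by (subst AE_ball_countable) auto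
  with AE_space show ?thesis
  proof eventually_elim
    case (elim x)
    show ?case
    proof
      assume "f x < f' x"
      then obtain q where q: "q \<in> \<rat>" "f x < q" "q < f' x" using Rats_dense_in_real by blast
      have "0 \<le> f x" "f' x \<le> 1" using f elim(1) by (simp_all add: admissible_def)
      with q have "q \<in> \<rat> \<inter> {0..1}" by simp
      from bspec[OF elim(2) this] q show "G x = 0" by (simp add: less_imp_le)
    qed
  qed
qed

lemma minimizers_difference_zero_gradient:
  assumes f: "f \<in> admissible A\<^sub>0 A\<^sub>1" "f' \<in> admissible A\<^sub>0 A\<^sub>1"
    and minimal: "E f = min_energy A\<^sub>0 A\<^sub>1" "E f' = min_energy A\<^sub>0 A\<^sub>1"
  shows "wug (\<lambda>x. f x - f' x) (\<lambda>_. 0)"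
proof -
  obtain g where g: "f \<in> borel_measurable N" "g \<in> borel_measurable N" "\<And>x. 0 \<le> g x"
    "wug f (\<lambda>x. ennreal (g x))" "Lp_power p N g = E f" "E f < \<infinity>"
    using f(1) by (rule admissible_gradientE) (rule that)
  obtain g' where g': "f' \<in> borel_measurable N" "g' \<in> borel_measurable N" "\<And>x. 0 \<le> g' x"
    "wug f' (\<lambda>x. ennreal (g' x))" "Lp_power p N g' = E f'" "E f' < \<infinity>"
    using f(2) by (rule admissible_gradientE) (rule that)
  obtain c where c: "E f = ennreal c" "0 \<le> c" using g(6) by (cases "E f") auto
  have c': "E f' = ennreal c" using c(1) minimal by simp
  note mid = admissible_midpoint[OF f g(4,3,5,2) g'(4,3,5,2), of c]
  \<comment> \<open>The midpoint is a competitor, so its energy is no smaller than \<open>c\<close>.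
    This is the equality case of uniform convexity and identifies the two gradients almost
    everywhere.\<close>
  have "ennreal c \<le> E (\<lambda>x. (f x + f' x) / 2)"
    unfolding c(1)[symmetric] minimal(1) using mid(1) c(1) c' by (intro INF_lower) simp
  also have "\<dots> \<le> Lp_mid p N g g'"
    using mid(2) c(1) c' by simp
  finally have "AE x in N. g x = g' x"
    using g(5) g'(5) c(1) c'
    by (intro Lp_midpoint_eq_imp_AE_eq[OF p c(2) g(2) g'(2) g(3) g'(3)]) simp_all
  then have AE_eq: "AE x in N. g' x = g x" by eventually_elim simp
  have g_meas: "(\<lambda>x. ennreal (g x)) \<in> borel_measurable N" using g(2) by measurable
  have wug': "wug f' (\<lambda>x. ennreal (g x))"
    using g'(4) g_meas by (rule wug_mono_AE) (use AE_eq in eventually_elim, simp)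
  have "AE x in N. f x < f' x \<longrightarrow> g x = 0"
    using common_gradient_vanishes[OF f g(2,3,4) wug'] g(5,6) minimal by simp
  moreover have "AE x in N. f' x < f x \<longrightarrow> g x = 0"
    using common_gradient_vanishes[OF f(2,1) g(2,3) wug' g(4)] g(5,6) minimal by simp
  ultimately have vanish: "AE x in N. f x - f' x \<noteq> 0 \<longrightarrow> g x = 0"
    by eventually_elim (auto simp: neq_iff)
  have sum: "wug (\<lambda>x. f x - f' x) (\<lambda>x. ennreal 1 * (ennreal (g x) + ennreal (g x)))"
    using g(4) wug' by (rule wug_linear_gradient) (simp_all add: abs_if)
  have fin: "(\<integral>\<^sup>+x. ennpowr (ennreal (g x)) p \<partial>N) < \<infinity>"
    using g(3,5,6) by (simp add: ennpowr_ennreal)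
  have "(\<integral>\<^sup>+x. ennpowr (ennreal (g x) + ennreal (g x)) p \<partial>N) < \<infinity>"
    using p by (intro nn_integral_ennpowr_add_finite g_meas fin) simp
  then have "(\<lambda>x. ennreal 1 * (ennreal (g x) + ennreal (g x))) \<in> Lp_loc p N"
    by (intro Lp_locI wug_measurable[OF sum]) simp
  \<comment> \<open>Where the two functions agree, their difference sits on its level 0 and the
    gradient may be dropped; elsewhere it already vanishes almost everywhere.\<close>
  then have "wug (\<lambda>x. f x - f' x) (\<lambda>x. if f x - f' x = 0 then 0 else ennreal 1 * (ennreal (g x) + ennreal (g x)))"
    using sum g(1) g'(1) by (intro wug_level borel_measurable_diff)
  then show ?thesis
    by (rule wug_mono_AE) (simp, use vanish in eventually_elim, auto)
qed

lemma newtonian_space_cong: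
  assumes eq: "\<And>x. x \<in> space N \<Longrightarrow> u x = v x" and u: "u \<in> newtonian_space p N"
  shows "v \<in> newtonian_space p N"
proof -
  have "u \<in> borel_measurable N" using u by (simp add: newtonian_space_def)
  then have "v \<in> borel_measurable N" using eq by (subst (asm) measurable_cong) auto
  moreover have "endpoint_diff u c = endpoint_diff v c" if "c \<in> curves (space N)" for c
    using eq that by (rule endpoint_diff_cong)
  then have "upper_gradient N u g \<longleftrightarrow> upper_gradient N v g" for g
    by (simp add: upper_gradient_def)
  moreover have "newtonian_norm p N u = newtonian_norm p N v"
    using energy_cong[OF eq] eq by (simp add: newtonian_norm_def cong: nn_integral_cong)
  ultimately show ?thesis using u by (simp add: newtonian_space_def)
qed

end

section \<open>Open subsets of a metric measure space\<close>

lemma metric_measure_space_basics: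
  assumes "metric_measure_space M"
  shows "space M = UNIV" "sets borel \<subseteq> sets M"
    "\<And>x r. 0 < r \<Longrightarrow> 0 < emeasure M (ball x r)" "\<And>x r. 0 < r \<Longrightarrow> emeasure M (ball x r) < \<infinity>"
    "\<exists>B. sets B = sets borel \<and> M = completion B"
proof -
  obtain B where B: "sets B = sets borel" "M = completion B"
    using assms by (auto simp: metric_measure_space_def)
  show "space M = UNIV" using sets_eq_imp_space_eq[OF B(1)] by (simp add: B(2))
  show "sets borel \<subseteq> sets M" using B by auto
  show "\<exists>B. sets B = sets borel \<and> M = completion B" using B by blast
qed (use assms in \<open>auto simp: metric_measure_space_def\<close>)

text \<open>Boundedness puts \<Omega> into a ball, which gives finite measure. Openness puts a full
  ball into every relative ball, which gives positive measure. The Borel majorant comes from the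
  completion.\<close>

lemma metric_measure_domain_restrict_space:
  fixes M :: "'a::metric_space measure"
  assumes M: "metric_measure_space M" and p: "1 < p" and \<Omega>: "bounded \<Omega>" "open \<Omega>"
  shows "metric_measure_domain (restrict_space M \<Omega>) p"
proof
  note basics = metric_measure_space_basics[OF M]
  have \<Omega>_sets: "\<Omega> \<inter> space M \<in> sets M" using \<Omega>(2) basics(1,2) by auto
  have space: "space (restrict_space M \<Omega>) = \<Omega>" by (simp add: space_restrict_space basics(1))
  have emeasure: "emeasure (restrict_space M \<Omega>) A = emeasure M A" if "A \<subseteq> \<Omega>" for A
    using \<Omega>_sets that by (rule emeasure_restrict_space)
  show "1 < p" by (rule p)
  obtain r x where r: "0 < r" "\<Omega> \<subseteq> ball (x::'a) r"
    using bounded_subset_ballD[OF \<Omega>(1)] by blast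
  have "ball x r \<in> sets M" using basics(2) by auto
  then have "emeasure M \<Omega> \<le> emeasure M (ball x r)" using r(2) by (intro emeasure_mono)
  then show "emeasure (restrict_space M \<Omega>) (space (restrict_space M \<Omega>)) < \<infinity>"
    unfolding space emeasure[OF order_refl] using basics(4)[OF r(1)] by (rule le_less_trans)
  show "sets (restrict_space borel (space (restrict_space M \<Omega>))) \<subseteq> sets (restrict_space M \<Omega>)"
    unfolding space sets_restrict_space using basics(2) by (rule image_mono)
  show "0 < emeasure (restrict_space M \<Omega>) (ball y r \<inter> space (restrict_space M \<Omega>))"
    if "y \<in> space (restrict_space M \<Omega>)" "0 < r" for y r
  proof -
    have "open (ball y r \<inter> \<Omega>)" "y \<in> ball y r \<inter> \<Omega>" using \<Omega>(2) that space by auto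
    then obtain s where s: "0 < s" "ball y s \<subseteq> ball y r \<inter> \<Omega>" by (meson openE)
    have "0 < emeasure M (ball y s)" using s(1) by (rule basics(3))
    also have "\<dots> \<le> emeasure M (ball y r \<inter> \<Omega>)"
      using s(2) basics(2) \<Omega>(2) by (intro emeasure_mono) auto
    finally show ?thesis unfolding space by (simp add: emeasure)
  qed
  fix g :: "'a \<Rightarrow> ennreal" assume g: "g \<in> borel_measurable (restrict_space M \<Omega>)"
  obtain B where B: "sets B = sets borel" "M = completion B" using basics(5) by blast
  have "(\<lambda>x. g x * indicator \<Omega> x) \<in> borel_measurable (completion B)"
    using g \<Omega>_sets unfolding B(2) by (simp add: borel_measurable_restrict_space_iff_ennreal)
  then obtain g' where g': "g' \<in> borel_measurable B" "AE x in B. g x * indicator \<Omega> x = g' x"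
    by (blast dest: completion_ex_borel_measurable)
  obtain Z where Z: "{x \<in> space B. \<not> g x * indicator \<Omega> x = g' x} \<subseteq> Z" "Z \<in> sets B" "emeasure B Z = 0"
    using g'(2) by (rule AE_E)
  have space_B: "space B = UNIV" using sets_eq_imp_space_eq[OF B(1)] by simp
  \<comment> \<open>The Borel null set \<open>Z\<close> contains all points where the Borel version
    \<open>g'\<close> differs from \<open>g\<close> on \<Omega>; the value \<open>top\<close> there
    makes \<open>h\<close> a majorant everywhere.\<close>
  define h where "h x = (if x \<in> Z then top else g' x)" for x
  have "h \<in> borel_measurable B"
    unfolding h_def using g'(1) Z(2) by (intro measurable_If_set) (auto simp: space_B)
  then have "h \<in> borel_measurable borel" using B(1) by (simp cong: measurable_cong_sets)
  then have h: "h \<in> borel_on \<Omega>" by (rule measurable_restrict_space1)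
  have eq: "h x = g x" if "x \<in> \<Omega>" "x \<notin> Z" for x
  proof -
    have "g x * indicator \<Omega> x = g' x" using subsetD[OF Z(1), of x] that by (auto simp: space_B)
    then show ?thesis using that by (simp add: h_def)
  qed
  have "AE x in M. x \<notin> Z"
    unfolding B(2) using Z(2,3) by (intro AE_completion AE_not_in) auto
  then have "AE x in restrict_space M \<Omega>. g x = h x"
    unfolding AE_restrict_space_iff[OF \<Omega>_sets] by eventually_elim (use eq in auto)
  moreover have "g x \<le> h x" if "x \<in> \<Omega>" for x
    using eq[OF that] by (cases "x \<in> Z") (auto simp: h_def)
  ultimately show "\<exists>h\<in>borel_measurable (restrict_space borel (space (restrict_space M \<Omega>))).
      (\<forall>x\<in>space (restrict_space M \<Omega>). g x \<le> h x) \<and> (AE x in restrict_space M \<Omega>. g x = h x)"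
    unfolding space using h by blast
qed

text \<open>A curve in \<open>U\<close> is a curve in \<Omega>, and restricting \<rho> only lowers
  its p-integral, so the same \<rho> works. The zero gradient property regards balls as spaces on
  their own, which is where the restriction is needed.\<close>

lemma weak_upper_gradient_zero_restrict:
  assumes U: "U \<subseteq> \<Omega>" "U \<in> sets M" "\<Omega> \<in> sets M" "open U" "open \<Omega>" and M: "space M = UNIV" "0 < p"
    and u: "weak_upper_gradient p (restrict_space M \<Omega>) u (\<lambda>_. 0)"
  shows "weak_upper_gradient p (restrict_space M U) u (\<lambda>_. 0)"
proof -
  have spaces: "space (restrict_space M \<Omega>) = \<Omega>" "space (restrict_space M U) = U"
    by (simp_all add: space_restrict_space M(1))
  obtain \<rho> where \<rho>: "\<rho> \<in> borel_on \<Omega>"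
    "Lp_integral p (restrict_space M \<Omega>) \<rho> < \<infinity>"
    "\<And>c. c \<in> curves \<Omega> \<Longrightarrow> line_integral \<rho> c < \<infinity> \<Longrightarrow>
      line_integral_defined (\<lambda>_. 0) c \<and> endpoint_diff u c \<le> line_integral (\<lambda>_. 0) c"
    using u unfolding weak_upper_gradient_def ae_curves_def[symmetric]
    by (elim conjE ae_curvesE) (use spaces in auto)
  have "\<rho> \<in> borel_measurable (restrict_space (restrict_space borel \<Omega>) U)"
    using \<rho>(1) by (rule measurable_restrict_space1)
  moreover have "restrict_space (restrict_space borel \<Omega>) U = restrict_space borel U"
    using U by (simp add: restrict_restrict_space Int_absorb1)
  ultimately have "\<rho> \<in> borel_on U" by simp
  moreover have "Lp_integral p (restrict_space M U) \<rho> < \<infinity>"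
  proof -
    have "Lp_integral p (restrict_space M U) \<rho> = (\<integral>\<^sup>+x. ennpowr (\<rho> x) p * indicator U x \<partial>M)"
      using U(2) M(1) by (simp add: nn_integral_restrict_space)
    also have "\<dots> \<le> (\<integral>\<^sup>+x. ennpowr (\<rho> x) p * indicator \<Omega> x \<partial>M)"
      using U(1) by (intro nn_integral_mono) (auto split: split_indicator)
    also have "\<dots> = Lp_integral p (restrict_space M \<Omega>) \<rho>"
      using U(3) M(1) by (simp add: nn_integral_restrict_space)
    finally show ?thesis using \<rho>(2) by (rule le_less_trans)
  qed
  moreover have "curves U \<subseteq> curves \<Omega>" using U(1) by (auto simp: curves_def)
  ultimately show ?thesis
    unfolding weak_upper_gradient_def ae_curves_def[symmetric]
    using \<rho>(3) by (intro conjI ae_curvesI[of \<rho>]) (auto simp: spaces)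
qed

text \<open>A curve meeting \<open>Z \<subseteq> \<Omega>\<close> contains a subcurve in \<open>\<Omega>\<close> meeting \<open>Z\<close>. The function exhibiting the
  exceptional curves in \<open>\<Omega>\<close> is therefore an upper gradient of the characteristic function of \<open>Z\<close>.\<close>

lemma sobolev_capacity_eq_0:
  fixes M :: "'a::metric_space measure"
  assumes M: "metric_measure_space M" and p: "1 < p" and \<Omega>: "open \<Omega>" and Z: "Z \<subseteq> \<Omega>" "AE x in M. x \<notin> Z"
    and ae: "ae_curves p (restrict_space M \<Omega>) (\<lambda>c. \<forall>t\<in>{0..fst c}. snd c t \<notin> Z)"
  shows "sobolev_capacity p M Z = 0"
proof -
  note basics = metric_measure_space_basics[OF M]
  have \<Omega>_sets: "\<Omega> \<in> sets M" using \<Omega> basics(2) by auto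
  have space: "space (restrict_space M \<Omega>) = \<Omega>" by (simp add: space_restrict_space basics(1))
  obtain B where B: "sets B = sets borel" "M = completion B" using basics(5) by blast
  \<comment> \<open>Completeness makes the null set \<open>Z\<close> measurable.\<close>
  have "AE x in B. \<not> x \<in> Z" using Z(2) unfolding B(2) by (simp add: AE_completion_iff)
  from sets_completion_AE[OF this] have "{x \<in> space M. x \<in> Z} \<in> sets M"
    unfolding B(2)[symmetric] pred_def .
  then have Z_sets: "Z \<in> sets M" by (simp add: basics(1))
  obtain \<rho> where \<rho>: "\<rho> \<in> borel_on \<Omega>"
    "Lp_integral p (restrict_space M \<Omega>) \<rho> < \<infinity>"
    "\<And>c. c \<in> curves \<Omega> \<Longrightarrow> line_integral \<rho> c < \<infinity> \<Longrightarrow> \<forall>t\<in>{0..fst c}. snd c t \<notin> Z"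
    using ae by (rule ae_curvesE) (simp add: space)
  define \<rho>' where "\<rho>' x = \<rho> x * indicator \<Omega> x" for x
  have \<rho>'_borel: "\<rho>' \<in> borel_measurable borel"
    using \<rho>(1) \<Omega> unfolding \<rho>'_def by (simp add: borel_measurable_restrict_space_iff_ennreal)
  have \<rho>'_borel': "\<rho>' \<in> borel_on (space M)"
    using \<rho>'_borel by (rule measurable_restrict_space1)
  have \<rho>'_M: "\<rho>' \<in> borel_measurable M"
    using \<rho>'_borel basics(1,2) by (auto simp: measurable_def)
  have "Lp_integral p M \<rho>' = (\<integral>\<^sup>+x. ennpowr (\<rho> x) p * indicator \<Omega> x \<partial>M)"
    by (intro nn_integral_cong) (auto simp: \<rho>'_def split: split_indicator)
  also have "\<dots> = Lp_integral p (restrict_space M \<Omega>) \<rho>"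
    using \<Omega>_sets by (simp add: nn_integral_restrict_space basics(1))
  finally have \<rho>'_fin: "Lp_integral p M \<rho>' < \<infinity>" using \<rho>(2) by simp
  have avoid: "snd c t \<notin> Z" if c: "c \<in> curves UNIV" "line_integral \<rho>' c < \<infinity>" and t: "t \<in> {0..fst c}" for c t
  proof
    assume "snd c t \<in> Z"
    have "0 < fst c" "continuous_on {0..fst c} (snd c)" using c(1) by (auto simp: curves_def)
    have "snd c t \<in> \<Omega>" using \<open>snd c t \<in> Z\<close> Z(1) by blast
    then obtain e where e: "0 < e" "ball (snd c t) e \<subseteq> \<Omega>" using \<Omega> by (meson openE)
    obtain d where d: "0 < d" "\<And>s. s \<in> {0..fst c} \<Longrightarrow> dist s t < d \<Longrightarrow> dist (snd c s) (snd c t) < e"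
      using \<open>continuous_on {0..fst c} (snd c)\<close> t e(1) unfolding continuous_on_iff by blast
    \<comment> \<open>Half the continuity radius on each side of \<open>t\<close>, cut off at the
      ends of the parameter interval; the piece stays nondegenerate when \<open>t\<close> is an
      endpoint.\<close>
    define a where "a = max 0 (t - d / 2)"
    define b where "b = min (fst c) (t + d / 2)"
    have ab: "0 \<le> a" "a < b" "b \<le> fst c" "a \<le> t" "t \<le> b"
      using t d(1) \<open>0 < fst c\<close> by (auto simp: a_def b_def)
    have "snd c s \<in> \<Omega>" if "s \<in> {a..b}" for s
    proof -
      have "\<bar>s - t\<bar> < d" using that d(1) by (auto simp: a_def b_def abs_less_iff)
      moreover have "s \<in> {0..fst c}" using that ab by auto
      ultimately have "dist (snd c s) (snd c t) < e" using d(2) by (simp add: dist_real_def)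
      then show ?thesis using e(2) by (auto simp: dist_commute)
    qed
    then have sub: "subcurve a b c \<in> curves \<Omega>"
      using c(1) ab by (intro subcurve_curves[where S=UNIV]) auto
    have "line_integral \<rho> (subcurve a b c) = line_integral \<rho>' (subcurve a b c)"
      unfolding line_integral_eq
    proof (rule nn_integral_cong)
      fix r
      show "along \<rho> (subcurve a b c) r = along \<rho>' (subcurve a b c) r"
        using curves_in[OF sub, of r] by (auto simp: along_def \<rho>'_def split: split_indicator)
    qed
    also have "\<dots> \<le> line_integral \<rho>' c"
      using \<rho>'_borel' c(1) ab by (intro subcurve_integral_le[of _ UNIV]) (auto simp: basics(1))
    finally have "\<forall>r\<in>{0..fst (subcurve a b c)}. snd (subcurve a b c) r \<notin> Z"
      using c(2) by (intro \<rho>(3)[OF sub]) (rule le_less_trans)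
    moreover have "t - a \<in> {0..fst (subcurve a b c)}" using ab by (simp add: subcurve_def)
    ultimately have "snd (subcurve a b c) (t - a) \<notin> Z" by (rule bspec)
    with \<open>snd c t \<in> Z\<close> show False by (simp add: subcurve_def)
  qed
  define v :: "'a \<Rightarrow> ereal" where "v x = ereal (indicator Z x)" for x
  have zero: "endpoint_diff v c = 0" if "c \<in> curves UNIV" "line_integral \<rho>' c < \<infinity>" for c
  proof -
    have "0 \<le> fst c" using that(1) by (auto simp: curves_def)
    then have "snd c 0 \<notin> Z" "snd c (fst c) \<notin> Z" by (auto intro!: avoid[OF that])
    then show ?thesis by (simp add: v_def[abs_def] endpoint_diff_real)
  qed
  have ug: "upper_gradient M v \<rho>'"
    unfolding upper_gradient_def
  proof (intro conjI \<rho>'_borel' ballI)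
    fix c assume "c \<in> curves (space M)"
    then show "endpoint_diff v c \<le> line_integral \<rho>' c"
      using zero[of c] by (cases "line_integral \<rho>' c < \<infinity>") (auto simp: basics(1) top_unique not_less)
  qed
  have "weak_upper_gradient p M v (\<lambda>_. 0)"
    unfolding weak_upper_gradient_def ae_curves_def[symmetric]
  proof (intro conjI ae_curvesI[OF \<rho>'_borel' \<rho>'_fin])
    fix c assume c: "c \<in> curves (space M)" "line_integral \<rho>' c < \<infinity>"
    show "line_integral_defined (\<lambda>_. 0) c" by (simp add: line_integral_defined_def)
    show "endpoint_diff v c \<le> line_integral (\<lambda>_. 0) c" using zero[of c] c by (simp add: basics(1))
  qed simp
  \<comment> \<open>\<open>\<rho>'\<close> is the genuine upper gradient that membership requires,
    but the energy comes from 0, which lies below every gradient. Minimality is checked directly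
    because \<open>M\<close> may have infinite total measure.\<close>
  then have "is_minimal_weak_upper_gradient p M v (\<lambda>_. 0)"
    by (auto simp: is_minimal_weak_upper_gradient_def intro!: Lp_locI)
  then have "is_minimal_weak_upper_gradient p M v (min_weak_upper_gradient p M v)"
    unfolding min_weak_upper_gradient_def by (rule someI[of "is_minimal_weak_upper_gradient p M v"])
  moreover have "(\<lambda>_. 0) \<in> Lp_loc p M" by (rule Lp_locI) simp_all
  ultimately have "AE x in M. min_weak_upper_gradient p M v x \<le> 0"
    using \<open>weak_upper_gradient p M v (\<lambda>_. 0)\<close> by (auto simp: is_minimal_weak_upper_gradient_def)
  then have "energy p M v = (\<integral>\<^sup>+x. 0 \<partial>M)"
    unfolding energy_def by (intro nn_integral_cong_AE) (auto elim!: eventually_mono)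
  moreover have "(\<integral>\<^sup>+x. ennpowr (e2ennreal \<bar>v x\<bar>) p \<partial>M) = (\<integral>\<^sup>+x. 0 \<partial>M)"
    by (intro nn_integral_cong_AE) (use Z(2) in eventually_elim, simp add: v_def e2ennreal_ereal[of 0, simplified])
  ultimately have norm: "newtonian_norm p M v = 0" by (simp add: newtonian_norm_def)
  have "v \<in> borel_measurable M" unfolding v_def using Z_sets by measurable
  then have "v \<in> newtonian_space p M"
    using ug Lp_locI[OF \<rho>'_M \<rho>'_fin] norm by (auto simp: newtonian_space_def)
  moreover have "\<forall>x\<in>Z. v x = 1" by (simp add: v_def one_ereal_def)
  ultimately have "sobolev_capacity p M Z \<le> ennpowr (newtonian_norm p M v) p"
    unfolding sobolev_capacity_def by (intro INF_lower) auto
  then show ?thesis by (simp add: norm)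
qed

lemma sobolev_capacity_mono: "A \<subseteq> B \<Longrightarrow> sobolev_capacity p M A \<le> sobolev_capacity p M B"
  unfolding sobolev_capacity_def by (rule INF_superset_mono) auto

text \<open>The ball around \<open>x\<close> and that around a point \<open>y\<close> of it share an
  open set of positive measure, so their constants agree. The choice of constants is thus locally
  constant, hence constant by connectedness, and a countable cover unites the null sets.\<close>

lemma locally_AE_constant_imp_AE_constant:
  fixes M :: "'a::metric_space measure" and h :: "'a \<Rightarrow> real"
  assumes N: "metric_measure_domain (restrict_space M \<Omega>) p" and M: "space M = UNIV" "sets borel \<subseteq> sets M"
    and \<Omega>: "open \<Omega>" "connected \<Omega>"
    and local: "\<And>x. x \<in> \<Omega> \<Longrightarrow> \<exists>d a. 0 < d \<and> ball x d \<subseteq> \<Omega> \<and> (AE y in M. y \<in> ball x d \<longrightarrow> h y = a)"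
  shows "\<exists>a. AE x in restrict_space M \<Omega>. h x = a"
proof -
  interpret metric_measure_domain "restrict_space M \<Omega>" p by (rule N)
  have space: "space (restrict_space M \<Omega>) = \<Omega>" by (simp add: space_restrict_space M(1))
  have \<Omega>_sets: "\<Omega> \<inter> space M \<in> sets M" using \<Omega>(1) M by auto
  from local have "\<forall>x. \<exists>d a. x \<in> \<Omega> \<longrightarrow> 0 < d \<and> ball x d \<subseteq> \<Omega> \<and> (AE y in M. y \<in> ball x d \<longrightarrow> h y = a)"
    by blast
  then obtain d a where da: "\<And>x. x \<in> \<Omega> \<Longrightarrow> 0 < d x" "\<And>x. x \<in> \<Omega> \<Longrightarrow> ball x (d x) \<subseteq> \<Omega>"
    "\<And>x. x \<in> \<Omega> \<Longrightarrow> AE y in M. y \<in> ball x (d x) \<longrightarrow> h y = a x" by metis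
  have a_eq: "a x = a y" if x: "x \<in> \<Omega>" and y: "y \<in> ball x (d x)" for x y
  proof (rule ccontr)
    assume "a x \<noteq> a y"
    have y': "y \<in> \<Omega>" using da(2)[OF x] y by blast
    have "open (ball x (d x) \<inter> ball y (d y))" "y \<in> ball x (d x) \<inter> ball y (d y)"
      using y da(1)[OF y'] by auto
    then obtain r where r: "0 < r" "ball y r \<subseteq> ball x (d x) \<inter> ball y (d y)" by (meson openE)
    have "AE z in M. z \<notin> ball y r"
      using da(3)[OF x] da(3)[OF y']
    proof eventually_elim
      case (elim z)
      show ?case
      proof
        assume "z \<in> ball y r"
        then have "z \<in> ball x (d x)" "z \<in> ball y (d y)" using r(2) by auto
        with elim \<open>a x \<noteq> a y\<close> show False by simp
      qed
    qed
    then have "AE z in restrict_space M \<Omega>. z \<notin> ball y r \<inter> \<Omega>"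
      unfolding AE_restrict_space_iff[OF \<Omega>_sets] by eventually_elim simp
    moreover have "ball y r \<inter> \<Omega> \<in> sets (restrict_space M \<Omega>)"
      using open_sets[of "ball y r"] by (simp add: space)
    ultimately have "ball y r \<inter> \<Omega> \<in> null_sets (restrict_space M \<Omega>)"
      using AE_iff_null_sets[of "ball y r \<inter> \<Omega>" "restrict_space M \<Omega>"] by simp
    then have "emeasure (restrict_space M \<Omega>) (ball y r \<inter> \<Omega>) = 0" by (rule null_setsD1)
    then show False using ball_pos[of y r] y' r(1) by (simp add: space)
  qed
  have "a constant_on \<Omega>"
  proof (rule locally_constant_imp_constant[OF \<Omega>(2)])
    fix x assume x: "x \<in> \<Omega>"
    have "openin (top_of_set \<Omega>) (ball x (d x))"
      using da(2)[OF x] by (intro open_subset) auto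
    moreover have "x \<in> ball x (d x)" using da(1)[OF x] by simp
    moreover have "\<forall>y\<in>ball x (d x). a y = a x" using a_eq[OF x] by simp
    ultimately show "\<exists>T. openin (top_of_set \<Omega>) T \<and> x \<in> T \<and> (\<forall>y\<in>T. a y = a x)" by blast
  qed
  then obtain b where b: "\<And>x. x \<in> \<Omega> \<Longrightarrow> a x = b" by (auto simp: constant_on_def)
  have "AE x in restrict_space M \<Omega>. h x = b"
  proof (rule AE_local)
    fix x assume "x \<in> space (restrict_space M \<Omega>)"
    then have x: "x \<in> \<Omega>" by (simp add: space)
    have "AE y in restrict_space M \<Omega>. y \<in> ball x (d x) \<longrightarrow> h y = b"
      unfolding AE_restrict_space_iff[OF \<Omega>_sets]
      using da(3)[OF x] by eventually_elim (simp add: b[OF x])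
    then show "\<exists>r>0. AE y in restrict_space M \<Omega>. y \<in> ball x r \<longrightarrow> h y = b"
      using da(1)[OF x] by blast
  qed
  then show ?thesis ..
qed

theorem theorem5p13:
  fixes M :: "'a::metric_space measure" and p :: real and \<Omega> A\<^sub>0 A\<^sub>1 :: "'a set"
  assumes "metric_measure_space M"
    and "1 < p"
    and "\<Omega> \<noteq> {}" and "bounded \<Omega>" and "open \<Omega>"
    and "A\<^sub>0 \<subseteq> \<Omega>" and "A\<^sub>1 \<subseteq> \<Omega>" and "A\<^sub>0 \<inter> A\<^sub>1 = {}"
  shows "(0 < set_distance A\<^sub>0 A\<^sub>1 \<longrightarrow> condenser_capacity p M A\<^sub>0 A\<^sub>1 \<Omega> < \<infinity>) \<and>
    (condenser_capacity p M A\<^sub>0 A\<^sub>1 \<Omega> < \<infinity> \<longrightarrow>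
      (\<exists>u. condenser_minimizer p M A\<^sub>0 A\<^sub>1 \<Omega> u) \<and>
      (zero_weak_upper_gradient_property p M \<and> connected \<Omega> \<and>
         0 < sobolev_capacity p M (A\<^sub>0 \<union> A\<^sub>1) \<longrightarrow>
       (\<forall>u v. condenser_minimizer p M A\<^sub>0 A\<^sub>1 \<Omega> u \<and> condenser_minimizer p M A\<^sub>0 A\<^sub>1 \<Omega> v \<longrightarrow>
          sobolev_capacity p M {x \<in> \<Omega>. u x \<noteq> v x} = 0)))"
proof -
  note M = assms(1) and p = assms(2) and \<Omega> = assms(5) and A = assms(6,7)
  note basics = metric_measure_space_basics[OF M]
  have domain: "metric_measure_domain (restrict_space M \<Omega>) p"
    using assms by (intro metric_measure_domain_restrict_space)
  interpret metric_measure_domain "restrict_space M \<Omega>" p by (rule domain)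
  have space: "space (restrict_space M \<Omega>) = \<Omega>" by (simp add: space_restrict_space basics(1))
  have \<Omega>_sets: "\<Omega> \<in> sets M" using \<Omega> basics(2) by auto
  let ?cap = "condenser_capacity p M A\<^sub>0 A\<^sub>1 \<Omega>"
  let ?adm = "condenser_admissible p M A\<^sub>0 A\<^sub>1 \<Omega>"
  have adm_ereal: "(\<lambda>x. ereal (f x)) \<in> ?adm" if "f \<in> admissible A\<^sub>0 A\<^sub>1" for f
    using that by (simp add: condenser_admissible_def admissible_def space zero_ereal_def one_ereal_def)
  \<comment> \<open>Values between 0 and 1 are finite, so passing to real functions changes nothing
    on \<Omega>.\<close>
  have real_eq: "u x = ereal (real_of_ereal (u x))" if "u \<in> ?adm" "x \<in> \<Omega>" for u x
  proof -
    have "0 \<le> u x" "u x \<le> 1" using that by (simp_all add: condenser_admissible_def)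
    then show ?thesis by (cases "u x") auto
  qed
  have adm_real: "(\<lambda>x. real_of_ereal (u x)) \<in> admissible A\<^sub>0 A\<^sub>1" if u: "u \<in> ?adm" for u
  proof -
    have "(\<lambda>x. ereal (real_of_ereal (u x))) \<in> newtonian_space p (restrict_space M \<Omega>)"
      by (rule newtonian_space_cong[of u])
         (use u real_eq[OF u] in \<open>simp_all add: space condenser_admissible_def\<close>)
    moreover have "0 \<le> real_of_ereal (u x) \<and> real_of_ereal (u x) \<le> 1" if "x \<in> \<Omega>" for x
    proof -
      have "0 \<le> u x" "u x \<le> 1" using that u by (simp_all add: condenser_admissible_def)
      then show ?thesis by (cases "u x") auto
    qed
    moreover have "\<forall>x\<in>A\<^sub>0. u x = 0" "\<forall>x\<in>A\<^sub>1. u x = 1"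
      using u by (simp_all add: condenser_admissible_def)
    ultimately show ?thesis by (simp add: admissible_def space)
  qed
  have energy_real: "E (\<lambda>x. real_of_ereal (u x)) = energy p (restrict_space M \<Omega>) u" if "u \<in> ?adm" for u
    by (rule energy_cong) (use real_eq[OF that] in \<open>simp add: space\<close>)
  have cap: "?cap = min_energy A\<^sub>0 A\<^sub>1"
  proof (rule antisym)
    show "?cap \<le> min_energy A\<^sub>0 A\<^sub>1"
      unfolding condenser_capacity_def by (intro INF_greatest INF_lower adm_ereal)
    show "min_energy A\<^sub>0 A\<^sub>1 \<le> ?cap"
      unfolding condenser_capacity_def
    proof (rule INF_greatest)
      fix u assume u: "u \<in> ?adm"
      show "min_energy A\<^sub>0 A\<^sub>1 \<le> energy p (restrict_space M \<Omega>) u"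
        unfolding energy_real[OF u, symmetric] using adm_real[OF u] by (rule INF_lower)
    qed
  qed
  have finite_capacity: "?cap < \<infinity>" if pos: "0 < set_distance A\<^sub>0 A\<^sub>1"
  proof -
    obtain d where d: "0 < d" "ennreal d \<le> set_distance A\<^sub>0 A\<^sub>1"
    proof (cases "set_distance A\<^sub>0 A\<^sub>1")
      case (real r)
      with pos show ?thesis by (intro that[of r]) simp_all
    next
      \<comment> \<open>The distance is infinite exactly when one of the sets is empty; any positive
        \<open>d\<close> then works.\<close>
      case top
      then show ?thesis by (intro that[of 1]) simp_all
    qed
    have "d \<le> dist x y" if "x \<in> A\<^sub>0" "y \<in> A\<^sub>1" for x y
    proof -
      have "set_distance A\<^sub>0 A\<^sub>1 \<le> ennreal (dist x y)"
        unfolding set_distance_def using that by (intro INF_lower2[of x] INF_lower)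
      with d(2) have "ennreal d \<le> ennreal (dist x y)" by (rule order_trans)
      then show ?thesis by (simp add: ennreal_le_iff)
    qed
    with d(1) have "admissible A\<^sub>0 A\<^sub>1 \<noteq> {}" by (rule admissible_nonempty)
    then obtain f where f: "f \<in> admissible A\<^sub>0 A\<^sub>1" by blast
    have "?cap \<le> E f" unfolding cap using f by (rule INF_lower)
    also have "E f < \<infinity>" using f by (rule admissible_gradientE)
    finally show ?thesis .
  qed
  have existence: "\<exists>u. condenser_minimizer p M A\<^sub>0 A\<^sub>1 \<Omega> u" if fin: "?cap < \<infinity>"
  proof -
    obtain f where f: "f \<in> admissible A\<^sub>0 A\<^sub>1" "E f \<le> ?cap"
      using admissible_minimizer[of A\<^sub>0 A\<^sub>1] fin unfolding cap by blast
    moreover have "?cap \<le> E f" unfolding cap using f(1) by (rule INF_lower)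
    ultimately have "condenser_minimizer p M A\<^sub>0 A\<^sub>1 \<Omega> (\<lambda>x. ereal (f x))"
      unfolding condenser_minimizer_def by (intro conjI adm_ereal antisym)
    then show ?thesis by (intro exI[of _ "\<lambda>x. ereal (f x)"])
  qed
  have uniqueness: "sobolev_capacity p M {x \<in> \<Omega>. u x \<noteq> v x} = 0"
    if zero: "zero_weak_upper_gradient_property p M" and "connected \<Omega>"
      and cap_pos: "0 < sobolev_capacity p M (A\<^sub>0 \<union> A\<^sub>1)"
      and u: "condenser_minimizer p M A\<^sub>0 A\<^sub>1 \<Omega> u" and v: "condenser_minimizer p M A\<^sub>0 A\<^sub>1 \<Omega> v" for u v
  proof -
    have uv: "u \<in> ?adm" "v \<in> ?adm" using u v by (simp_all add: condenser_minimizer_def)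
    define f where "f x = real_of_ereal (u x)" for x
    define f' where "f' x = real_of_ereal (v x)" for x
    have adm: "f \<in> admissible A\<^sub>0 A\<^sub>1" "f' \<in> admissible A\<^sub>0 A\<^sub>1"
      using adm_real[OF uv(1)] adm_real[OF uv(2)] by (simp_all add: f_def[abs_def] f'_def[abs_def])
    have E_eq: "E f = ?cap" "E f' = ?cap"
      using energy_real[OF uv(1)] energy_real[OF uv(2)] u v
      by (simp_all add: f_def[abs_def] f'_def[abs_def] condenser_minimizer_def)
    have diff: "wug (\<lambda>x. f x - f' x) (\<lambda>_. 0)"
      using adm E_eq unfolding cap by (rule minimizers_difference_zero_gradient)
    \<comment> \<open>Extension by 0, because the zero gradient property asks for a function
      measurable on the whole space.\<close>
    define h where "h x = indicator \<Omega> x *\<^sub>R (f x - f' x)" for x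
    have "(\<lambda>x. f x - f' x) \<in> borel_measurable (restrict_space M \<Omega>)"
      using adm by (intro borel_measurable_diff) (auto elim: admissible_gradientE)
    then have h_meas: "h \<in> borel_measurable M"
      using \<Omega>_sets basics(1) unfolding h_def by (simp add: borel_measurable_restrict_space_iff)
    have wug_h: "wug h (\<lambda>_. 0)"
      using diff by (subst wug_cong[of _ "\<lambda>x. ereal (f x - f' x)"]) (simp_all add: space h_def)
    have local: "\<exists>d a. 0 < d \<and> ball x d \<subseteq> \<Omega> \<and> (AE y in M. y \<in> ball x d \<longrightarrow> h y = a)" if x: "x \<in> \<Omega>" for x
    proof -
      obtain r where r: "0 < r" "ball x r \<subseteq> \<Omega>" using \<Omega> x by (meson openE)
      have "ball x r \<in> sets M" using basics(2) by auto
      then have "weak_upper_gradient p (restrict_space M (ball x r)) (\<lambda>x. ereal (h x)) (\<lambda>_. 0)"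
        using r(2) \<Omega>_sets \<Omega> basics(1) p wug_h
        by (intro weak_upper_gradient_zero_restrict[of "ball x r" \<Omega>]) auto
      moreover have "(\<lambda>x. ereal (h x)) \<in> borel_measurable M" using h_meas by measurable
      \<comment> \<open>The bound \<open>d <= r\<close> keeps the smaller ball inside
        \<Omega>.\<close>
      ultimately obtain d c where d: "0 < d" "d \<le> r" "AE y in M. y \<in> ball x d \<longrightarrow> ereal (h y) = c"
        using zero r(1) unfolding zero_weak_upper_gradient_property_def by blast
      have "AE y in M. y \<in> ball x d \<longrightarrow> h y = real_of_ereal c"
        using d(3) by eventually_elim auto
      moreover have "ball x d \<subseteq> \<Omega>" using subset_ball[OF d(2)] r(2) by (rule order_trans)
      ultimately show ?thesis using d(1) by blast
    qed
    obtain a where "AE x in restrict_space M \<Omega>. h x = a"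
      using locally_AE_constant_imp_AE_constant[OF domain basics(1,2) \<Omega> \<open>connected \<Omega>\<close> local] ..
    with AE_space have AE_a: "AE x in restrict_space M \<Omega>. f x - f' x = a"
      by eventually_elim (simp add: space h_def)
    define Z where "Z = {x \<in> \<Omega>. f x - f' x \<noteq> a}"
    have "(\<lambda>_. 0) \<in> Lp_loc p (restrict_space M \<Omega>)" by (rule Lp_locI) simp_all
    from wug_AE_const[OF this diff AE_a]
    have "ae_curves p (restrict_space M \<Omega>) (\<lambda>c. \<forall>t\<in>{0..fst c}. snd c t \<notin> Z)"
      by (rule ae_curves_mono) (simp add: Z_def)
    moreover have "AE x in M. x \<notin> Z"
      using AE_a \<Omega>_sets basics(1) by (subst (asm) AE_restrict_space_iff) (auto simp: Z_def elim: eventually_mono)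
    ultimately have cap_Z: "sobolev_capacity p M Z = 0"
      by (intro sobolev_capacity_eq_0[OF M p \<Omega>]) (auto simp: Z_def)
    have "a = 0"
    proof (rule ccontr)
      assume "a \<noteq> 0"
      have "f x - f' x = 0" if "x \<in> A\<^sub>0 \<union> A\<^sub>1" for x
        using that adm by (auto simp: admissible_def)
      then have "A\<^sub>0 \<union> A\<^sub>1 \<subseteq> Z" using A \<open>a \<noteq> 0\<close> by (auto simp: Z_def)
      from sobolev_capacity_mono[OF this, of p M] cap_Z cap_pos show False by simp
    qed
    moreover have "u x = ereal (f x)" "v x = ereal (f' x)" if "x \<in> \<Omega>" for x
      using real_eq[OF uv(1) that] real_eq[OF uv(2) that] by (simp_all add: f_def f'_def)
    ultimately have "{x \<in> \<Omega>. u x \<noteq> v x} = Z" by (auto simp: Z_def)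
    with cap_Z show ?thesis by simp
  qed
  show ?thesis using finite_capacity existence uniqueness by blast
qed

end
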